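(* Let $c_1,c_2\ge 0$, $b_1,b_2>0$, let $D=[c_1,c_1+b_1]\times[c_2,c_2+b_2]$, and let the buyer's valuation $z=(z_1,z_2)$ be uniformly distributed on $D$. Suppose that $$\Big(c_1\le b_1 \text{ and } c_2\le \tfrac{2b_2(b_1+c_1)}{b_1+3c_1}\Big)\quad\text{or}\quad\Big(c_2\le b_2\text{ and } c_1\le \tfrac{2b_1(b_2+c_2)}{b_2+3c_2}\Big).$$ Then the optimal mechanism has one of the four structures (a), (b), (b'), (c) described in the context. The exact structure and the values of the parameters $(p_{a_i},a_i,p)$ are given as follows (with $r_i$, $p^*_{a_i}$, $p^*$ as in the context, and $-i$ denoting the index in $\{1,2\}$ other than $i$). (a) If there exist $p_{a_1}\in[r_1,p_{a_1}^*]$ and $p_{a_2}\in[r_2,p_{a_2}^*]$ solving simultaneously $$(c_1-c_2-2(b_1-b_2)-(p_{a_1}-p_{a_2}))(c_1-2b_1+3p_{a_2})(c_2-2b_2+3p_{a_1})+8c_1(b_2-p_{a_1})(c_1-2b_1+3p_{a_2})-8c_2(b_1-p_{a_2})(c_2-2b_2+3p_{a_1})=0$$ and $$3\prod_{i=1}^2\big(b_i(c_{-i}-2b_{-i}+3p_{a_i})-4c_i(b_{-i}-p_{a_i})\big)-\sum_{i=1}^2\big(b_i(c_{-i}-2b_{-i}+3p_{a_i})-4c_i(b_{-i}-p_{a_i})\big)(c_i-2b_i+3p_{a_{-i}})(c_{-i}+b_{-i})$$ $$-\frac38\prod_{i=1}^2\big((2b_{-i}-c_{-i}-p_{a_i})(c_i-2b_i+3p_{a_{-i}})-8c_{-i}(b_i-p_{a_{-i}})\big)=0,$$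 then the optimal mechanism is that of structure (a) with these $p_{a_1},p_{a_2}$, where the values of $a_1,a_2,p$ are found from $$a_1=\frac{(c_2-2b_2+3p_{a_1})^2}{8c_1(b_2-p_{a_1})},\qquad a_2=\frac{(c_1-2b_1+3p_{a_2})^2}{8c_2(b_1-p_{a_2})},$$ $$p=\frac{4c_1(b_2-p_{a_1})}{c_2-2b_2+3p_{a_1}}+\frac{2b_2-c_2-p_{a_1}}{2}=\frac{2b_1-c_1-p_{a_2}}{2}+\frac{4c_2(b_1-p_{a_2})}{c_1-2b_1+3p_{a_2}}.$$ (b) If (i) the condition in (a) does not hold, and (ii) there exists $p_{a_1}\in[r_1,p_{a_1}^*]$ solving $$-8c_1b_2^2+(c_2b_1-b_2b_1-b_2c_1)(c_2-2b_2)+\Big(\frac{c_2}{2}-b_1\Big)(c_2-2b_2)^2-\frac38(c_2-2b_2)^3$$ $$+\Big(c_1(4c_2-3b_2)+3b_1b_2+2(c_2-2c_1)(c_2-2b_2)-\frac{15}{8}(c_2-2b_2)^2\Big)p_{a_1}+\Big(\frac{3c_2}{2}-\frac{21}{8}(c_2-2b_2)\Big)p_{a_1}^2-\frac98p_{a_1}^3=0,$$ then the optimal mechanism is that of structure (b) with this $p_{a_1}$, where the values of $a_1,p$ are found from $$a_1=\frac{(c_2-2b_2+3p_{a_1})^2}{8c_1(b_2-p_{a_1})},\qquad p=\frac{4c_1(b_2-p_{a_1})}{c_2-2b_2+3p_{a_1}}+\frac{2b_2-c_2-p_{a_1}}{2}.$$ If (i) and (ii) hold with the roles of the indices $1$ and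 $2$ swapped, that is, if the condition in (a) does not hold and there exists $p_{a_2}\in[r_2,p_{a_2}^*]$ solving $$-8c_2b_1^2+(c_1b_2-b_2b_1-b_1c_2)(c_1-2b_1)+\Big(\frac{c_1}{2}-b_2\Big)(c_1-2b_1)^2-\frac38(c_1-2b_1)^3$$ $$+\Big(c_2(4c_1-3b_1)+3b_1b_2+2(c_1-2c_2)(c_1-2b_1)-\frac{15}{8}(c_1-2b_1)^2\Big)p_{a_2}+\Big(\frac{3c_1}{2}-\frac{21}{8}(c_1-2b_1)\Big)p_{a_2}^2-\frac98p_{a_2}^3=0,$$ then the optimal mechanism is that of structure (b') with this $p_{a_2}$, where the values of $a_2,p$ are found from $$a_2=\frac{(c_1-2b_1+3p_{a_2})^2}{8c_2(b_1-p_{a_2})},\qquad p=\frac{4c_2(b_1-p_{a_2})}{c_1-2b_1+3p_{a_2}}+\frac{2b_1-c_1-p_{a_2}}{2}.$$ (c) If none of the conditions in (a) and (b) (including the swapped version in (b)) holds, then the optimal mechanism is that of structure (c) with $p=p^*$.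
   Context: A seller sells two items to one buyer with valuation $z=(z_1,z_2)\in D$. A (direct) mechanism is a pair of an allocation function $q:D\to[0,1]^2$ and a payment function $t:D\to\mathbb{R}_{\ge0}$. It is incentive compatible if $z\cdot q(z)-t(z)\ge z\cdot q(\hat z)-t(\hat z)$ for all $z,\hat z\in D$, and individually rational if $z\cdot q(z)-t(z)\ge0$ for all $z\in D$. A mechanism is optimal if it maximizes the expected revenue $\mathbb{E}[t(z)]$ among all incentive compatible and individually rational mechanisms. "The optimal mechanism is X" means that mechanism X is optimal. A menu is a finite set of pairs (allocation, price). The mechanism induced by a menu assigns to each $z\in D$ an allocation $q$ and price $t$ from the menu maximizing $z\cdot q-t$ (ties broken arbitrarily). Constants: for $i=1,2$, $$p_{a_i}^*=\frac{2b_{-i}-c_{-i}}{3}-\frac{4c_i}{9}+\frac29\sqrt{2c_i(2c_i+3(b_{-i}+c_{-i}))},\qquad r_i=\frac{2b_{-i}(2b_i+5c_i)-c_{-i}(2b_i-3c_i)}{3(2b_i+3c_i)},$$ $$p^*=\frac{\sqrt{(c_1+c_2)^2+6b_1b_2}-c_1-c_2}{3}.$$ Structures (each a mechanism induced by a menu): (a) Menu: $(0,0)$ at price $0$; $(a_1,1)$ at price $a_1c_1+c_2+p_{a_1}$; $(1,a_2)$ at price $c_1+a_2c_2+p_{a_2}$; $(1,1)$ at price $c_1+c_2+p$. (The no-sale region in the bottom-left of $D$ is bounded by a segment of $a_1(z_1-c_1)+(z_2-c_2)=p_{a_1}$ starting at $(c_1,c_2+p_{a_1})$, a segment of $z_1+z_2=c_1+c_2+p$,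 and a segment of $(z_1-c_1)+a_2(z_2-c_2)=p_{a_2}$ ending at $(c_1+p_{a_2},c_2)$; the $(a_1,1)$ region is at the top left, the $(1,a_2)$ region at the bottom right.) (b) Menu: $(0,0)$ at price $0$; $(a_1,1)$ at price $a_1c_1+c_2+p_{a_1}$; $(1,1)$ at price $c_1+c_2+p$. (b') Menu: $(0,0)$ at price $0$; $(1,a_2)$ at price $c_1+a_2c_2+p_{a_2}$; $(1,1)$ at price $c_1+c_2+p$. (c) Menu: $(0,0)$ at price $0$; $(1,1)$ at price $c_1+c_2+p$ (pure bundling).
   Formalization: The rule in (a) is stated only for c_1, c_2 > 0, since at c_i = 0 its equations hold identically in the other unknown and the formulas for a_i and p read 0/0; in the other cases, formulas whose denominator vanishes impose no constraint. *)

theory Defs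
  imports "HOL-Analysis.Analysis"
begin

type_synonym valuation = "real \<times> real"
type_synonym alloc = "real \<times> real"

section \<open>Mechanisms for two items\<close>

definition valuations :: "real \<Rightarrow> real \<Rightarrow> real \<Rightarrow> real \<Rightarrow> valuation set" where
  "valuations c1 c2 b1 b2 = {c1..c1 + b1} \<times> {c2..c2 + b2}"

text \<open>Mechanisms are functions on \<open>D\<close>; their values outside \<open>D\<close> are irrelevant to every notion below.\<close>

definition mechanism :: "valuation set \<Rightarrow> (valuation \<Rightarrow> alloc) \<Rightarrow> (valuation \<Rightarrow> real) \<Rightarrow> bool" where
  "mechanism D q t \<longleftrightarrow> (\<forall>z\<in>D. q z \<in> {0..1} \<times> {0..1} \<and> 0 \<le> t z)"

definition incentive_compatible ::
    "valuation set \<Rightarrow> (valuation \<Rightarrow> alloc) \<Rightarrow> (valuation \<Rightarrow> real) \<Rightarrow> bool" where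
  "incentive_compatible D q t \<longleftrightarrow> (\<forall>z\<in>D. \<forall>z'\<in>D. z \<bullet> q z - t z \<ge> z \<bullet> q z' - t z')"

definition individually_rational ::
    "valuation set \<Rightarrow> (valuation \<Rightarrow> alloc) \<Rightarrow> (valuation \<Rightarrow> real) \<Rightarrow> bool" where
  "individually_rational D q t \<longleftrightarrow> (\<forall>z\<in>D. z \<bullet> q z - t z \<ge> 0)"

text \<open>
  Expected payment for a valuation uniformly distributed on \<open>D\<close>.  The completed measure is used
  because arbitrary tie breaking on null sets may destroy Borel measurability; on a rectangle, the
  payment function of an incentive compatible, individually rational mechanism is bounded and
  Lebesgue measurable (the utility is convex), hence no integrability side condition is needed.
\<close>

definition expected_revenue :: "valuation set \<Rightarrow> (valuation \<Rightarrow> real) \<Rightarrow> real" where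
  "expected_revenue D t = (\<integral>z. t z \<partial>uniform_measure (lebesgue_on D) D)"

definition optimal_mechanism ::
    "valuation set \<Rightarrow> (valuation \<Rightarrow> alloc) \<Rightarrow> (valuation \<Rightarrow> real) \<Rightarrow> bool" where
  "optimal_mechanism D q t \<longleftrightarrow>
     mechanism D q t \<and> incentive_compatible D q t \<and> individually_rational D q t \<and>
     (\<forall>q' t'. mechanism D q' t' \<and> incentive_compatible D q' t' \<and> individually_rational D q' t' \<longrightarrow>
        expected_revenue D t' \<le> expected_revenue D t)"

section \<open>Menus\<close>

type_synonym menu = "(alloc \<times> real) set"

definition induced_by ::
    "valuation set \<Rightarrow> menu \<Rightarrow> (valuation \<Rightarrow> alloc) \<Rightarrow> (valuation \<Rightarrow> real) \<Rightarrow> bool" where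
  "induced_by D M q t \<longleftrightarrow>
     (\<forall>z\<in>D. (q z, t z) \<in> M \<and> (\<forall>(x, s)\<in>M. z \<bullet> x - s \<le> z \<bullet> q z - t z))"

text \<open>Ties may be broken arbitrarily: every mechanism induced by the menu has to be optimal.\<close>

definition optimal_menu :: "valuation set \<Rightarrow> menu \<Rightarrow> bool" where
  "optimal_menu D M \<longleftrightarrow>
     finite M \<and> (\<forall>(x, s)\<in>M. x \<in> {0..1} \<times> {0..1}) \<and>
     (\<forall>q t. induced_by D M q t \<longrightarrow> optimal_mechanism D q t)"

definition menu_a ::
    "real \<Rightarrow> real \<Rightarrow> real \<Rightarrow> real \<Rightarrow> real \<Rightarrow> real \<Rightarrow> real \<Rightarrow> menu" where
  "menu_a c1 c2 a1 pa1 a2 pa2 p =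
     {((0, 0), 0), ((a1, 1), a1 * c1 + c2 + pa1), ((1, a2), c1 + a2 * c2 + pa2),
      ((1, 1), c1 + c2 + p)}"

definition menu_b :: "real \<Rightarrow> real \<Rightarrow> real \<Rightarrow> real \<Rightarrow> real \<Rightarrow> menu" where
  "menu_b c1 c2 a1 pa1 p =
     {((0, 0), 0), ((a1, 1), a1 * c1 + c2 + pa1), ((1, 1), c1 + c2 + p)}"

definition menu_b' :: "real \<Rightarrow> real \<Rightarrow> real \<Rightarrow> real \<Rightarrow> real \<Rightarrow> menu" where
  "menu_b' c1 c2 a2 pa2 p =
     {((0, 0), 0), ((1, a2), c1 + a2 * c2 + pa2), ((1, 1), c1 + c2 + p)}"

definition menu_c :: "real \<Rightarrow> real \<Rightarrow> real \<Rightarrow> menu" where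
  "menu_c c1 c2 p = {((0, 0), 0), ((1, 1), c1 + c2 + p)}"

text \<open>
  Geometry of structure (a): in \<open>D\<close>, the no-sale region is bounded by the (possibly degenerate)
  segments joining \<open>(c1, c2 + pa1)\<close>, \<open>(x1, y1)\<close>, \<open>(x2, y2)\<close> and \<open>(c1 + pa2, c2)\<close>, along which the
  buyer is indifferent between no sale and \<open>(a1, 1)\<close>, \<open>(1, 1)\<close>, \<open>(1, a2)\<close> respectively.
\<close>

definition no_sale_shape_a ::
    "real \<Rightarrow> real \<Rightarrow> real \<Rightarrow> real \<Rightarrow> real \<Rightarrow> real \<Rightarrow> real \<Rightarrow> real \<Rightarrow> real \<Rightarrow> bool" where
  "no_sale_shape_a c1 c2 b1 b2 a1 pa1 a2 pa2 p \<longleftrightarrow>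
     (\<exists>x1 y1 x2 y2.
        a1 * (x1 - c1) + (y1 - c2) = pa1 \<and> x1 + y1 = c1 + c2 + p \<and>
        x2 + y2 = c1 + c2 + p \<and> (x2 - c1) + a2 * (y2 - c2) = pa2 \<and>
        c1 \<le> x1 \<and> x1 \<le> x2 \<and> x2 \<le> c1 + pa2 \<and> c1 + pa2 \<le> c1 + b1 \<and>
        c2 \<le> y2 \<and> y2 \<le> y1 \<and> y1 \<le> c2 + pa1 \<and> c2 + pa1 \<le> c2 + b2)"

section \<open>Parameters\<close>

text \<open>
  In the following, \<open>ci\<close>, \<open>bi\<close> are the constants of item \<open>i\<close>, \<open>cj\<close>, \<open>bj\<close> those of the other item,
  and \<open>pa\<close> stands for \<open>p\<^sub>a\<^sub>i\<close>.
\<close>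

definition pa_max :: "real \<Rightarrow> real \<Rightarrow> real \<Rightarrow> real \<Rightarrow> real" where
  "pa_max ci cj bi bj =
     (2 * bj - cj) / 3 - 4 * ci / 9 + 2 / 9 * sqrt (2 * ci * (2 * ci + 3 * (bj + cj)))"

definition pa_min :: "real \<Rightarrow> real \<Rightarrow> real \<Rightarrow> real \<Rightarrow> real" where
  "pa_min ci cj bi bj =
     (2 * bj * (2 * bi + 5 * ci) - cj * (2 * bi - 3 * ci)) / (3 * (2 * bi + 3 * ci))"

definition p_bundle :: "real \<Rightarrow> real \<Rightarrow> real \<Rightarrow> real \<Rightarrow> real" where
  "p_bundle c1 c2 b1 b2 = (sqrt ((c1 + c2)^2 + 6 * b1 * b2) - c1 - c2) / 3"

text \<open>
  The parameters \<open>a\<^sub>i\<close> and \<open>p\<close> are found from \<open>pa\<close>.  For \<open>ci > 0\<close> and \<open>pa\<close> in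
  \<open>{pa_min..pa_max}\<close> both denominators are positive.  For \<open>ci = 0\<close> that interval is a single point
  at which both formulas read \<open>0 / 0\<close>; then they impose no constraint (rather than the value \<open>0\<close>).
\<close>

definition params_from :: "real \<Rightarrow> real \<Rightarrow> real \<Rightarrow> real \<Rightarrow> real \<Rightarrow> real \<Rightarrow> bool" where
  "params_from ci cj bj pa a p \<longleftrightarrow>
     (8 * ci * (bj - pa) \<noteq> 0 \<longrightarrow>
        a = (cj - 2 * bj + 3 * pa)^2 / (8 * ci * (bj - pa))) \<and>
     (cj - 2 * bj + 3 * pa \<noteq> 0 \<longrightarrow>
        p = 4 * ci * (bj - pa) / (cj - 2 * bj + 3 * pa) + (2 * bj - cj - pa) / 2)"

text \<open>
  For \<open>c1 = 0\<close> (hence \<open>c2 - 2 * b2 + 3 * pa1 = 0\<close> on the admissible range) both equations below hold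
  for every \<open>pa2\<close>, and symmetrically for \<open>c2 = 0\<close>.  So a solution singles out structure (a) only if
  \<open>c1\<close> and \<open>c2\<close> are positive: for \<open>c1 = 0\<close>, \<open>c2 = 0.01\<close>, \<open>b1 = 10\<close>, \<open>b2 = 1\<close> there are solutions,
  but structure (b) is the optimal one.
\<close>

definition solves_a :: "real \<Rightarrow> real \<Rightarrow> real \<Rightarrow> real \<Rightarrow> real \<Rightarrow> real \<Rightarrow> bool" where
  "solves_a c1 c2 b1 b2 pa1 pa2 \<longleftrightarrow>
     pa1 \<in> {pa_min c1 c2 b1 b2..pa_max c1 c2 b1 b2} \<and>
     pa2 \<in> {pa_min c2 c1 b2 b1..pa_max c2 c1 b2 b1} \<and>
     (c1 - c2 - 2 * (b1 - b2) - (pa1 - pa2)) * (c1 - 2 * b1 + 3 * pa2) * (c2 - 2 * b2 + 3 * pa1)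
       + 8 * c1 * (b2 - pa1) * (c1 - 2 * b1 + 3 * pa2)
       - 8 * c2 * (b1 - pa2) * (c2 - 2 * b2 + 3 * pa1) = 0 \<and>
     3 * ((b1 * (c2 - 2 * b2 + 3 * pa1) - 4 * c1 * (b2 - pa1))
          * (b2 * (c1 - 2 * b1 + 3 * pa2) - 4 * c2 * (b1 - pa2)))
       - ((b1 * (c2 - 2 * b2 + 3 * pa1) - 4 * c1 * (b2 - pa1)) * (c1 - 2 * b1 + 3 * pa2) * (c2 + b2)
          + (b2 * (c1 - 2 * b1 + 3 * pa2) - 4 * c2 * (b1 - pa2)) * (c2 - 2 * b2 + 3 * pa1) * (c1 + b1))
       - 3 / 8 * (((2 * b2 - c2 - pa1) * (c1 - 2 * b1 + 3 * pa2) - 8 * c2 * (b1 - pa2))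
          * ((2 * b1 - c1 - pa2) * (c2 - 2 * b2 + 3 * pa1) - 8 * c1 * (b2 - pa1))) = 0"

definition solves_b :: "real \<Rightarrow> real \<Rightarrow> real \<Rightarrow> real \<Rightarrow> real \<Rightarrow> bool" where
  "solves_b ci cj bi bj pa \<longleftrightarrow>
     pa \<in> {pa_min ci cj bi bj..pa_max ci cj bi bj} \<and>
     - 8 * ci * bj^2 + (cj * bi - bj * bi - bj * ci) * (cj - 2 * bj)
       + (cj / 2 - bi) * (cj - 2 * bj)^2 - 3 / 8 * (cj - 2 * bj)^3
       + (ci * (4 * cj - 3 * bj) + 3 * bi * bj + 2 * (cj - 2 * ci) * (cj - 2 * bj)
          - 15 / 8 * (cj - 2 * bj)^2) * pa
       + (3 * cj / 2 - 21 / 8 * (cj - 2 * bj)) * pa^2 - 9 / 8 * pa^3 = 0"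

section \<open>The optimal mechanism has a given structure\<close>

definition optimal_a :: "real \<Rightarrow> real \<Rightarrow> real \<Rightarrow> real \<Rightarrow> real \<Rightarrow> real \<Rightarrow> bool" where
  "optimal_a c1 c2 b1 b2 pa1 pa2 \<longleftrightarrow>
     (\<exists>a1 a2 p. params_from c1 c2 b2 pa1 a1 p \<and> params_from c2 c1 b1 pa2 a2 p \<and>
        no_sale_shape_a c1 c2 b1 b2 a1 pa1 a2 pa2 p \<and>
        optimal_menu (valuations c1 c2 b1 b2) (menu_a c1 c2 a1 pa1 a2 pa2 p))"

definition optimal_b :: "real \<Rightarrow> real \<Rightarrow> real \<Rightarrow> real \<Rightarrow> real \<Rightarrow> bool" where
  "optimal_b c1 c2 b1 b2 pa1 \<longleftrightarrow>
     (\<exists>a1 p. params_from c1 c2 b2 pa1 a1 p \<and>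
        optimal_menu (valuations c1 c2 b1 b2) (menu_b c1 c2 a1 pa1 p))"

definition optimal_b' :: "real \<Rightarrow> real \<Rightarrow> real \<Rightarrow> real \<Rightarrow> real \<Rightarrow> bool" where
  "optimal_b' c1 c2 b1 b2 pa2 \<longleftrightarrow>
     (\<exists>a2 p. params_from c2 c1 b1 pa2 a2 p \<and>
        optimal_menu (valuations c1 c2 b1 b2) (menu_b' c1 c2 a2 pa2 p))"

definition optimal_c :: "real \<Rightarrow> real \<Rightarrow> real \<Rightarrow> real \<Rightarrow> bool" where
  "optimal_c c1 c2 b1 b2 \<longleftrightarrow>
     optimal_menu (valuations c1 c2 b1 b2) (menu_c c1 c2 (p_bundle c1 c2 b1 b2))"

end

theory Submission
  imports Defs
begin

text \<open>
  The revenue of an incentive compatible mechanism is a linear functional of its utility \<open>u\<close>: integration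
  by parts gives positive masses on the top and right edge of \<open>D\<close> and negative masses on the left edge,
  the bottom edge and the interior.  So it suffices to show that this functional is \<open>\<le> 0\<close> on
  \<open>d = u - u*\<close>, where \<open>u*\<close> is the utility of the menu.  On the no-sale region \<open>d\<close> is nonnegative and the mass is
  negative.  Where item \<open>i\<close> is sold for sure, \<open>d\<close> decreases in \<open>z\<^sub>i\<close>, so negative mass may be moved to
  the top or right edge.  On the part of the top edge above the \<open>(a1, 1)\<close> region the resulting mass is
  negative, positive, negative with zero total and zero mean, and \<open>d\<close> is convex there; this zero mean
  determines \<open>a1\<close> as a function of \<open>p\<^sub>a\<^sub>1\<close>.  The rest, the \<open>(1, 1)\<close> region, balances by monotonicity
  exactly if the total mass is zero, and this is the equation for \<open>p\<close> in each case of the theorem.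
  If the partial allocation with \<open>a\<^sub>i\<close> is on the menu exactly when \<open>p\<close> exceeds \<open>p\<^sub>a\<^sub>i*\<close>, the total mass is a
  continuous function of \<open>p\<close>; the intermediate value theorem yields a root, and its position relative to the \<open>p\<^sub>a\<^sub>i*\<close>
  decides between the structures.
\<close>

section \<open>Utilities and revenue\<close>

text \<open>Moving the mass as described presupposes that the two junctions of the no-sale boundary
  come in the right order, \<open>L1 + L2 <= p\<close>. This inequality is the main obstacle. The
  restriction on \<open>c1\<close>, \<open>c2\<close> enters through it
  (\<open>cut_near_left\<close>, \<open>bundle_junction_le\<close>,
  \<open>bundle_junctions\<close>), and in (a) it is the lower end of the range of
  \<open>pa1\<close> that rules out a root with crossing junctions. The constant
  \<open>pa_max\<close> is the value of \<open>p\<close> at which \<open>a_i\<close> reaches 1. For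
  smaller \<open>p\<close> the allocation stays at 1 and the left edge carries more mass than
  convexity on the top edge can take; the surplus \<open>g1\<close> travels horizontally to the
  right edge, which is possible because \<open>(1, 1)\<close> is sold all along the way. The
  polynomials of the theorem are mass balances multiplied by
  \<open>v_i = c_j - 2 b_j + 3 pa_i\<close>. If \<open>c_i = 0\<close>, the admissible range forces
  \<open>v_i = 0\<close>, the equations hold identically, and \<open>p\<close> cannot be read off
  from them; such cases are settled through the bare existence of a structure.\<close>

lemma antiderivative_on_real_line:
  fixes g :: "real \<Rightarrow> real"
  assumes "continuous_on UNIV g"
  obtains G where "\<And>x. x \<in> {a<..<b} \<Longrightarrow> (G has_real_derivative g x) (at x)"
proof -
  have "continuous_on {a..b} g"
    using assms continuous_on_subset by blast
  then obtain G where G: "\<And>x. x \<in> {a..b} \<Longrightarrow> (G has_vector_derivative g x) (at x within {a..b})"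
    using antiderivative_continuous by blast
  have "(G has_real_derivative g x) (at x)" if "x \<in> {a<..<b}" for x
    using G[of x] that at_within_Icc_at[of a x b]
    by (simp add: has_real_derivative_iff_has_vector_derivative)
  then show ?thesis using that by blast
qed

text \<open>Integration by parts for \<open>x * g' x\<close> although \<open>g\<close> is only
  continuous: the whole integral is differentiated in the shift \<open>e\<close>, so no derivative
  of \<open>g\<close> is formed.\<close>

lemma DERIV_integral_weighted_increment:
  fixes g :: "real \<Rightarrow> real"
  assumes cont: "continuous_on UNIV g" and ab: "a \<le> b"
  shows "((\<lambda>e. integral {a..b} (\<lambda>x. x * (g (x + e) - g x))) has_real_derivative
           b * g b - a * g a - integral {a..b} g) (at 0)"
proof -
  obtain G where G: "\<And>x. x \<in> {a-1<..<b+1} \<Longrightarrow> (G has_real_derivative g x) (at x)"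
    using antiderivative_on_real_line[OF cont] by blast
  have cont': "continuous_on UNIV (\<lambda>x. x * g x)"
    by (intro continuous_intros cont)
  obtain F where F: "\<And>x. x \<in> {a-1<..<b+1} \<Longrightarrow> (F has_real_derivative x * g x) (at x)"
    using antiderivative_on_real_line[OF cont'] by blast
  \<comment> \<open>\<open>x * g (x + e) = (x + e) * g (x + e) - e * g (x + e)\<close>, and shifts
    of \<open>F\<close> and \<open>G\<close> are antiderivatives of the two terms.\<close>
  define H where "H e = (F (b + e) - F b) - (F (a + e) - F a) - e * (G (b + e) - G (a + e))" for e
  have int: "integral {a..b} (\<lambda>x. x * (g (x + e) - g x)) = H e" if "e \<in> {-1<..<1}" for e
  proof -
    have "((\<lambda>x. x * (g (x + e) - g x)) has_integral
            (F (b + e) - F b - e * G (b + e)) - (F (a + e) - F a - e * G (a + e))) {a..b}"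
    proof (rule fundamental_theorem_of_calculus[OF ab])
      fix x assume x: "x \<in> {a..b}"
      have "((\<lambda>x. F (x + e)) has_real_derivative (x + e) * g (x + e)) (at x)"
        using F[of "x + e"] x that by (simp add: DERIV_shift)
      moreover have "((\<lambda>x. G (x + e)) has_real_derivative g (x + e)) (at x)"
        using G[of "x + e"] x that by (simp add: DERIV_shift)
      moreover have "(F has_real_derivative x * g x) (at x)"
        using F[of x] x by simp
      ultimately have "((\<lambda>x. F (x + e) - F x - e * G (x + e)) has_real_derivative
          (x + e) * g (x + e) - x * g x - e * g (x + e)) (at x)"
        by (intro DERIV_diff DERIV_cmult)
      then show "((\<lambda>x. F (x + e) - F x - e * G (x + e)) has_vector_derivative
          x * (g (x + e) - g x)) (at x within {a..b})"
        by (simp add: has_real_derivative_iff_has_vector_derivative[symmetric] algebra_simps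
            has_field_derivative_at_within)
    qed
    then show ?thesis
      by (simp add: integral_unique H_def algebra_simps)
  qed
  have shift: "((\<lambda>e. f (y + e)) has_real_derivative d) (at 0)"
    if "(f has_real_derivative d) (at y)" for f :: "real \<Rightarrow> real" and y d
    using DERIV_shift[of f d 0 y] that by (simp add: add.commute)
  have "G b - G a = integral {a..b} g"
  proof -
    have "(g has_integral G b - G a) {a..b}"
      by (rule fundamental_theorem_of_calculus[OF ab])
        (simp add: has_real_derivative_iff_has_vector_derivative[symmetric]
            has_field_derivative_at_within G)
    then show ?thesis by (simp add: integral_unique)
  qed
  moreover have "(H has_real_derivative
      ((b * g b - 0) - (a * g a - 0)) - (1 * (G (b + 0) - G (a + 0)) + (g b - g a) * 0)) (at 0)"
    unfolding H_def
    by (intro DERIV_diff DERIV_mult DERIV_const DERIV_ident shift F G) (use ab in simp_all)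
  ultimately have "(H has_real_derivative b * g b - a * g a - integral {a..b} g) (at 0)"
    by simp
  then show ?thesis
    by (rule has_field_derivative_transform_within_open[where S = "{-1<..<1}"]) (use int in auto)
qed

definition utility :: "(valuation \<Rightarrow> alloc) \<Rightarrow> (valuation \<Rightarrow> real) \<Rightarrow> valuation \<Rightarrow> real" where
  "utility q t z = z \<bullet> q z - t z"

text \<open>A supremum of affine functions with slopes \<open>q z\<close> makes sense on the whole
  plane, is finite because payments are nonnegative, and agrees with the utility on \<open>D\<close>
  by incentive compatibility. The extension is needed because shifting a valuation by
  \<open>e\<close> may leave \<open>D\<close>.\<close>

lemma utility_extension:
  assumes mech: "mechanism D q t" and ic: "incentive_compatible D q t" and ne: "D \<noteq> {}"
  obtains U where "continuous_on UNIV U"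
    and "\<And>z. z \<in> D \<Longrightarrow> U z = utility q t z"
    and "\<And>z w. z \<in> D \<Longrightarrow> U w \<ge> U z + (w - z) \<bullet> q z"
proof -
  define U where "U w = (SUP z\<in>D. w \<bullet> q z - t z)" for w
  have q: "0 \<le> fst (q z)" "fst (q z) \<le> 1" "0 \<le> snd (q z)" "snd (q z) \<le> 1" "0 \<le> t z"
    if "z \<in> D" for z
    using mech that by (auto simp: mechanism_def mem_Times_iff)
  have inner: "x \<bullet> q z \<le> \<bar>fst x\<bar> + \<bar>snd x\<bar>" if "z \<in> D" for x z
  proof -
    have "x \<bullet> q z = fst x * fst (q z) + snd x * snd (q z)"
      by (simp add: inner_prod_def)
    moreover have "y * a \<le> \<bar>y\<bar>" if "0 \<le> a" "a \<le> 1" for y a :: real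
      using mult_right_mono[OF abs_ge_self \<open>0 \<le> a\<close>, of y] mult_left_le[OF \<open>a \<le> 1\<close>, of "\<bar>y\<bar>"] by linarith
    ultimately show ?thesis
      using q[OF that] by (simp add: add_mono)
  qed
  have bdd: "bdd_above ((\<lambda>z. w \<bullet> q z - t z) ` D)" for w
    by (rule bdd_aboveI2[where M = "\<bar>fst w\<bar> + \<bar>snd w\<bar>"]) (use inner[of _ w] q(5) in smt)
  have ge: "U w \<ge> w \<bullet> q z - t z" if "z \<in> D" for w z
    unfolding U_def by (rule cSUP_upper[OF that bdd])
  have eq: "U z = utility q t z" if "z \<in> D" for z
  proof (rule antisym)
    show "U z \<le> utility q t z"
      unfolding U_def utility_def
      by (rule cSUP_least[OF ne]) (use ic that in \<open>auto simp: incentive_compatible_def\<close>)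
  qed (use ge[OF that, of z] in \<open>simp add: utility_def\<close>)
  have lip: "U w \<le> U x + (\<bar>fst (w - x)\<bar> + \<bar>snd (w - x)\<bar>)" for w x
    unfolding U_def[of w]
  proof (rule cSUP_least[OF ne])
    fix z assume z: "z \<in> D"
    have "w \<bullet> q z - t z = (x \<bullet> q z - t z) + (w - x) \<bullet> q z"
      by (simp add: inner_diff_left)
    then show "w \<bullet> q z - t z \<le> U x + (\<bar>fst (w - x)\<bar> + \<bar>snd (w - x)\<bar>)"
      using ge[OF z, of x] inner[OF z, of "w - x"] by linarith
  qed
  have "\<bar>U w - U x\<bar> \<le> 2 * dist w x" for w x
  proof -
    have "\<bar>fst (w - x)\<bar> \<le> dist w x" "\<bar>snd (w - x)\<bar> \<le> dist w x"
      using dist_fst_le[of w x] dist_snd_le[of w x] by (simp_all add: dist_real_def)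
    then show ?thesis
      using lip[of w x] lip[of x w] abs_minus_commute[of "fst w"] abs_minus_commute[of "snd w"]
      unfolding fst_diff snd_diff abs_le_iff[of "U w - U x"] by (smt (verit))
  qed
  then have "2-lipschitz_on UNIV U"
    by (intro lipschitz_onI) (auto simp: dist_real_def)
  then have "continuous_on UNIV U"
    by (rule lipschitz_on_continuous_on)
  moreover have "U w \<ge> U z + (w - z) \<bullet> q z" if "z \<in> D" for z w
    using ge[OF that, of w] eq[OF that] by (simp add: utility_def inner_diff_left)
  ultimately show ?thesis using that eq by blast
qed

lemma valuations_cbox: "valuations c1 c2 b1 b2 = cbox (c1, c2) (c1 + b1, c2 + b2)"
  by (simp add: valuations_def cbox_Pair_eq)

text \<open>The revenue as a functional of the utility, after integration by parts.\<close>

definition boundary_functional ::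
    "real \<Rightarrow> real \<Rightarrow> real \<Rightarrow> real \<Rightarrow> (valuation \<Rightarrow> real) \<Rightarrow> real" where
  "boundary_functional c1 c2 b1 b2 f =
     (c1 + b1) * integral {c2..c2 + b2} (\<lambda>y. f (c1 + b1, y))
     - c1 * integral {c2..c2 + b2} (\<lambda>y. f (c1, y))
     + (c2 + b2) * integral {c1..c1 + b1} (\<lambda>x. f (x, c2 + b2))
     - c2 * integral {c1..c1 + b1} (\<lambda>x. f (x, c2))
     - 3 * integral (valuations c1 c2 b1 b2) f"

lemma boundary_functional_cong:
  assumes "0 \<le> b1" "0 \<le> b2" "\<And>z. z \<in> valuations c1 c2 b1 b2 \<Longrightarrow> f z = g z"
  shows "boundary_functional c1 c2 b1 b2 f = boundary_functional c1 c2 b1 b2 g"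
proof -
  have "integral {c2..c2 + b2} (\<lambda>y. f (c1 + b1, y)) = integral {c2..c2 + b2} (\<lambda>y. g (c1 + b1, y))"
    "integral {c2..c2 + b2} (\<lambda>y. f (c1, y)) = integral {c2..c2 + b2} (\<lambda>y. g (c1, y))"
    "integral {c1..c1 + b1} (\<lambda>x. f (x, c2 + b2)) = integral {c1..c1 + b1} (\<lambda>x. g (x, c2 + b2))"
    "integral {c1..c1 + b1} (\<lambda>x. f (x, c2)) = integral {c1..c1 + b1} (\<lambda>x. g (x, c2))"
    by (intro integral_cong assms(3); use assms(1,2) in \<open>simp add: valuations_def\<close>)+
  moreover have "integral (valuations c1 c2 b1 b2) f = integral (valuations c1 c2 b1 b2) g"
    by (intro integral_cong assms(3))
  ultimately show ?thesis
    by (simp add: boundary_functional_def)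
qed

lemma integral_valuations_fst:
  fixes f :: "valuation \<Rightarrow> real"
  assumes "continuous_on (valuations c1 c2 b1 b2) f"
  shows "integral (valuations c1 c2 b1 b2) f =
    integral {c1..c1 + b1} (\<lambda>x. integral {c2..c2 + b2} (\<lambda>y. f (x, y)))"
  using integral_prod_continuous[of c1 c2 "c1 + b1" "c2 + b2" f] assms
  by (simp add: valuations_cbox)

lemma integral_valuations_snd:
  fixes f :: "valuation \<Rightarrow> real"
  assumes "continuous_on (valuations c1 c2 b1 b2) f"
  shows "integral (valuations c1 c2 b1 b2) f =
    integral {c2..c2 + b2} (\<lambda>y. integral {c1..c1 + b1} (\<lambda>x. f (x, y)))"
  using integral_swap_continuous[of c1 c2 "c1 + b1" "c2 + b2" "\<lambda>x y. f (x, y)"] assms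
    integral_valuations_fst[OF assms]
  by (simp add: valuations_cbox)

text \<open>Moving the valuation \<open>z\<close> along both axes by \<open>e\<close> bounds \<open>e * t z\<close> by increments of the
  utility, with equality at \<open>e = 0\<close>; so the two sides have the same derivative there.\<close>

lemma revenue_eq_boundary_functional:
  assumes mech: "mechanism D q t" and ic: "incentive_compatible D q t"
    and D: "D = valuations c1 c2 b1 b2"
    and nonneg: "0 \<le> c1" "0 \<le> c2" "0 < b1" "0 < b2"
    and int: "integrable (lebesgue_on D) t"
  shows "(\<integral>z. t z \<partial>lebesgue_on D) = boundary_functional c1 c2 b1 b2 (utility q t)"
proof -
  have ne: "D \<noteq> {}"
    using nonneg by (auto simp: D valuations_def)
  obtain U where cont: "continuous_on UNIV U"
    and U: "\<And>z. z \<in> D \<Longrightarrow> U z = utility q t z"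
    and sub: "\<And>z w. z \<in> D \<Longrightarrow> U w \<ge> U z + (w - z) \<bullet> q z"
    using utility_extension[OF mech ic ne] by blast
  have cont_comp: "continuous_on A (\<lambda>z. U (h z))" if "continuous_on A h"
    for A :: "'a::topological_space set" and h
    using continuous_on_compose2[OF cont that] by simp
  define g1 where "g1 x = integral {c2..c2 + b2} (\<lambda>y. U (x, y))" for x
  define g2 where "g2 y = integral {c1..c1 + b1} (\<lambda>x. U (x, y))" for y
  define w1 where "w1 e z = fst z * (U (z + (e, 0)) - U z)" for e :: real and z :: valuation
  define w2 where "w2 e z = snd z * (U (z + (0, e)) - U z)" for e :: real and z :: valuation
  have cont_w1: "continuous_on D (w1 e)" for e
    unfolding w1_def by (intro continuous_intros cont_comp)
  have cont_w2: "continuous_on D (w2 e)" for e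
    unfolding w2_def by (intro continuous_intros cont_comp)
  have cont_U: "continuous_on D U"
    using cont continuous_on_subset by blast
  have iny: "(\<lambda>y. U (x, y)) integrable_on {a..b}" for x a b
    by (intro integrable_continuous_real cont_comp continuous_intros)
  have inx: "(\<lambda>x. U (x, y)) integrable_on {a..b}" for y a b
    by (intro integrable_continuous_real cont_comp continuous_intros)
  have cont_g1: "continuous_on UNIV g1"
    unfolding g1_def
    using integral_continuous_on_param[of UNIV c2 "c2 + b2" "\<lambda>x y. U (x, y)"]
      continuous_on_subset[OF cont subset_UNIV] by simp
  have cont_g2: "continuous_on UNIV g2"
    unfolding g2_def
    using integral_continuous_on_param[of UNIV c1 "c1 + b1" "\<lambda>y x. U (x, y)"]
    by (simp add: case_prod_unfold cont_comp continuous_intros)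
  have int_w1: "integral D (w1 e) = integral {c1..c1 + b1} (\<lambda>x. x * (g1 (x + e) - g1 x))" for e
    using integral_valuations_fst[OF cont_w1[unfolded D], folded D]
    by (simp add: w1_def g1_def integral_diff[OF iny iny])
  have int_w2: "integral D (w2 e) = integral {c2..c2 + b2} (\<lambda>y. y * (g2 (y + e) - g2 y))" for e
    using integral_valuations_snd[OF cont_w2[unfolded D], folded D]
    by (simp add: w2_def g2_def integral_diff[OF inx inx])
  define I where "I = (\<integral>z. t z \<partial>lebesgue_on D)"
  define P where "P e = integral D (w1 e) + integral D (w2 e) - e * integral D U - e * I" for e
  have P_nonneg: "0 \<le> P e" for e
  proof -
    have intble: "integrable (lebesgue_on D) (\<lambda>z. w1 e z + w2 e z - e * U z)"
      unfolding D valuations_cbox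
      by (rule continuous_imp_integrable)
        (intro continuous_intros cont_w1[unfolded D valuations_cbox]
          cont_w2[unfolded D valuations_cbox] cont_U[unfolded D valuations_cbox])
    have "(\<integral>z. e * t z \<partial>lebesgue_on D) \<le> (\<integral>z. w1 e z + w2 e z - e * U z \<partial>lebesgue_on D)"
    proof (rule integral_mono)
      fix z assume "z \<in> space (lebesgue_on D)"
      then have z: "z \<in> D" by simp
      then have pos: "0 \<le> fst z" "0 \<le> snd z"
        using nonneg by (auto simp: D valuations_def)
      have "e * fst (q z) \<le> U (z + (e, 0)) - U z" "e * snd (q z) \<le> U (z + (0, e)) - U z"
        using sub[OF z, of "z + (e, 0)"] sub[OF z, of "z + (0, e)"] by (simp_all add: inner_prod_def)
      then have "fst z * (e * fst (q z)) \<le> w1 e z" "snd z * (e * snd (q z)) \<le> w2 e z"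
        unfolding w1_def w2_def using pos by (simp_all add: mult_left_mono)
      moreover have "t z = fst z * fst (q z) + snd z * snd (q z) - U z"
        using U[OF z] by (simp add: utility_def inner_prod_def)
      then have "e * t z = fst z * (e * fst (q z)) + snd z * (e * snd (q z)) - e * U z"
        by (simp only: right_diff_distrib distrib_left mult.left_commute)
      ultimately show "e * t z \<le> w1 e z + w2 e z - e * U z"
        by linarith
    qed (use int intble in auto)
    also have "\<dots> = integral D (\<lambda>z. w1 e z + w2 e z - e * U z)"
      by (rule lebesgue_integral_eq_integral[OF intble]) (simp add: D valuations_cbox)
    also have "\<dots> = integral D (w1 e) + integral D (w2 e) - e * integral D U"
    proof -
      have "w1 e integrable_on D" "w2 e integrable_on D" "U integrable_on D"
        using cont_w1 cont_w2 cont_U unfolding D valuations_cbox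
        by (simp_all add: integrable_continuous)
      then show ?thesis
        using integrable_on_mult_right[of U D e]
        by (subst integral_diff) (simp_all add: integral_add integrable_add)
    qed
    finally show ?thesis
      by (simp add: P_def I_def)
  qed
  have P0: "P 0 = 0"
    unfolding P_def w1_def w2_def zero_prod_def[symmetric] by simp
  have P': "(P has_real_derivative
      ((c1 + b1) * g1 (c1 + b1) - c1 * g1 c1 - integral {c1..c1 + b1} g1)
      + ((c2 + b2) * g2 (c2 + b2) - c2 * g2 c2 - integral {c2..c2 + b2} g2)
      - 1 * integral D U - 1 * I) (at 0)"
    unfolding P_def int_w1 int_w2
    by (intro DERIV_add DERIV_diff DERIV_cmult_right DERIV_ident
        DERIV_integral_weighted_increment cont_g1 cont_g2) (use nonneg in auto)
  have "((c1 + b1) * g1 (c1 + b1) - c1 * g1 c1 - integral {c1..c1 + b1} g1)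
      + ((c2 + b2) * g2 (c2 + b2) - c2 * g2 c2 - integral {c2..c2 + b2} g2)
      - 1 * integral D U - 1 * I = 0"
    using DERIV_local_min[OF P' zero_less_one] P_nonneg P0 by simp
  moreover have "integral {c1..c1 + b1} g1 = integral D U" "integral {c2..c2 + b2} g2 = integral D U"
    unfolding g1_def g2_def D
    using integral_valuations_fst[OF cont_U[unfolded D]] integral_valuations_snd[OF cont_U[unfolded D]]
    by simp_all
  ultimately have "I = boundary_functional c1 c2 b1 b2 U"
    by (simp add: boundary_functional_def g1_def g2_def D)
  also have "\<dots> = boundary_functional c1 c2 b1 b2 (utility q t)"
    by (rule boundary_functional_cong) (use nonneg U D in auto)
  finally show ?thesis
    by (simp add: I_def)
qed

lemma expected_revenue_valuations:
  assumes D: "D = valuations c1 c2 b1 b2" and pos: "0 < b1" "0 < b2"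
  shows "expected_revenue D t = (\<integral>z. t z \<partial>lebesgue_on D) / (b1 * b2)"
proof -
  have D_sets: "D \<in> sets lebesgue"
    by (simp add: D valuations_cbox)
  have em: "emeasure (lebesgue_on D) D = ennreal (b1 * b2)"
    using pos D_sets
    by (simp add: emeasure_restrict_space D valuations_cbox emeasure_lborel_cbox_eq
        Basis_prod_def inner_prod_def ennreal_mult mult.commute)
  have D': "D \<in> sets (lebesgue_on D)"
    using D_sets by (simp add: sets_restrict_space_iff)
  show ?thesis
  proof (cases "t \<in> borel_measurable (lebesgue_on D)")
    case True
    have eq: "indicator D z / ennreal (b1 * b2) = ennreal (indicator D z / (b1 * b2))" for z :: valuation
      using pos by (auto simp: indicator_def divide_ennreal[symmetric] simp flip: ennreal_1)
    have "expected_revenue D t = (\<integral>z. (indicator D z / (b1 * b2)) *\<^sub>R t z \<partial>lebesgue_on D)"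
      unfolding expected_revenue_def uniform_measure_def em eq
      by (rule integral_density) (use True D' pos in \<open>auto intro!: borel_measurable_divide borel_measurable_indicator\<close>)
    also have "\<dots> = (\<integral>z. t z / (b1 * b2) \<partial>lebesgue_on D)"
      by (rule Bochner_Integration.integral_cong) auto
    finally show ?thesis by simp
  next
    \<comment> \<open>Without measurability both integrals are 0 by the convention for
      non-integrable functions.\<close>
    case False
    then have "\<not> integrable (lebesgue_on D) t" "\<not> integrable (uniform_measure (lebesgue_on D) D) t"
      by (auto dest: borel_measurable_integrable)
    then show ?thesis
      by (simp add: expected_revenue_def not_integrable_integral_eq)
  qed
qed

text \<open>Ties occur only on finitely many lines. Off this null set \<open>t\<close> agrees with
  the average \<open>f\<close> of the prices of the best entries, which is measurable because every
  \<open>C m\<close> is closed.\<close>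

lemma integrable_of_menu:
  assumes M: "finite M" and ind: "induced_by D M q t" and D: "D = valuations c1 c2 b1 b2"
  shows "integrable (lebesgue_on D) t"
proof -
  have D_sets: "D \<in> sets lebesgue"
    by (simp add: D valuations_cbox)
  define C where "C m = {z \<in> D. \<forall>m'\<in>M. z \<bullet> fst m' - snd m' \<le> z \<bullet> fst m - snd m}" for m
  define f where "f z = (\<Sum>m\<in>M. snd m * indicator (C m) z) / (\<Sum>m\<in>M. indicator (C m) z)" for z
  have "closed D"
    by (simp add: D valuations_cbox closed_cbox)
  have "closed (C m)" for m
  proof -
    have "C m = D \<inter> (\<Inter>m'\<in>M. {z. z \<bullet> fst m' - snd m' \<le> z \<bullet> fst m - snd m})"
      by (auto simp: C_def)
    then show ?thesis
      using \<open>closed D\<close> by (auto intro!: closed_Collect_le continuous_intros)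
  qed
  then have C_meas: "C m \<in> sets (lebesgue_on D)" for m
    using D_sets by (auto simp: sets_restrict_space_iff C_def)
  have f_meas: "f \<in> borel_measurable (lebesgue_on D)"
    unfolding f_def using C_meas by measurable
  \<comment> \<open>Distinct entries with equal allocations differ in price, so their set is empty
    and not the whole plane.\<close>
  define N where "N = (\<Union>m\<in>M. \<Union>m'\<in>M - {m}. {z. (fst m - fst m') \<bullet> z = snd m - snd m'})"
  have "negligible N"
    unfolding N_def
    by (intro negligible_Union negligible_hyperplane finite_imageI M finite_Diff ballI)
      (auto intro!: negligible_Union negligible_hyperplane simp: prod_eq_iff M)
  have off: "t z = f z" if "z \<in> D" "z \<notin> N" for z
  proof -
    have m: "(q z, t z) \<in> M" "z \<in> C (q z, t z)"
      using ind that by (fastforce simp: induced_by_def C_def)+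
    have uniq: "m = (q z, t z)" if "m \<in> M" "z \<in> C m" for m
    proof (rule ccontr)
      assume "m \<noteq> (q z, t z)"
      moreover have "z \<bullet> fst m - snd m = z \<bullet> q z - t z"
        using bspec[of M "\<lambda>m'. z \<bullet> fst m' - snd m' \<le> z \<bullet> fst m - snd m", OF _ m(1)]
          bspec[of M "\<lambda>m'. z \<bullet> fst m' - snd m' \<le> z \<bullet> q z - t z", OF _ that(1)] that(2) m(2)
        by (simp add: C_def)
      ultimately have "z \<in> N"
        using m(1) \<open>m \<in> M\<close> unfolding N_def
        by (intro UN_I[of m] UN_I[of "(q z, t z)"]) (auto simp: inner_diff_left inner_commute algebra_simps)
      then show False using \<open>z \<notin> N\<close> by simp
    qed
    have "indicator (C m) z = (if m = (q z, t z) then 1 else 0 :: real)" if "m \<in> M" for m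
      using uniq[OF that] m(2) by (cases "m = (q z, t z)") (auto simp: indicator_def)
    then have "(\<Sum>m\<in>M. snd m * indicator (C m) z) = (\<Sum>m\<in>M. if m = (q z, t z) then t z else 0)"
      "(\<Sum>m\<in>M. indicator (C m) z) = (\<Sum>m\<in>M. if m = (q z, t z) then 1 else 0 :: real)"
      by (auto intro!: sum.cong)
    then show ?thesis
      using M m(1) by (simp add: f_def)
  qed
  have "t measurable_on D"
    by (rule measurable_on_spike[OF _ \<open>negligible N\<close>, of f])
      (use f_meas off in \<open>auto simp: measurable_on_iff_borel_measurable[OF D_sets]\<close>)
  then have "t \<in> borel_measurable (lebesgue_on D)"
    by (simp add: measurable_on_iff_borel_measurable[OF D_sets])
  moreover have "\<bar>t z\<bar> \<le> (\<Sum>m\<in>M. \<bar>snd m\<bar>)" if "z \<in> D" for z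
    using ind that member_le_sum[of "(q z, t z)" M "\<lambda>m. \<bar>snd m\<bar>"] M
    by (auto simp: induced_by_def)
  moreover have "finite_measure (lebesgue_on D)"
    by (rule finite_measure_lebesgue_on) (simp add: D valuations_cbox)
  ultimately show ?thesis
    by (intro finite_measure.integrable_const_bound[where B = "\<Sum>m\<in>M. \<bar>snd m\<bar>"]) auto
qed

section \<open>Dual certificates\<close>

text \<open>The weight minus a point mass \<open>a * L^2 / 2\<close> at 0 has zero total and zero
  first moment, hence annihilates affine functions; so \<open>f\<close> may be compared with a
  chord.\<close>

lemma convex_weighted_integral_le:
  fixes f :: "real \<Rightarrow> real"
  assumes conv: "convex_on {0..L} f" and cont: "continuous_on {0..L} f" and "0 \<le> L" "0 \<le> a"
  shows "integral {0..L} (\<lambda>s. (2 * a * L - 3 * a * s) * f s) \<le> a * L^2 / 2 * f 0"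
proof (cases "L = 0")
  case False
  then have L: "0 < L" using assms by simp
  \<comment> \<open>The weight changes sign at \<open>x\<close>. The chord through 0 and
    \<open>x\<close> lies above \<open>f\<close> where the weight is positive and below
    \<open>f\<close> where it is negative.\<close>
  define x where "x = 2 * L / 3"
  define m where "m = (f x - f 0) / x"
  have x: "0 < x" "x < L" using L by (auto simp: x_def)
  have fx: "f x = f 0 + m * x" using x by (simp add: m_def)
  have below: "f s \<le> f 0 + m * s" if "0 \<le> s" "s \<le> x" for s
  proof -
    have "f ((1 - s / x) *\<^sub>R 0 + (s / x) *\<^sub>R x) \<le> (1 - s / x) * f 0 + s / x * f x"
      by (rule convex_onD[OF conv]) (use that x in auto)
    then show ?thesis using x by (simp add: m_def field_simps)
  qed
  have above: "f s \<ge> f 0 + m * s" if "x \<le> s" "s \<le> L" for s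
  proof -
    have s: "0 < s" using that x by simp
    have "f ((1 - x / s) *\<^sub>R 0 + (x / s) *\<^sub>R s) \<le> (1 - x / s) * f 0 + x / s * f s"
      by (rule convex_onD[OF conv]) (use that x s in auto)
    then have "s * f x \<le> (s - x) * f 0 + x * f s" using s by (simp add: field_simps)
    then have "x * (f 0 + m * s) \<le> x * f s" unfolding fx by (simp add: algebra_simps)
    then show ?thesis using x by simp
  qed
  have "integral {0..L} (\<lambda>s. (2 * a * L - 3 * a * s) * f s)
      \<le> integral {0..L} (\<lambda>s. (2 * a * L - 3 * a * s) * (f 0 + m * s))"
  proof (rule integral_le)
    fix s assume s: "s \<in> {0..L}"
    have w: "2 * a * L - 3 * a * s = 3 * a * (x - s)" by (simp add: x_def algebra_simps)
    show "(2 * a * L - 3 * a * s) * f s \<le> (2 * a * L - 3 * a * s) * (f 0 + m * s)"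
    proof (cases "s \<le> x")
      case True
      then show ?thesis unfolding w using below[of s] s assms(4) by (intro mult_left_mono) auto
    next
      case False
      then show ?thesis unfolding w using above[of s] s assms(4)
        by (intro mult_left_mono_neg) (auto simp: mult_nonneg_nonpos)
    qed
  qed (intro integrable_continuous_real continuous_intros cont)+
  also have "\<dots> = a * L^2 / 2 * f 0"
  proof -
    define F where "F s = 2 * a * L * f 0 * s + (2 * a * L * m - 3 * a * f 0) * s^2 / 2 - a * m * s^3" for s
    have "((\<lambda>s. (2 * a * L - 3 * a * s) * (f 0 + m * s)) has_integral F L - F 0) {0..L}"
    proof (rule fundamental_theorem_of_calculus[OF assms(3)])
      fix s
      have "(F has_real_derivative (2 * a * L - 3 * a * s) * (f 0 + m * s)) (at s within {0..L})"
        unfolding F_def by (rule derivative_eq_intros refl | simp)+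
          (simp add: algebra_simps power2_eq_square)
      then show "(F has_vector_derivative (2 * a * L - 3 * a * s) * (f 0 + m * s)) (at s within {0..L})"
        by (simp add: has_real_derivative_iff_has_vector_derivative)
    qed
    moreover have "F L - F 0 = a * L^2 / 2 * f 0"
      by (simp add: F_def field_simps power2_eq_square power3_eq_cube)
    ultimately show ?thesis by (simp add: integral_unique)
  qed
  finally show ?thesis .
qed simp

lemma integral_ge_tail:
  fixes f :: "real \<Rightarrow> real"
  assumes int: "f integrable_on {x..y}" and "x \<le> h" "h \<le> y"
    and nonneg: "\<And>u. \<lbrakk>x \<le> u; u < h\<rbrakk> \<Longrightarrow> 0 \<le> f u"
  shows "integral {x..y} f \<ge> integral {h..y} f"
proof -
  have "integral {x..y} f = integral {x..h} f + integral {h..y} f"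
    using Henstock_Kurzweil_Integration.integral_combine[OF assms(2,3) int] by simp
  moreover have "f integrable_on {x..h}"
    using integrable_subinterval_real[OF int] assms by auto
  then have "0 \<le> integral {x<..<h} f"
    by (intro Henstock_Kurzweil_Integration.integral_nonneg)
      (use nonneg in \<open>auto simp: integrable_on_open_interval_real\<close>)
  ultimately show ?thesis by (simp add: integral_open_interval_real)
qed

lemma integral_ge_tail_const:
  fixes f :: "real \<Rightarrow> real"
  assumes int: "f integrable_on {x..y}" and "x \<le> h" "h \<le> y"
    and nonneg: "\<And>u. \<lbrakk>x \<le> u; u < h\<rbrakk> \<Longrightarrow> 0 \<le> f u"
    and ge: "\<And>u. \<lbrakk>h \<le> u; u \<le> y\<rbrakk> \<Longrightarrow> m \<le> f u"
  shows "integral {x..y} f \<ge> (y - h) * m"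
proof -
  have "f integrable_on {h..y}" using integrable_subinterval_real[OF int] assms by auto
  then have "integral {h..y} (\<lambda>_. m) \<le> integral {h..y} f"
    by (intro integral_le) (use ge in auto)
  then show ?thesis using integral_ge_tail[OF assms(1-4)] assms(3) by simp
qed

text \<open>
  Coordinates relative to the lower left corner of \<open>D\<close>.  The junctions of the no-sale boundary are
  \<open>(L1, p - L1)\<close> and \<open>(p - L2, L2)\<close>; \<open>g1\<close>, \<open>g2\<close> are the densities of the part of the negative
  mass on the left and bottom edge that is compensated from the right edge.
\<close>

locale certificate =
  fixes c1 c2 b1 b2 L1 L2 a1 a2 g1 g2 p pa1 pa2 :: real
  assumes pa1: "pa1 = p - (1 - a1) * L1" and pa2: "pa2 = p - (1 - a2) * L2"
    and c_nonneg: "0 \<le> c1" "0 \<le> c2" and b_pos: "0 < b1" "0 < b2"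
    and L_nonneg: "0 \<le> L1" "0 \<le> L2" and L_sum: "L1 + L2 \<le> p"
    and a1: "0 \<le> a1" "a1 \<le> 1" and a2: "0 \<le> a2" "a2 \<le> 1"
    and pa_le: "pa1 \<le> b2" "pa2 \<le> b1"
    and depth: "c2 + b2 \<le> 3 * b2 - 3 * p + 3 * L1" "c1 + b1 \<le> 3 * b1 - 3 * p + 3 * L2"
    and slope: "0 < L1 \<Longrightarrow> c2 + b2 - 3 * (b2 - pa1) = 2 * a1 * L1"
      "0 < L2 \<Longrightarrow> c1 + b1 - 3 * (b1 - pa2) = 2 * a2 * L2"
    and g1: "0 \<le> g1" "g1 \<le> c1" "0 < g1 \<Longrightarrow> a1 = 1"
    and g2: "0 \<le> g2" "g2 \<le> c2" "0 < g2 \<Longrightarrow> a2 = 1"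
    and edge: "(c1 - g1) * (b2 - pa1) = a1 * L1^2 / 2" "(c2 - g2) * (b1 - pa2) = a2 * L2^2 / 2"
    and mass: "(c2 + b2) * (b1 - L1) + (c1 + b1) * (b2 - L2) - 3 * (b1 - L1) * (b2 - L2)
       + 3 / 2 * (p - L1 - L2)^2 - g1 * (b2 - pa1) - g2 * (b1 - pa2) = 0"
begin

text \<open>Value of the best sale in relative coordinates: \<open>s + t - p\<close> is the payoff
  of \<open>(1, 1)\<close>, and the two bonuses are what \<open>(a1, 1)\<close> and
  \<open>(1, a2)\<close> add to it; they change sign at \<open>s = L1\<close> and
  \<open>t = L2\<close>.\<close>

definition gain :: "real \<Rightarrow> real \<Rightarrow> real" where
  "gain s t = s + t - p + max 0 (max ((1 - a1) * (L1 - s)) ((1 - a2) * (L2 - t)))"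

text \<open>\<open>depth\<close> keeps the first junction at distance at least
  \<open>(c2 + b2) / 3\<close> from the top edge and the second at least
  \<open>(c1 + b1) / 3\<close> from the right edge.\<close>

lemma geometry:
  "L1 \<le> b1" "L2 \<le> b2" "p - L2 \<le> b1" "p - L1 \<le> b2" "L2 \<le> pa1" "L1 \<le> pa2"
  "p - L1 \<le> b2 - (c2 + b2) / 3" "0 \<le> pa1" "0 \<le> pa2" "pa1 \<le> p" "pa2 \<le> p"
proof -
  have prods: "0 \<le> a1 * L1" "0 \<le> a2 * L2" "0 \<le> (1 - a1) * L1" "0 \<le> (1 - a2) * L2"
    using a1 a2 L_nonneg by simp_all
  have pa: "pa1 = p - L1 + a1 * L1" "pa2 = p - L2 + a2 * L2"
    by (simp_all add: pa1 pa2 algebra_simps)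
  show "p - L2 \<le> b1" using depth(2) c_nonneg b_pos by linarith
  then show "L1 \<le> b1" using L_sum by linarith
  show "p - L1 \<le> b2" using depth(1) c_nonneg b_pos by linarith
  then show "L2 \<le> b2" using L_sum by linarith
  show "L2 \<le> pa1" "L1 \<le> pa2" using pa prods L_sum by simp_all
  then show "0 \<le> pa1" "0 \<le> pa2" using L_nonneg by simp_all
  show "pa1 \<le> p" "pa2 \<le> p" using pa1 pa2 prods by simp_all
  show "p - L1 \<le> b2 - (c2 + b2) / 3" using depth(1) by (simp add: field_simps)
qed

text \<open>Left of \<open>L1\<close> the entry \<open>(1, a2)\<close> is never strictly best: for
  \<open>t <= L2\<close> it yields at most \<open>s + L2 - p\<close>, which is at most
  \<open>L1 + L2 - p <= 0\<close>.\<close>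

lemma bonus2_left:
  assumes "s \<le> L1" "0 \<le> t"
  shows "s + t - p + (1 - a2) * (L2 - t) \<le> max 0 (s + t - p)"
proof (cases "t \<le> L2")
  case True
  then have "(1 - a2) * (L2 - t) \<le> L2 - t" using a2 by (simp add: mult_left_le_one_le)
  then show ?thesis using assms L_sum by linarith
next
  case False
  then have "(1 - a2) * (L2 - t) \<le> 0" using a2 by (simp add: mult_nonneg_nonpos)
  then show ?thesis by linarith
qed

lemma bonus1_le: "s \<ge> L1 \<Longrightarrow> (1 - a1) * (L1 - s) \<le> 0"
  using a1 by (simp add: mult_nonneg_nonpos)

lemma bonus2_le: "t \<ge> L2 \<Longrightarrow> (1 - a2) * (L2 - t) \<le> 0"
  using a2 by (simp add: mult_nonneg_nonpos)

lemma pa1_line: "p - s - (1 - a1) * (L1 - s) = pa1 - a1 * s"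
  by (simp add: pa1 algebra_simps)

lemma pa2_line: "p - t - (1 - a2) * (L2 - t) = pa2 - a2 * t"
  by (simp add: pa2 algebra_simps)

end

text \<open>The transport below treats the two items differently, but its hypotheses are symmetric;
  this turns a certificate for (b) into one for (b').\<close>

lemma certificate_swap:
  "certificate c1 c2 b1 b2 L1 L2 a1 a2 g1 g2 p pa1 pa2 \<Longrightarrow>
   certificate c2 c1 b2 b1 L2 L1 a2 a1 g2 g1 p pa2 pa1"
  unfolding certificate_def by (simp add: algebra_simps power2_eq_square)

text \<open>\<open>d\<close> stands for \<open>u - u*\<close>. The last premise of \<open>up\<close>
  says that \<open>(1, a2)\<close> is not strictly better than the other sales, so item 2 is sold
  for sure and \<open>u*\<close> has slope 1 upwards; \<open>right\<close> is its mirror image.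
  Convexity of \<open>d\<close> is asked only on the two edge segments where \<open>u*\<close> is
  affine.\<close>

locale certificate_deviation = certificate +
  fixes d :: "real \<Rightarrow> real \<Rightarrow> real"
  assumes cont: "continuous_on ({0..b1} \<times> {0..b2}) (\<lambda>(s, t). d s t)"
    and no_sale: "\<lbrakk>s \<in> {0..b1}; t \<in> {0..b2}; gain s t \<le> 0\<rbrakk> \<Longrightarrow> 0 \<le> d s t"
    and up: "\<lbrakk>s \<in> {0..b1}; t \<in> {0..b2}; t' \<in> {t..b2}; 0 \<le> gain s t;
        (1 - a2) * (L2 - t) \<le> max 0 ((1 - a1) * (L1 - s))\<rbrakk> \<Longrightarrow> d s t' \<le> d s t"
    and right: "\<lbrakk>s \<in> {0..b1}; t \<in> {0..b2}; s' \<in> {s..b1}; 0 \<le> gain s t;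
        (1 - a1) * (L1 - s) \<le> max 0 ((1 - a2) * (L2 - t))\<rbrakk> \<Longrightarrow> d s' t \<le> d s t"
    and conv_top: "convex_on {0..L1} (\<lambda>s. d s b2)"
    and conv_right: "convex_on {0..L2} (\<lambda>t. d b1 t)"
begin

text \<open>The mass on the top edge pays for the strip between height \<open>t0\<close> and the top.\<close>

definition t0 :: real where "t0 = b2 - (c2 + b2) / 3"

text \<open>In column \<open>s <= L1\<close>, the height at which \<open>(a1, 1)\<close> breaks even
  with no sale.\<close>

definition top_cut :: "real \<Rightarrow> real" where "top_cut s = pa1 - a1 * s"

text \<open>In row \<open>t\<close>, the abscissa from which selling item 1 pays. It is cut off at
  \<open>L1\<close> because the columns further left are charged to the top edge.\<close>

definition right_cut :: "real \<Rightarrow> real" where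
  "right_cut t = max L1 (p - t - max 0 ((1 - a2) * (L2 - t)))"

section \<open>Transport of the negative mass to the edges\<close>

lemma t0: "0 \<le> t0" "t0 \<le> b2" "L2 \<le> t0" "p - L1 \<le> t0"
proof -
  show *: "p - L1 \<le> t0" using geometry(7) by (simp add: t0_def)
  then show "L2 \<le> t0" using L_sum by simp
  then show "0 \<le> t0" using L_nonneg by simp
  show "t0 \<le> b2" using c_nonneg b_pos by (simp add: t0_def)
qed

lemma top_cut_bounds: assumes "s \<in> {0..L1}" shows "0 \<le> top_cut s" "top_cut s \<le> b2" "L2 \<le> top_cut s"
proof -
  have "0 \<le> a1 * s" "a1 * s \<le> a1 * L1" using assms a1 by (simp_all add: mult_left_mono)
  moreover have "pa1 - a1 * L1 = p - L1" by (simp add: pa1 algebra_simps)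
  ultimately show "0 \<le> top_cut s" "top_cut s \<le> b2" "L2 \<le> top_cut s"
    using pa_le L_sum L_nonneg by (auto simp: top_cut_def)
qed

lemma right_cut_bounds: assumes "0 \<le> t" shows "0 \<le> right_cut t" "right_cut t \<le> b1" "L1 \<le> right_cut t"
proof -
  have "p - t - max 0 ((1 - a2) * (L2 - t)) \<le> b1"
  proof (cases "t \<le> L2")
    case True
    have "a2 * t \<ge> 0" using a2 assms by simp
    then show ?thesis using pa2_line[of t] pa_le by linarith
  next
    case False
    then show ?thesis using geometry(3) by linarith
  qed
  then show "0 \<le> right_cut t" "right_cut t \<le> b1" "L1 \<le> right_cut t"
    using geometry L_nonneg by (auto simp: right_cut_def)
qed

lemma cont_d_comp:
  assumes "continuous_on A f" "continuous_on A g" "f ` A \<subseteq> {0..b1}" "g ` A \<subseteq> {0..b2}"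
  shows "continuous_on A (\<lambda>x. d (f x) (g x))"
proof -
  have "continuous_on A (\<lambda>x. (\<lambda>(s, t). d s t) (f x, g x))"
    by (rule continuous_on_compose2[OF cont]) (use assms in \<open>auto intro!: continuous_intros\<close>)
  then show ?thesis by simp
qed

lemma integrable_d_snd: "\<lbrakk>s \<in> {0..b1}; 0 \<le> x; y \<le> b2\<rbrakk> \<Longrightarrow> (\<lambda>t. d s t) integrable_on {x..y}"
  by (intro integrable_continuous_real cont_d_comp continuous_intros) auto

lemma integrable_d_fst: "\<lbrakk>t \<in> {0..b2}; 0 \<le> x; y \<le> b1\<rbrakk> \<Longrightarrow> (\<lambda>s. d s t) integrable_on {x..y}"
  by (intro integrable_continuous_real cont_d_comp continuous_intros) auto

lemma cont_top_cut: "continuous_on A top_cut" unfolding top_cut_def by (intro continuous_intros)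
lemma cont_right_cut: "continuous_on A right_cut" unfolding right_cut_def by (intro continuous_intros)

lemma no_sale_left: "\<lbrakk>s \<in> {0..L1}; 0 \<le> t; t \<le> top_cut s\<rbrakk> \<Longrightarrow> 0 \<le> d s t"
proof (rule no_sale)
  assume *: "s \<in> {0..L1}" "0 \<le> t" "t \<le> top_cut s"
  have "0 \<le> (1 - a1) * (L1 - s)" using * a1 by simp
  then show "gain s t \<le> 0"
    using bonus2_left[of s t] * pa1_line[of s] by (auto simp: gain_def top_cut_def)
qed (use top_cut_bounds geometry in force)+

lemma up_left: "\<lbrakk>s \<in> {0..L1}; top_cut s \<le> t; t \<le> t'; t' \<le> b2\<rbrakk> \<Longrightarrow> d s t' \<le> d s t"
proof (rule up)
  assume *: "s \<in> {0..L1}" "top_cut s \<le> t" "t \<le> t'" "t' \<le> b2"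
  show "0 \<le> gain s t" using * pa1_line[of s] by (auto simp: gain_def top_cut_def)
  show "(1 - a2) * (L2 - t) \<le> max 0 ((1 - a1) * (L1 - s))"
    using bonus2_le[of t] top_cut_bounds(3)[OF *(1)] * by linarith
qed (use top_cut_bounds(1)[of s] geometry in auto)

lemma column_left:
  assumes "s \<in> {0..L1}"
  shows "integral {0..b2} (\<lambda>t. d s t) \<ge> (b2 - top_cut s) * d s b2"
proof (rule integral_ge_tail_const)
  show "d s b2 \<le> d s u" if "top_cut s \<le> u" "u \<le> b2" for u
    using up_left[OF assms that(1) that(2)] by simp
  show "0 \<le> d s u" if "0 \<le> u" "u < top_cut s" for u
    using no_sale_left[OF assms that(1)] that(2) by simp
qed (use assms top_cut_bounds[OF assms] geometry(1) in \<open>simp_all add: integrable_d_snd\<close>)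

lemma up_top: "\<lbrakk>s \<in> {L1..b1}; t0 \<le> t; t \<le> b2\<rbrakk> \<Longrightarrow> d s b2 \<le> d s t"
proof (rule up)
  assume *: "s \<in> {L1..b1}" "t0 \<le> t" "t \<le> b2"
  show "0 \<le> gain s t" using * t0(4) by (auto simp: gain_def)
  show "(1 - a2) * (L2 - t) \<le> max 0 ((1 - a1) * (L1 - s))"
    using bonus2_le[of t] t0(3) * by linarith
qed (use t0 L_nonneg in auto)

text \<open>Multiplied by the interior density 3, the bound has exactly the density
  \<open>c2 + b2\<close> of the top edge, so beyond \<open>L1\<close> strip and top edge
  cancel.\<close>

lemma column_top:
  assumes "s \<in> {L1..b1}"
  shows "integral {t0..b2} (\<lambda>t. d s t) \<ge> (c2 + b2) / 3 * d s b2"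
proof -
  have "integral {t0..b2} (\<lambda>t. d s t) \<ge> (b2 - t0) * d s b2"
    by (rule integral_ge_tail_const)
      (use assms up_top[OF assms] t0 L_nonneg in \<open>simp_all add: integrable_d_snd\<close>)
  then show ?thesis by (simp add: t0_def)
qed

lemma row_right:
  assumes t: "t \<in> {0..t0}"
  shows "integral {L1..b1} (\<lambda>s. d s t) \<ge> (b1 - right_cut t) * d b1 t"
proof (rule integral_ge_tail_const)
  have t': "t \<in> {0..b2}" using t t0 by auto
  show "(\<lambda>s. d s t) integrable_on {L1..b1}"
    using t' L_nonneg by (intro integrable_d_fst) auto
  show "L1 \<le> right_cut t" "right_cut t \<le> b1" using right_cut_bounds t by auto
  show "0 \<le> d s t" if "L1 \<le> s" "s < right_cut t" for s
  proof (rule no_sale)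
    show "gain s t \<le> 0"
      using that bonus1_le[of s] by (auto simp: gain_def right_cut_def)
  qed (use that t' right_cut_bounds[of t] L_nonneg in auto)
  show "d b1 t \<le> d s t" if "right_cut t \<le> s" "s \<le> b1" for s
  proof (rule right)
    show "0 \<le> gain s t" using that by (auto simp: gain_def right_cut_def)
    show "(1 - a1) * (L1 - s) \<le> max 0 ((1 - a2) * (L2 - t))"
      using bonus1_le[of s] right_cut_bounds[of t] t that by auto
  qed (use that t' right_cut_bounds[of t] in auto)
qed

text \<open>The density \<open>c1\<close> is split: the share \<open>c1 - g1\<close> is pushed up to
  the corner \<open>(0, b2)\<close>, the share \<open>g1\<close> across to the right edge. The
  latter happens only for \<open>a1 = 1\<close>; then \<open>pa1 = p\<close>, and
  \<open>(1, 1)\<close> is sold along the way.\<close>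

lemma left_edge:
  "c1 * integral {0..b2} (\<lambda>t. d 0 t) \<ge>
     (c1 - g1) * (b2 - pa1) * d 0 b2 + g1 * integral {pa1..b2} (\<lambda>t. d b1 t)"
proof -
  have 0: "(0::real) \<in> {0..L1}" "(0::real) \<in> {0..b1}" using L_nonneg b_pos by auto
  have h0: "top_cut 0 = pa1" by (simp add: top_cut_def)
  have int: "(\<lambda>t. d 0 t) integrable_on {0..b2}" using 0 by (intro integrable_d_snd) auto
  have nonneg: "0 \<le> d 0 u" if "0 \<le> u" "u < pa1" for u
    using no_sale_left[OF 0(1), of u] that h0 by simp
  have 1: "integral {0..b2} (\<lambda>t. d 0 t) \<ge> (b2 - pa1) * d 0 b2"
    using column_left[OF 0(1)] h0 by simp
  have 2: "g1 * integral {0..b2} (\<lambda>t. d 0 t) \<ge> g1 * integral {pa1..b2} (\<lambda>t. d b1 t)"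
  proof (cases "0 < g1")
    case True
    then have "a1 = 1" using g1 by simp
    then have "pa1 = p" by (simp add: pa1)
    have "integral {pa1..b2} (\<lambda>t. d b1 t) \<le> integral {pa1..b2} (\<lambda>t. d 0 t)"
    proof (rule integral_le)
      fix t assume t: "t \<in> {pa1..b2}"
      have "0 \<le> gain 0 t" using t \<open>pa1 = p\<close> by (auto simp: gain_def)
      then show "d b1 t \<le> d 0 t"
        by (intro right) (use t geometry b_pos \<open>a1 = 1\<close> in auto)
    qed (use geometry b_pos in \<open>auto intro!: integrable_d_snd\<close>)
    also have "\<dots> \<le> integral {0..b2} (\<lambda>t. d 0 t)"
      by (rule integral_ge_tail[OF int]) (use geometry pa_le nonneg in auto)
    finally show ?thesis using True by (intro mult_left_mono) auto
  next
    case False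
    then show ?thesis using g1(1) by simp
  qed
  have "c1 * integral {0..b2} (\<lambda>t. d 0 t) =
      (c1 - g1) * integral {0..b2} (\<lambda>t. d 0 t) + g1 * integral {0..b2} (\<lambda>t. d 0 t)"
    by (simp add: algebra_simps)
  moreover have "(c1 - g1) * integral {0..b2} (\<lambda>t. d 0 t) \<ge> (c1 - g1) * ((b2 - pa1) * d 0 b2)"
    by (rule mult_left_mono[OF 1]) (use g1 in simp)
  ultimately show ?thesis using 2 by (simp add: mult.assoc)
qed

text \<open>All mass goes to the corner \<open>(b1, 0)\<close>; for \<open>a2 = 1\<close> the share
  \<open>g2\<close> moves on up the right edge to \<open>t0\<close>, the reference height of the
  balance in \<open>right_edge\<close>.\<close>

lemma bottom_edge:
  "c2 * integral {0..b1} (\<lambda>s. d s 0) \<ge>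
     (c2 - g2) * (b1 - pa2) * d b1 0 + g2 * (b1 - pa2) * d b1 t0"
proof -
  have h0: "right_cut 0 = pa2"
  proof -
    have "0 \<le> (1 - a2) * L2" using a2 L_nonneg by simp
    then show ?thesis using geometry(6) by (simp add: right_cut_def pa2)
  qed
  have L1: "integral {0..b1} (\<lambda>s. d s 0) \<ge> integral {L1..b1} (\<lambda>s. d s 0)"
  proof (rule integral_ge_tail)
    fix u assume u: "0 \<le> u" "u < L1"
    show "0 \<le> d u 0"
      by (rule no_sale_left) (use u top_cut_bounds[of u] in auto)
  qed (use L_nonneg geometry b_pos in \<open>auto intro!: integrable_d_fst\<close>)
  have 1: "integral {0..b1} (\<lambda>s. d s 0) \<ge> (b1 - pa2) * d b1 0"
    using row_right[of 0] t0 h0 L1 by simp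
  have 2: "g2 * (b1 - pa2) * d b1 t0 \<le> g2 * (b1 - pa2) * d b1 0"
  proof (cases "0 < g2")
    case True
    then have "a2 = 1" using g2 by simp
    then have "pa2 = p" by (simp add: pa2)
    have "0 \<le> gain b1 0" using pa_le \<open>pa2 = p\<close> by (auto simp: gain_def)
    then have "d b1 t0 \<le> d b1 0"
      by (intro up) (use t0 b_pos \<open>a2 = 1\<close> in auto)
    then show ?thesis using True pa_le by (intro mult_left_mono) auto
  next
    case False
    then show ?thesis using g2(1) by simp
  qed
  have "c2 * integral {0..b1} (\<lambda>s. d s 0) \<ge> c2 * ((b1 - pa2) * d b1 0)"
    by (rule mult_left_mono[OF 1]) (use c_nonneg in simp)
  then show ?thesis using 2 by (simp add: algebra_simps)
qed

text \<open>Three pieces: columns left of \<open>L1\<close> go to the top edge, the strip above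
  \<open>t0\<close> right of \<open>L1\<close> also goes to the top edge, and the remaining rows go
  to the right edge.\<close>

lemma integral_valuation_set:
  "integral {0..b1} (\<lambda>s. integral {0..b2} (\<lambda>t. d s t)) \<ge>
     integral {0..L1} (\<lambda>s. (b2 - top_cut s) * d s b2) + (c2 + b2) / 3 * integral {L1..b1} (\<lambda>s. d s b2)
     + integral {0..t0} (\<lambda>t. (b1 - right_cut t) * d b1 t)"
proof -
  have inner_cont: "continuous_on {0..b1} (\<lambda>s. integral {x..y} (\<lambda>t. d s t))"
    if "0 \<le> x" "y \<le> b2" for x y
  proof -
    have "continuous_on ({0..b1} \<times> {x..y}) (\<lambda>(s, t). d s t)"
      by (rule continuous_on_subset[OF cont]) (use that in auto)
    then show ?thesis using integral_continuous_on_param[of "{0..b1}" x y d] by simp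
  qed
  have inner_int: "(\<lambda>s. integral {x..y} (\<lambda>t. d s t)) integrable_on {u..v}"
    if "0 \<le> x" "y \<le> b2" "0 \<le> u" "v \<le> b1" for x y u v
    using continuous_on_subset[OF inner_cont[OF that(1,2)]] that by (intro integrable_continuous_real) auto
  have "integral {0..b1} (\<lambda>s. integral {0..b2} (\<lambda>t. d s t)) =
      integral {0..L1} (\<lambda>s. integral {0..b2} (\<lambda>t. d s t))
      + integral {L1..b1} (\<lambda>s. integral {0..b2} (\<lambda>t. d s t))"
    using Henstock_Kurzweil_Integration.integral_combine[OF L_nonneg(1) geometry(1) inner_int[of 0 b2 0 b1]]
    by simp
  moreover have "integral {0..L1} (\<lambda>s. integral {0..b2} (\<lambda>t. d s t)) \<ge>
      integral {0..L1} (\<lambda>s. (b2 - top_cut s) * d s b2)"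
    using column_left geometry L_nonneg b_pos
    by (intro integral_le inner_int integrable_continuous_real continuous_intros cont_top_cut cont_d_comp) auto
  moreover have "integral {L1..b1} (\<lambda>s. integral {0..b2} (\<lambda>t. d s t)) =
      integral {L1..b1} (\<lambda>s. integral {0..t0} (\<lambda>t. d s t))
      + integral {L1..b1} (\<lambda>s. integral {t0..b2} (\<lambda>t. d s t))"
  proof -
    have "integral {L1..b1} (\<lambda>s. integral {0..b2} (\<lambda>t. d s t)) =
        integral {L1..b1} (\<lambda>s. integral {0..t0} (\<lambda>t. d s t) + integral {t0..b2} (\<lambda>t. d s t))"
    proof (rule Henstock_Kurzweil_Integration.integral_cong)
      fix s assume "s \<in> {L1..b1}"
      then have "(\<lambda>t. d s t) integrable_on {0..b2}"
        using L_nonneg by (intro integrable_d_snd) auto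
      then show "integral {0..b2} (\<lambda>t. d s t) =
          integral {0..t0} (\<lambda>t. d s t) + integral {t0..b2} (\<lambda>t. d s t)"
        using Henstock_Kurzweil_Integration.integral_combine[OF t0(1,2), of "d s"] by simp
    qed
    then show ?thesis
      using inner_int t0 L_nonneg by (simp add: Henstock_Kurzweil_Integration.integral_add)
  qed
  moreover have "integral {L1..b1} (\<lambda>s. integral {t0..b2} (\<lambda>t. d s t)) \<ge>
      (c2 + b2) / 3 * integral {L1..b1} (\<lambda>s. d s b2)"
  proof -
    have "integral {L1..b1} (\<lambda>s. integral {t0..b2} (\<lambda>t. d s t)) \<ge>
        integral {L1..b1} (\<lambda>s. (c2 + b2) / 3 * d s b2)"
      using column_top t0 L_nonneg b_pos
      by (intro integral_le inner_int integrable_on_mult_right integrable_d_fst) auto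
    then show ?thesis by simp
  qed
  moreover have "integral {L1..b1} (\<lambda>s. integral {0..t0} (\<lambda>t. d s t)) =
      integral {0..t0} (\<lambda>t. integral {L1..b1} (\<lambda>s. d s t))"
    using integral_swap_continuous[of L1 0 b1 t0 d] continuous_on_subset[OF cont] t0 L_nonneg
    by (simp add: cbox_Pair_eq Sigma_mono)
  moreover have "integral {0..t0} (\<lambda>t. integral {L1..b1} (\<lambda>s. d s t)) \<ge>
      integral {0..t0} (\<lambda>t. (b1 - right_cut t) * d b1 t)"
  proof (rule integral_le)
    have "continuous_on ({0..t0} \<times> {L1..b1}) (\<lambda>(t, s). d s t)"
      unfolding case_prod_unfold
      by (rule cont_d_comp) (use t0 L_nonneg in \<open>auto intro!: continuous_intros\<close>)
    then show "(\<lambda>t. integral {L1..b1} (\<lambda>s. d s t)) integrable_on {0..t0}"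
      using integral_continuous_on_param[of "{0..t0}" L1 b1 "\<lambda>t s. d s t"]
      by (intro integrable_continuous_real) simp
    show "(\<lambda>t. (b1 - right_cut t) * d b1 t) integrable_on {0..t0}"
      using t0 b_pos by (intro integrable_continuous_real continuous_intros cont_right_cut cont_d_comp) auto
  qed (use row_right in auto)
  ultimately show ?thesis by linarith
qed

text \<open>Convexity handles the part below \<open>L2\<close>. Above \<open>L2\<close> the net
  density is nonpositive up to \<open>t0\<close> and nonnegative beyond, while \<open>d\<close>
  decreases; so comparing with the value at \<open>t0\<close> loses nothing, and the coefficient of
  that value vanishes by \<open>mass\<close>.\<close>

lemma right_edge:
  "(c1 + b1) * integral {0..b2} (\<lambda>t. d b1 t) - 3 * integral {0..t0} (\<lambda>t. (b1 - right_cut t) * d b1 t)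
     - g1 * integral {pa1..b2} (\<lambda>t. d b1 t)
     \<le> (c2 - g2) * (b1 - pa2) * d b1 0 + g2 * (b1 - pa2) * d b1 t0"
proof -
  define e where "e t = d b1 t - d b1 t0" for t
  have int_d: "(\<lambda>t. d b1 t) integrable_on {x..y}" if "0 \<le> x" "y \<le> b2" for x y
    using that b_pos by (intro integrable_d_snd) auto
  have cont_d: "continuous_on {x..y} (\<lambda>t. d b1 t)" if "0 \<le> x" "y \<le> b2" for x y
    using that b_pos by (intro cont_d_comp continuous_intros) auto
  have int_hd: "(\<lambda>t. (b1 - right_cut t) * d b1 t) integrable_on {x..y}" if "0 \<le> x" "y \<le> b2" for x y
    by (intro integrable_continuous_real continuous_intros cont_right_cut cont_d that)
  have int_h: "(\<lambda>t. b1 - right_cut t) integrable_on {x..y}" for x y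
    by (intro integrable_continuous_real continuous_intros cont_right_cut)
  have L2_le: "L2 \<le> b2" "0 \<le> L2" using geometry L_nonneg by auto
  have low: "(c1 + b1) * integral {0..L2} (\<lambda>t. d b1 t) - 3 * integral {0..L2} (\<lambda>t. (b1 - right_cut t) * d b1 t)
      \<le> (c2 - g2) * (b1 - pa2) * d b1 0"
  proof (cases "L2 = 0")
    case True
    then show ?thesis using edge(2) by auto
  next
    case False
    then have sl: "c1 + b1 - 3 * (b1 - pa2) = 2 * a2 * L2" using slope(2) L2_le by simp
    have "(c1 + b1) * integral {0..L2} (\<lambda>t. d b1 t) - 3 * integral {0..L2} (\<lambda>t. (b1 - right_cut t) * d b1 t)
        = integral {0..L2} (\<lambda>t. (c1 + b1) * d b1 t - 3 * ((b1 - right_cut t) * d b1 t))"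
      using int_d[of 0 L2] int_hd[of 0 L2] L2_le
      by (subst integral_diff) (auto intro!: integrable_on_mult_right)
    also have "\<dots> = integral {0..L2} (\<lambda>t. (2 * a2 * L2 - 3 * a2 * t) * d b1 t)"
    proof (rule Henstock_Kurzweil_Integration.integral_cong)
      fix t assume t: "t \<in> {0..L2}"
      have "0 \<le> (1 - a2) * (L2 - t)" using t a2 by simp
      moreover have "pa2 - a2 * t \<ge> L1"
      proof -
        have "a2 * t \<le> a2 * L2" using t a2 by (simp add: mult_left_mono)
        moreover have "pa2 - a2 * L2 = p - L2" by (simp add: pa2 algebra_simps)
        ultimately show ?thesis using L_sum by simp
      qed
      ultimately have "right_cut t = pa2 - a2 * t"
        using pa2_line[of t] by (simp add: right_cut_def)
      then have "c1 + b1 - 3 * (b1 - right_cut t) = 2 * a2 * L2 - 3 * a2 * t" using sl by simp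
      then have "(c1 + b1 - 3 * (b1 - right_cut t)) * d b1 t = (2 * a2 * L2 - 3 * a2 * t) * d b1 t" by simp
      then show "(c1 + b1) * d b1 t - 3 * ((b1 - right_cut t) * d b1 t) = (2 * a2 * L2 - 3 * a2 * t) * d b1 t"
        by (simp only: left_diff_distrib mult.assoc)
    qed
    also have "\<dots> \<le> a2 * L2^2 / 2 * d b1 0"
      by (rule convex_weighted_integral_le[OF conv_right cont_d]) (use L2_le a2 in auto)
    finally show ?thesis unfolding edge(2) .
  qed
  have right_cut_high: "right_cut t = max L1 (p - t)" if "L2 \<le> t" for t
    using bonus2_le[OF that] by (simp add: right_cut_def)
  have int_right_cut: "integral {L2..t0} (\<lambda>t. b1 - right_cut t) = (b1 - L1) * (t0 - L2) - (p - L1 - L2)^2 / 2"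
  proof -
    have "integral {L2..t0} (\<lambda>t. b1 - right_cut t) =
        integral {L2..p - L1} (\<lambda>t. b1 - right_cut t) + integral {p - L1..t0} (\<lambda>t. b1 - right_cut t)"
      using Henstock_Kurzweil_Integration.integral_combine[OF _ t0(4) int_h, of L2] L_sum by simp
    also have "integral {p - L1..t0} (\<lambda>t. b1 - right_cut t) = integral {p - L1..t0} (\<lambda>t. b1 - L1)"
      by (rule Henstock_Kurzweil_Integration.integral_cong) (use right_cut_high L_sum in auto)
    also have "\<dots> = (b1 - L1) * (t0 - (p - L1))" using t0 by simp
    also have "integral {L2..p - L1} (\<lambda>t. b1 - right_cut t) = integral {L2..p - L1} (\<lambda>t. b1 - p + t)"
      by (rule Henstock_Kurzweil_Integration.integral_cong) (use right_cut_high in auto)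
    also have "\<dots> = (b1 - p) * (p - L1 - L2) + ((p - L1)^2 - L2^2) / 2"
    proof -
      define F where "F t = (b1 - p) * t + t^2 / 2" for t
      have "((\<lambda>t. b1 - p + t) has_integral F (p - L1) - F L2) {L2..p - L1}"
      proof (rule fundamental_theorem_of_calculus)
        fix t
        have "(F has_real_derivative b1 - p + t) (at t within {L2..p - L1})"
          unfolding F_def by (rule derivative_eq_intros refl | simp)+
        then show "(F has_vector_derivative b1 - p + t) (at t within {L2..p - L1})"
          by (simp add: has_real_derivative_iff_has_vector_derivative)
      qed (use L_sum in simp)
      then show ?thesis
        by (simp add: integral_unique F_def algebra_simps diff_divide_distrib)
    qed
    finally show ?thesis by (simp add: field_simps power2_eq_square)
  qed
  have dec_low: "0 \<le> e t" if "L2 \<le> t" "t \<le> t0" for t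
  proof -
    have "d b1 t0 \<le> d b1 t"
      by (rule up)
        (use that t0 geometry b_pos bonus2_le[of t] L_nonneg in \<open>auto simp: gain_def\<close>)
    then show ?thesis by (simp add: e_def)
  qed
  have dec_high: "e t \<le> 0" if "t0 \<le> t" "t \<le> b2" for t
  proof -
    have "d b1 t \<le> d b1 t0"
      by (rule up)
        (use that t0 geometry b_pos bonus2_le[of t0] L_nonneg in \<open>auto simp: gain_def\<close>)
    then show ?thesis by (simp add: e_def)
  qed
  have int_e: "e integrable_on {x..y}" if "0 \<le> x" "y \<le> b2" for x y
    unfolding e_def by (intro integrable_diff int_d that) auto
  have cont_e: "continuous_on {x..y} e" if "0 \<le> x" "y \<le> b2" for x y
    unfolding e_def by (intro continuous_intros cont_d that)
  have e_split: "integral {x..y} (\<lambda>t. d b1 t) = integral {x..y} e + (y - x) * d b1 t0"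
    if "0 \<le> x" "y \<le> b2" "x \<le> y" for x y
    unfolding e_def using int_d[OF that(1,2)] that(3) by (subst integral_diff) auto
  have A: "(c1 + b1) * integral {L2..t0} e - 3 * integral {L2..t0} (\<lambda>t. (b1 - right_cut t) * e t) \<le> 0"
  proof -
    have int_he: "(\<lambda>t. (b1 - right_cut t) * e t) integrable_on {L2..t0}"
      by (intro integrable_continuous_real continuous_intros cont_right_cut cont_e) (use L2_le t0 in auto)
    have "integral {L2..t0} (\<lambda>t. (c1 + b1) * e t) \<le> integral {L2..t0} (\<lambda>t. 3 * ((b1 - right_cut t) * e t))"
    proof (rule integral_le)
      fix t assume t: "t \<in> {L2..t0}"
      have "right_cut t \<le> p - L2" using t right_cut_high[of t] L_sum by auto
      then have "c1 + b1 \<le> 3 * (b1 - right_cut t)" using depth(2) by simp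
      then have "(c1 + b1) * e t \<le> 3 * (b1 - right_cut t) * e t"
        by (rule mult_right_mono) (use dec_low t in auto)
      then show "(c1 + b1) * e t \<le> 3 * ((b1 - right_cut t) * e t)" by (simp only: mult.assoc)
    qed (use int_he int_e L2_le t0 in \<open>auto intro!: integrable_on_mult_right\<close>)
    then show ?thesis by simp
  qed
  have B: "(c1 + b1 - g1) * integral {t0..b2} e \<le> 0"
  proof -
    have "integral {t0..b2} e \<le> integral {t0..b2} (\<lambda>_. 0)"
      by (intro integral_le int_e) (use dec_high t0 in auto)
    then show ?thesis using g1 b_pos by (intro mult_nonneg_nonpos) auto
  qed
  \<comment> \<open>This holds in either order of \<open>pa1\<close> and \<open>t0\<close>, since
    \<open>e\<close> is nonnegative between \<open>L2\<close> and \<open>t0\<close> and nonpositive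
    above \<open>t0\<close>.\<close>
  have C: "integral {t0..b2} e \<le> integral {pa1..b2} e"
  proof (cases "pa1 \<le> t0")
    case True
    show ?thesis
      by (rule integral_ge_tail) (use True geometry t0 L2_le dec_low in \<open>auto intro!: int_e\<close>)
  next
    case False
    have "integral {t0..b2} (\<lambda>t. - e t) \<ge> integral {pa1..b2} (\<lambda>t. - e t)"
      by (rule integral_ge_tail)
        (use False pa_le t0 dec_high in \<open>auto intro!: int_e integrable_neg\<close>)
    then show ?thesis by simp
  qed
  have D: "g1 * integral {t0..b2} e \<le> g1 * integral {pa1..b2} e"
    by (rule mult_left_mono[OF C g1(1)])
  have split1: "integral {0..b2} (\<lambda>t. d b1 t) =
      integral {0..L2} (\<lambda>t. d b1 t) + (integral {L2..t0} (\<lambda>t. d b1 t) + integral {t0..b2} (\<lambda>t. d b1 t))"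
    using Henstock_Kurzweil_Integration.integral_combine[OF L2_le(2,1) int_d[of 0 b2]]
      Henstock_Kurzweil_Integration.integral_combine[OF t0(3,2) int_d[of L2 b2]] L2_le by simp
  have split2: "integral {0..t0} (\<lambda>t. (b1 - right_cut t) * d b1 t) =
      integral {0..L2} (\<lambda>t. (b1 - right_cut t) * d b1 t) + integral {L2..t0} (\<lambda>t. (b1 - right_cut t) * d b1 t)"
    using Henstock_Kurzweil_Integration.integral_combine[OF L2_le(2) t0(3) int_hd[of 0 t0]] t0 by simp
  have split3: "integral {L2..t0} (\<lambda>t. (b1 - right_cut t) * d b1 t) =
      integral {L2..t0} (\<lambda>t. (b1 - right_cut t) * e t) + integral {L2..t0} (\<lambda>t. b1 - right_cut t) * d b1 t0"
  proof -
    have "integral {L2..t0} (\<lambda>t. (b1 - right_cut t) * e t) =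
        integral {L2..t0} (\<lambda>t. (b1 - right_cut t) * d b1 t - (b1 - right_cut t) * d b1 t0)"
      by (simp add: e_def right_diff_distrib)
    also have "\<dots> = integral {L2..t0} (\<lambda>t. (b1 - right_cut t) * d b1 t) - integral {L2..t0} (\<lambda>t. (b1 - right_cut t) * d b1 t0)"
      using int_hd[of L2 t0] int_h[of L2 t0] t0 L2_le
      by (intro integral_diff) (auto intro!: integrable_on_mult_left)
    finally show ?thesis by simp
  qed
  have Z: "(c1 + b1) * (b2 - L2) * d b1 t0 - 3 * (integral {L2..t0} (\<lambda>t. b1 - right_cut t) * d b1 t0)
      - g1 * (b2 - pa1) * d b1 t0 - g2 * (b1 - pa2) * d b1 t0 = 0"
  proof -
    have "(c1 + b1) * (b2 - L2) - 3 * integral {L2..t0} (\<lambda>t. b1 - right_cut t)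
      - g1 * (b2 - pa1) - g2 * (b1 - pa2) = 0"
      unfolding int_right_cut using mass by (simp add: t0_def field_simps)
    then have "((c1 + b1) * (b2 - L2) - 3 * integral {L2..t0} (\<lambda>t. b1 - right_cut t)
      - g1 * (b2 - pa1) - g2 * (b1 - pa2)) * d b1 t0 = 0" by simp
    then show ?thesis by (simp only: left_diff_distrib mult.assoc)
  qed
  have E: "integral {L2..t0} (\<lambda>t. d b1 t) = integral {L2..t0} e + (t0 - L2) * d b1 t0"
    "integral {t0..b2} (\<lambda>t. d b1 t) = integral {t0..b2} e + (b2 - t0) * d b1 t0"
    "integral {pa1..b2} (\<lambda>t. d b1 t) = integral {pa1..b2} e + (b2 - pa1) * d b1 t0"
    using e_split[of L2 t0] e_split[of t0 b2] e_split[of pa1 b2] t0 L2_le geometry pa_le by auto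
  have "(c1 + b1) * integral {0..b2} (\<lambda>t. d b1 t) - 3 * integral {0..t0} (\<lambda>t. (b1 - right_cut t) * d b1 t)
      - g1 * integral {pa1..b2} (\<lambda>t. d b1 t)
      = ((c1 + b1) * integral {0..L2} (\<lambda>t. d b1 t) - 3 * integral {0..L2} (\<lambda>t. (b1 - right_cut t) * d b1 t))
      + ((c1 + b1) * integral {L2..t0} e - 3 * integral {L2..t0} (\<lambda>t. (b1 - right_cut t) * e t))
      + (c1 + b1 - g1) * integral {t0..b2} e
      + (g1 * integral {t0..b2} e - g1 * integral {pa1..b2} e)
      + ((c1 + b1) * (b2 - L2) * d b1 t0 - 3 * (integral {L2..t0} (\<lambda>t. b1 - right_cut t) * d b1 t0)
         - g1 * (b2 - pa1) * d b1 t0)"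
    unfolding split1 split2 split3 E by algebra
  then show ?thesis using low A B D Z by linarith
qed

lemma deviation_not_profitable:
  "(c1 + b1) * integral {0..b2} (\<lambda>t. d b1 t) - c1 * integral {0..b2} (\<lambda>t. d 0 t)
   + (c2 + b2) * integral {0..b1} (\<lambda>s. d s b2) - c2 * integral {0..b1} (\<lambda>s. d s 0)
   - 3 * integral {0..b1} (\<lambda>s. integral {0..b2} (\<lambda>t. d s t)) \<le> 0"
proof -
  have int_top: "(\<lambda>s. d s b2) integrable_on {x..y}" if "0 \<le> x" "y \<le> b1" for x y
    using that b_pos by (intro integrable_d_fst) auto
  have cont_top: "continuous_on {0..L1} (\<lambda>s. d s b2)"
    using geometry b_pos by (intro cont_d_comp continuous_intros) auto
  have "(c2 + b2) * integral {0..L1} (\<lambda>s. d s b2) - 3 * integral {0..L1} (\<lambda>s. (b2 - top_cut s) * d s b2)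
      \<le> (c1 - g1) * (b2 - pa1) * d 0 b2"
  proof (cases "L1 = 0")
    case True
    then show ?thesis using edge(1) by auto
  next
    case False
    then have sl: "c2 + b2 - 3 * (b2 - pa1) = 2 * a1 * L1" using slope(1) L_nonneg by simp
    have "(\<lambda>s. (b2 - top_cut s) * d s b2) integrable_on {0..L1}"
      by (intro integrable_continuous_real continuous_intros cont_top_cut cont_top)
    then have "(c2 + b2) * integral {0..L1} (\<lambda>s. d s b2) - 3 * integral {0..L1} (\<lambda>s. (b2 - top_cut s) * d s b2)
        = integral {0..L1} (\<lambda>s. (c2 + b2) * d s b2 - 3 * ((b2 - top_cut s) * d s b2))"
      using int_top[of 0 L1] geometry
      by (subst integral_diff) (auto intro!: integrable_on_mult_right)
    also have "\<dots> = integral {0..L1} (\<lambda>s. (2 * a1 * L1 - 3 * a1 * s) * d s b2)"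
    proof (rule Henstock_Kurzweil_Integration.integral_cong)
      fix s
      have "c2 + b2 - 3 * (b2 - top_cut s) = 2 * a1 * L1 - 3 * a1 * s" using sl by (simp add: top_cut_def)
      then have "(c2 + b2 - 3 * (b2 - top_cut s)) * d s b2 = (2 * a1 * L1 - 3 * a1 * s) * d s b2" by simp
      then show "(c2 + b2) * d s b2 - 3 * ((b2 - top_cut s) * d s b2) = (2 * a1 * L1 - 3 * a1 * s) * d s b2"
        by (simp only: left_diff_distrib mult.assoc)
    qed
    also have "\<dots> \<le> a1 * L1^2 / 2 * d 0 b2"
      by (rule convex_weighted_integral_le[OF conv_top cont_top]) (use L_nonneg a1 in auto)
    finally show ?thesis unfolding edge(1) .
  qed
  moreover have "integral {0..b1} (\<lambda>s. d s b2) = integral {0..L1} (\<lambda>s. d s b2) + integral {L1..b1} (\<lambda>s. d s b2)"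
    using Henstock_Kurzweil_Integration.integral_combine[OF L_nonneg(1) geometry(1) int_top[of 0 b1]] by simp
  ultimately have "(c2 + b2) * integral {0..b1} (\<lambda>s. d s b2)
      \<le> 3 * integral {0..L1} (\<lambda>s. (b2 - top_cut s) * d s b2) + (c1 - g1) * (b2 - pa1) * d 0 b2
        + (c2 + b2) * integral {L1..b1} (\<lambda>s. d s b2)"
    by (simp add: distrib_left)
  moreover have "3 * integral {0..b1} (\<lambda>s. integral {0..b2} (\<lambda>t. d s t)) \<ge>
      3 * integral {0..L1} (\<lambda>s. (b2 - top_cut s) * d s b2) + (c2 + b2) * integral {L1..b1} (\<lambda>s. d s b2)
      + 3 * integral {0..t0} (\<lambda>t. (b1 - right_cut t) * d b1 t)"
    using integral_valuation_set by simp
  ultimately show ?thesis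
    using left_edge bottom_edge right_edge by linarith
qed

end

section \<open>Optimal menus from certificates\<close>

lemma boundary_functional_diff:
  assumes f: "continuous_on UNIV f" and g: "continuous_on UNIV g"
  shows "boundary_functional c1 c2 b1 b2 f - boundary_functional c1 c2 b1 b2 g =
    (c1 + b1) * integral {0..b2} (\<lambda>t. f (c1 + b1, c2 + t) - g (c1 + b1, c2 + t))
    - c1 * integral {0..b2} (\<lambda>t. f (c1 + 0, c2 + t) - g (c1 + 0, c2 + t))
    + (c2 + b2) * integral {0..b1} (\<lambda>s. f (c1 + s, c2 + b2) - g (c1 + s, c2 + b2))
    - c2 * integral {0..b1} (\<lambda>s. f (c1 + s, c2 + 0) - g (c1 + s, c2 + 0))
    - 3 * integral {0..b1} (\<lambda>s. integral {0..b2} (\<lambda>t. f (c1 + s, c2 + t) - g (c1 + s, c2 + t)))"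
proof -
  define h where "h z = f z - g z" for z
  have shift: "integral {0..b} (\<lambda>x. k (c + x)) = integral {c..c + b} k" for b c and k :: "real \<Rightarrow> real"
    using integral_shift_Icc_real[of 0 b k c] by (simp add: comp_def add.commute)
  have cont_comp: "continuous_on A (\<lambda>x. f (r x))" "continuous_on A (\<lambda>x. g (r x))"
    if "continuous_on A r" for A :: "real set" and r
    using continuous_on_compose2[OF f that] continuous_on_compose2[OF g that] by simp_all
  have fst: "integral {a..b} (\<lambda>x. h (x, y)) = integral {a..b} (\<lambda>x. f (x, y)) - integral {a..b} (\<lambda>x. g (x, y))"
    and snd: "integral {a..b} (\<lambda>x. h (y, x)) = integral {a..b} (\<lambda>x. f (y, x)) - integral {a..b} (\<lambda>x. g (y, x))"
    for a b y
    unfolding h_def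
    by (intro integral_diff integrable_continuous_real cont_comp continuous_intros)+
  have conts: "continuous_on (valuations c1 c2 b1 b2) f" "continuous_on (valuations c1 c2 b1 b2) g"
    using f g continuous_on_subset by blast+
  then have "integral (valuations c1 c2 b1 b2) h =
      integral (valuations c1 c2 b1 b2) f - integral (valuations c1 c2 b1 b2) g"
    unfolding h_def valuations_cbox by (intro integral_diff integrable_continuous)
  moreover have "integral (valuations c1 c2 b1 b2) h =
      integral {c1..c1 + b1} (\<lambda>x. integral {c2..c2 + b2} (\<lambda>y. h (x, y)))"
    by (rule integral_valuations_fst) (unfold h_def, intro continuous_intros conts)
  ultimately have "boundary_functional c1 c2 b1 b2 f - boundary_functional c1 c2 b1 b2 g =
     (c1 + b1) * integral {c2..c2 + b2} (\<lambda>y. h (c1 + b1, y))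
     - c1 * integral {c2..c2 + b2} (\<lambda>y. h (c1 + 0, y))
     + (c2 + b2) * integral {c1..c1 + b1} (\<lambda>x. h (x, c2 + b2))
     - c2 * integral {c1..c1 + b1} (\<lambda>x. h (x, c2 + 0))
     - 3 * integral {c1..c1 + b1} (\<lambda>x. integral {c2..c2 + b2} (\<lambda>y. h (x, y)))"
    unfolding boundary_functional_def fst snd add_0_right by (simp add: right_diff_distrib)
  then show ?thesis
    unfolding shift[symmetric] by (simp only: h_def)
qed

lemma convex_on_if_subgradient:
  fixes f :: "real \<Rightarrow> real"
  assumes "convex A" and sub: "\<And>m. m \<in> A \<Longrightarrow> \<exists>k. \<forall>x\<in>A. f x \<ge> f m + k * (x - m)"
  shows "convex_on A f"
proof (rule convex_onI[OF _ assms(1)])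
  fix l x y :: real
  assume l: "0 < l" "l < 1" and xy: "x \<in> A" "y \<in> A"
  let ?m = "(1 - l) *\<^sub>R x + l *\<^sub>R y"
  have "?m \<in> A" using assms(1) xy l by (simp add: convex_alt)
  then obtain k where k: "\<And>x. x \<in> A \<Longrightarrow> f x \<ge> f ?m + k * (x - ?m)" using sub by blast
  have "(1 - l) * f x + l * f y \<ge> (1 - l) * (f ?m + k * (x - ?m)) + l * (f ?m + k * (y - ?m))"
    using k[OF xy(1)] k[OF xy(2)] l by (intro add_mono mult_left_mono) auto
  moreover have "(1 - l) * (f ?m + k * (x - ?m)) + l * (f ?m + k * (y - ?m)) = f ?m"
    by (simp add: algebra_simps)
  ultimately show "f ?m \<le> (1 - l) * f x + l * f y" by simp
qed

lemma max_bonus_ge: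
  fixes x y z :: real
  shows "0 \<le> max 0 (z + max 0 (max x y))" "z \<le> max 0 (z + max 0 (max x y))"
    "z + x \<le> max 0 (z + max 0 (max x y))" "z + y \<le> max 0 (z + max 0 (max x y))"
  by auto

section \<open>From a certificate to optimal menus\<close>

context certificate
begin

lemma continuous_gain: "continuous_on A (\<lambda>z. max 0 (gain (fst z - c1) (snd z - c2)))"
  unfolding gain_def by (intro continuous_intros)

lemma gain_up:
  assumes "t \<le> t'" "0 \<le> gain s t" "(1 - a2) * (L2 - t) \<le> max 0 ((1 - a1) * (L1 - s))"
  shows "max 0 (gain s t') \<ge> max 0 (gain s t) + (t' - t)"
  using assms by (auto simp: gain_def)

lemma gain_right:
  assumes "s \<le> s'" "0 \<le> gain s t" "(1 - a1) * (L1 - s) \<le> max 0 ((1 - a2) * (L2 - t))"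
  shows "max 0 (gain s' t) \<ge> max 0 (gain s t) + (s' - s)"
  using assms by (auto simp: gain_def)

lemma gain_top: assumes "s \<in> {0..L1}" shows "max 0 (gain s b2) = (b2 - pa1) + a1 * s"
proof -
  have "0 \<le> (1 - a1) * (L1 - s)" "0 \<le> a1 * s" using assms a1 by simp_all
  then show ?thesis
    using bonus2_le[OF geometry(2)] pa1_line[of s] pa_le by (simp add: gain_def)
qed

lemma gain_edge_right: assumes "t \<in> {0..L2}" shows "max 0 (gain b1 t) = (b1 - pa2) + a2 * t"
proof -
  have "0 \<le> (1 - a2) * (L2 - t)" "0 \<le> a2 * t" using assms a2 by simp_all
  then show ?thesis
    using bonus1_le[OF geometry(1)] pa2_line[of t] pa_le by (simp add: gain_def)
qed

text \<open>The three constraints supply the properties of \<open>d\<close>: allocations at most 1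
  bound the slopes of \<open>U\<close>, individual rationality gives \<open>U >= 0\<close>, and the
  subgradients \<open>q z\<close> give convexity.\<close>

lemma boundary_functional_le:
  assumes mech: "mechanism D q t" and ic: "incentive_compatible D q t"
    and ir: "individually_rational D q t" and D: "D = valuations c1 c2 b1 b2"
  shows "boundary_functional c1 c2 b1 b2 (utility q t) \<le>
    boundary_functional c1 c2 b1 b2 (\<lambda>z. max 0 (gain (fst z - c1) (snd z - c2)))"
proof -
  have ne: "D \<noteq> {}"
    using b_pos by (auto simp: D valuations_def)
  obtain U where contU: "continuous_on UNIV U"
    and U: "\<And>z. z \<in> D \<Longrightarrow> U z = utility q t z"
    and sub: "\<And>z w. z \<in> D \<Longrightarrow> U w \<ge> U z + (w - z) \<bullet> q z"
    using utility_extension[OF mech ic ne] by blast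
  have in_D: "(c1 + s, c2 + r) \<in> D" if "s \<in> {0..b1}" "r \<in> {0..b2}" for s r
    using that by (simp add: D valuations_def)
  have q_le: "fst (q z) \<le> 1" "snd (q z) \<le> 1" if "z \<in> D" for z
    using mech that by (auto simp: mechanism_def mem_Times_iff)
  have U_up: "U (c1 + s, c2 + r') \<le> U (c1 + s, c2 + r) + (r' - r)"
    if "s \<in> {0..b1}" "r' \<in> {0..b2}" "r \<le> r'" for s r r'
  proof -
    have "(r' - r) * snd (q (c1 + s, c2 + r')) \<le> (r' - r)"
      using q_le(2)[OF in_D[OF that(1,2)]] that(3) by (simp add: mult_left_le)
    then show ?thesis
      using sub[OF in_D[OF that(1,2)], of "(c1 + s, c2 + r)"] by (simp add: inner_prod_def left_diff_distrib)
  qed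
  have U_right: "U (c1 + s', c2 + r) \<le> U (c1 + s, c2 + r) + (s' - s)"
    if "s' \<in> {0..b1}" "r \<in> {0..b2}" "s \<le> s'" for s s' r
  proof -
    have "(s' - s) * fst (q (c1 + s', c2 + r)) \<le> (s' - s)"
      using q_le(1)[OF in_D[OF that(1,2)]] that(3) by (simp add: mult_left_le)
    then show ?thesis
      using sub[OF in_D[OF that(1,2)], of "(c1 + s, c2 + r)"] by (simp add: inner_prod_def left_diff_distrib)
  qed
  define d where "d s r = U (c1 + s, c2 + r) - max 0 (gain s r)" for s r
  interpret certificate_deviation c1 c2 b1 b2 L1 L2 a1 a2 g1 g2 p pa1 pa2 d
  proof unfold_locales
    show "continuous_on ({0..b1} \<times> {0..b2}) (\<lambda>(s, r). d s r)"
      unfolding d_def gain_def case_prod_unfold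
      by (intro continuous_intros continuous_on_compose2[OF contU]) auto
    show "0 \<le> d s r" if "s \<in> {0..b1}" "r \<in> {0..b2}" "gain s r \<le> 0" for s r
      using U[OF in_D[OF that(1,2)]] ir in_D[OF that(1,2)] that(3)
      by (auto simp: d_def individually_rational_def utility_def)
    show "d s r' \<le> d s r"
      if "s \<in> {0..b1}" "r \<in> {0..b2}" "r' \<in> {r..b2}" "0 \<le> gain s r"
        "(1 - a2) * (L2 - r) \<le> max 0 ((1 - a1) * (L1 - s))" for s r r'
      using U_up[of s r' r] gain_up[of r r' s] that by (simp add: d_def)
    show "d s' r \<le> d s r"
      if "s \<in> {0..b1}" "r \<in> {0..b2}" "s' \<in> {s..b1}" "0 \<le> gain s r"
        "(1 - a1) * (L1 - s) \<le> max 0 ((1 - a2) * (L2 - r))" for s r s'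
      using U_right[of s' r s] gain_right[of s s' r] that by (simp add: d_def)
    show "convex_on {0..L1} (\<lambda>s. d s b2)"
    proof (rule convex_on_if_subgradient)
      fix m assume m: "m \<in> {0..L1}"
      then have z: "(c1 + m, c2 + b2) \<in> D" using geometry(1) b_pos by (intro in_D) auto
      have "d x b2 \<ge> d m b2 + (fst (q (c1 + m, c2 + b2)) - a1) * (x - m)" if "x \<in> {0..L1}" for x
        using sub[OF z, of "(c1 + x, c2 + b2)"] gain_top[OF m] gain_top[OF that]
        by (simp add: d_def inner_prod_def algebra_simps)
      then show "\<exists>k. \<forall>x\<in>{0..L1}. d x b2 \<ge> d m b2 + k * (x - m)" by blast
    qed simp
    show "convex_on {0..L2} (\<lambda>r. d b1 r)"
    proof (rule convex_on_if_subgradient)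
      fix m assume m: "m \<in> {0..L2}"
      then have z: "(c1 + b1, c2 + m) \<in> D" using geometry(2) b_pos by (intro in_D) auto
      have "d b1 x \<ge> d b1 m + (snd (q (c1 + b1, c2 + m)) - a2) * (x - m)" if "x \<in> {0..L2}" for x
        using sub[OF z, of "(c1 + b1, c2 + x)"] gain_edge_right[OF m] gain_edge_right[OF that]
        by (simp add: d_def inner_prod_def algebra_simps)
      then show "\<exists>k. \<forall>x\<in>{0..L2}. d b1 x \<ge> d b1 m + k * (x - m)" by blast
    qed simp
  qed
  let ?G = "\<lambda>z. max 0 (gain (fst z - c1) (snd z - c2))"
  have "boundary_functional c1 c2 b1 b2 U - boundary_functional c1 c2 b1 b2 ?G \<le> 0"
    using deviation_not_profitable
    unfolding boundary_functional_diff[OF contU continuous_gain] d_def by simp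
  moreover have "boundary_functional c1 c2 b1 b2 U = boundary_functional c1 c2 b1 b2 (utility q t)"
    by (rule boundary_functional_cong) (use b_pos U D in auto)
  ultimately show ?thesis by simp
qed

lemma optimal_mechanism_if_utility:
  assumes mech: "mechanism D q t" and ic: "incentive_compatible D q t"
    and ir: "individually_rational D q t" and D: "D = valuations c1 c2 b1 b2"
    and int: "integrable (lebesgue_on D) t"
    and ut: "\<And>z. z \<in> D \<Longrightarrow> utility q t z = max 0 (gain (fst z - c1) (snd z - c2))"
  shows "optimal_mechanism D q t"
  unfolding optimal_mechanism_def
proof (intro conjI allI impI mech ic ir)
  fix q' t' assume *: "mechanism D q' t' \<and> incentive_compatible D q' t' \<and> individually_rational D q' t'"
  have "(\<integral>z. t' z \<partial>lebesgue_on D) \<le> (\<integral>z. t z \<partial>lebesgue_on D)"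
  proof (cases "integrable (lebesgue_on D) t'")
    case True
    have "(\<integral>z. t' z \<partial>lebesgue_on D) = boundary_functional c1 c2 b1 b2 (utility q' t')"
      using * c_nonneg b_pos D True by (intro revenue_eq_boundary_functional) auto
    also have "\<dots> \<le> boundary_functional c1 c2 b1 b2 (\<lambda>z. max 0 (gain (fst z - c1) (snd z - c2)))"
      using * D by (intro boundary_functional_le) auto
    also have "\<dots> = boundary_functional c1 c2 b1 b2 (utility q t)"
      by (rule boundary_functional_cong) (use b_pos ut D in auto)
    also have "\<dots> = (\<integral>z. t z \<partial>lebesgue_on D)"
      using c_nonneg b_pos
      by (intro revenue_eq_boundary_functional[OF mech ic D _ _ _ _ int, symmetric]) auto
    finally show ?thesis .
  next
    \<comment> \<open>A non-integrable competitor has revenue 0 by convention, which nonnegative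
      payments cannot fall below.\<close>
    case False
    have "0 \<le> (\<integral>z. t z \<partial>lebesgue_on D)"
      by (rule Bochner_Integration.integral_nonneg_AE)
        (use mech in \<open>auto simp: mechanism_def\<close>)
    then show ?thesis using False by (simp add: not_integrable_integral_eq)
  qed
  then show "expected_revenue D t' \<le> expected_revenue D t"
    using b_pos by (simp add: expected_revenue_valuations[OF D] divide_right_mono)
qed

lemma optimal_menu_if_utility:
  assumes D: "D = valuations c1 c2 b1 b2" and fin: "finite M"
    and alloc: "\<And>x s. (x, s) \<in> M \<Longrightarrow> x \<in> {0..1} \<times> {0..1} \<and> 0 \<le> s"
    and zero: "((0, 0), 0) \<in> M"
    and le: "\<And>z x s. \<lbrakk>z \<in> D; (x, s) \<in> M\<rbrakk> \<Longrightarrow> z \<bullet> x - s \<le> max 0 (gain (fst z - c1) (snd z - c2))"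
    and ge: "\<And>z. z \<in> D \<Longrightarrow> \<exists>(x, s)\<in>M. max 0 (gain (fst z - c1) (snd z - c2)) \<le> z \<bullet> x - s"
  shows "optimal_menu D M"
  unfolding optimal_menu_def
proof (intro conjI allI impI fin)
  show "\<forall>(x, s)\<in>M. x \<in> {0..1} \<times> {0..1}" using alloc by blast
  fix q t assume ind: "induced_by D M q t"
  then have in_M: "(q z, t z) \<in> M" and best: "\<And>x s. (x, s) \<in> M \<Longrightarrow> z \<bullet> x - s \<le> z \<bullet> q z - t z"
    if "z \<in> D" for z
    using that by (auto simp: induced_by_def)
  show "optimal_mechanism D q t"
  proof (rule optimal_mechanism_if_utility[OF _ _ _ D])
    show "mechanism D q t" using alloc[OF in_M] by (auto simp: mechanism_def)
    show "incentive_compatible D q t" using best in_M by (auto simp: incentive_compatible_def)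
    show "individually_rational D q t"
      using best[OF _ zero] by (auto simp: individually_rational_def inner_prod_def)
    show "integrable (lebesgue_on D) t" by (rule integrable_of_menu[OF fin ind D])
    show "utility q t z = max 0 (gain (fst z - c1) (snd z - c2))" if z: "z \<in> D" for z
    proof (rule antisym)
      show "utility q t z \<le> max 0 (gain (fst z - c1) (snd z - c2))"
        unfolding utility_def by (rule le[OF z in_M[OF z]])
      obtain x s where "(x, s) \<in> M" "max 0 (gain (fst z - c1) (snd z - c2)) \<le> z \<bullet> x - s"
        using ge[OF z] by auto
      then show "max 0 (gain (fst z - c1) (snd z - c2)) \<le> utility q t z"
        unfolding utility_def using best[OF z, of x s] by linarith
    qed
  qed
qed

lemma menu_values:
  "z \<bullet> (a1, 1) - (a1 * c1 + c2 + pa1) = (fst z - c1) + (snd z - c2) - p + (1 - a1) * (L1 - (fst z - c1))"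
  "z \<bullet> (1, a2) - (c1 + a2 * c2 + pa2) = (fst z - c1) + (snd z - c2) - p + (1 - a2) * (L2 - (snd z - c2))"
  "z \<bullet> (1, 1) - (c1 + c2 + p) = (fst z - c1) + (snd z - c2) - p"
  "z \<bullet> (0, 0) - 0 = 0"
  by (simp_all add: inner_prod_def pa1 pa2 algebra_simps)

lemma prices_nonneg:
  "0 \<le> a1 * c1 + c2 + pa1" "0 \<le> c1 + a2 * c2 + pa2" "0 \<le> c1 + c2 + p"
  using a1 a2 c_nonneg L_nonneg L_sum geometry by simp_all

lemma optimal_menu_a:
  "optimal_menu (valuations c1 c2 b1 b2) (menu_a c1 c2 a1 pa1 a2 pa2 p)"
proof (rule optimal_menu_if_utility[OF refl])
  show "z \<bullet> x - s \<le> max 0 (gain (fst z - c1) (snd z - c2))"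
    if m: "(x, s) \<in> menu_a c1 c2 a1 pa1 a2 pa2 p" for z x s
  proof -
    consider "x = (0, 0)" "s = 0" | "x = (a1, 1)" "s = a1 * c1 + c2 + pa1"
      | "x = (1, a2)" "s = c1 + a2 * c2 + pa2" | "x = (1, 1)" "s = c1 + c2 + p"
      using m by (auto simp: menu_a_def)
    then show ?thesis
      by cases (simp_all only: menu_values gain_def max_bonus_ge)
  qed
  show "\<exists>(x, s)\<in>menu_a c1 c2 a1 pa1 a2 pa2 p. max 0 (gain (fst z - c1) (snd z - c2)) \<le> z \<bullet> x - s" for z
  proof -
    have "max 0 (gain (fst z - c1) (snd z - c2)) = z \<bullet> (0, 0) - 0
      \<or> max 0 (gain (fst z - c1) (snd z - c2)) = z \<bullet> (a1, 1) - (a1 * c1 + c2 + pa1)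
      \<or> max 0 (gain (fst z - c1) (snd z - c2)) = z \<bullet> (1, a2) - (c1 + a2 * c2 + pa2)
      \<or> max 0 (gain (fst z - c1) (snd z - c2)) = z \<bullet> (1, 1) - (c1 + c2 + p)"
      unfolding menu_values gain_def max_def by simp
    then show ?thesis unfolding menu_a_def by fastforce
  qed
qed (use a1 a2 prices_nonneg in \<open>auto simp: menu_a_def\<close>)

text \<open>With \<open>a2 = 1\<close> the bonus of \<open>(1, a2)\<close> in \<open>gain\<close>
  vanishes, so that this entry coincides with \<open>(1, 1)\<close>.\<close>

lemma optimal_menu_b:
  assumes "a2 = 1"
  shows "optimal_menu (valuations c1 c2 b1 b2) (menu_b c1 c2 a1 pa1 p)"
proof (rule optimal_menu_if_utility[OF refl])
  show "z \<bullet> x - s \<le> max 0 (gain (fst z - c1) (snd z - c2))"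
    if m: "(x, s) \<in> menu_b c1 c2 a1 pa1 p" for z x s
  proof -
    consider "x = (0, 0)" "s = 0" | "x = (a1, 1)" "s = a1 * c1 + c2 + pa1"
      | "x = (1, 1)" "s = c1 + c2 + p"
      using m by (auto simp: menu_b_def)
    then show ?thesis
      by cases (simp_all only: menu_values gain_def max_bonus_ge)
  qed
  show "\<exists>(x, s)\<in>menu_b c1 c2 a1 pa1 p. max 0 (gain (fst z - c1) (snd z - c2)) \<le> z \<bullet> x - s" for z
  proof -
    have "max 0 (gain (fst z - c1) (snd z - c2)) = z \<bullet> (0, 0) - 0
      \<or> max 0 (gain (fst z - c1) (snd z - c2)) = z \<bullet> (a1, 1) - (a1 * c1 + c2 + pa1)
      \<or> max 0 (gain (fst z - c1) (snd z - c2)) = z \<bullet> (1, 1) - (c1 + c2 + p)"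
      unfolding menu_values gain_def max_def unfolding assms by simp
    then show ?thesis unfolding menu_b_def by fastforce
  qed
qed (use a1 prices_nonneg in \<open>auto simp: menu_b_def\<close>)

lemma optimal_menu_b':
  assumes "a1 = 1"
  shows "optimal_menu (valuations c1 c2 b1 b2) (menu_b' c1 c2 a2 pa2 p)"
proof (rule optimal_menu_if_utility[OF refl])
  show "z \<bullet> x - s \<le> max 0 (gain (fst z - c1) (snd z - c2))"
    if m: "(x, s) \<in> menu_b' c1 c2 a2 pa2 p" for z x s
  proof -
    consider "x = (0, 0)" "s = 0" | "x = (1, a2)" "s = c1 + a2 * c2 + pa2"
      | "x = (1, 1)" "s = c1 + c2 + p"
      using m by (auto simp: menu_b'_def)
    then show ?thesis
      by cases (simp_all only: menu_values gain_def max_bonus_ge)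
  qed
  show "\<exists>(x, s)\<in>menu_b' c1 c2 a2 pa2 p. max 0 (gain (fst z - c1) (snd z - c2)) \<le> z \<bullet> x - s" for z
  proof -
    have "max 0 (gain (fst z - c1) (snd z - c2)) = z \<bullet> (0, 0) - 0
      \<or> max 0 (gain (fst z - c1) (snd z - c2)) = z \<bullet> (1, a2) - (c1 + a2 * c2 + pa2)
      \<or> max 0 (gain (fst z - c1) (snd z - c2)) = z \<bullet> (1, 1) - (c1 + c2 + p)"
      unfolding menu_values gain_def max_def unfolding assms by simp
    then show ?thesis unfolding menu_b'_def by fastforce
  qed
qed (use a2 prices_nonneg in \<open>auto simp: menu_b'_def\<close>)

lemma bundle_values:
  assumes "a1 = 1" "a2 = 1"
  shows "max 0 (gain (fst z - c1) (snd z - c2)) = max 0 (z \<bullet> (1, 1) - (c1 + c2 + p))"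
  unfolding menu_values gain_def unfolding assms by simp

lemma optimal_menu_c:
  assumes "a1 = 1" "a2 = 1"
  shows "optimal_menu (valuations c1 c2 b1 b2) (menu_c c1 c2 p)"
proof (rule optimal_menu_if_utility[OF refl])
  show "z \<bullet> x - s \<le> max 0 (gain (fst z - c1) (snd z - c2))" if "(x, s) \<in> menu_c c1 c2 p" for z x s
    using that unfolding bundle_values[OF assms] by (auto simp: menu_c_def inner_prod_def)
  show "\<exists>(x, s)\<in>menu_c c1 c2 p. max 0 (gain (fst z - c1) (snd z - c2)) \<le> z \<bullet> x - s" for z
    unfolding bundle_values[OF assms] by (auto simp: menu_c_def max_def inner_prod_def)
qed (use prices_nonneg in \<open>auto simp: menu_c_def\<close>)

text \<open>Here \<open>(1, 1)\<close> is offered a second time at a price that is not lower.\<close>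

lemma optimal_menu_b_bundle:
  assumes "a1 = 1" "a2 = 1" "p \<le> pa"
  shows "optimal_menu (valuations c1 c2 b1 b2) (menu_b c1 c2 1 pa p)"
proof (rule optimal_menu_if_utility[OF refl])
  show "z \<bullet> x - s \<le> max 0 (gain (fst z - c1) (snd z - c2))" if "(x, s) \<in> menu_b c1 c2 1 pa p" for z x s
    using that assms(3) unfolding bundle_values[OF assms(1,2)] by (auto simp: menu_b_def inner_prod_def)
  show "\<exists>(x, s)\<in>menu_b c1 c2 1 pa p. max 0 (gain (fst z - c1) (snd z - c2)) \<le> z \<bullet> x - s" for z
    unfolding bundle_values[OF assms(1,2)] by (auto simp: menu_b_def max_def inner_prod_def)
qed (use prices_nonneg assms(3) in \<open>auto simp: menu_b_def\<close>)

lemma optimal_menu_b'_bundle: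
  assumes "a1 = 1" "a2 = 1" "p \<le> pa"
  shows "optimal_menu (valuations c1 c2 b1 b2) (menu_b' c1 c2 1 pa p)"
proof (rule optimal_menu_if_utility[OF refl])
  show "z \<bullet> x - s \<le> max 0 (gain (fst z - c1) (snd z - c2))" if "(x, s) \<in> menu_b' c1 c2 1 pa p" for z x s
    using that assms(3) unfolding bundle_values[OF assms(1,2)] by (auto simp: menu_b'_def inner_prod_def)
  show "\<exists>(x, s)\<in>menu_b' c1 c2 1 pa p. max 0 (gain (fst z - c1) (snd z - c2)) \<le> z \<bullet> x - s" for z
    unfolding bundle_values[OF assms(1,2)] by (auto simp: menu_b'_def max_def inner_prod_def)
qed (use prices_nonneg assms(3) in \<open>auto simp: menu_b'_def\<close>)

lemma no_sale_shape:
  "no_sale_shape_a c1 c2 b1 b2 a1 pa1 a2 pa2 p"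
proof -
  have "0 \<le> a1 * L1" "0 \<le> a2 * L2" using a1 a2 L_nonneg by simp_all
  then have "c2 + (p - L1) \<le> c2 + pa1" "c1 + (p - L2) \<le> c1 + pa2"
    by (simp_all add: pa1 pa2 algebra_simps)
  then show ?thesis
    unfolding no_sale_shape_a_def
    using L_nonneg L_sum pa_le
    by (intro exI[of _ "c1 + L1"] exI[of _ "c2 + (p - L1)"] exI[of _ "c1 + (p - L2)"] exI[of _ "c2 + L2"])
      (auto simp: pa1 pa2 algebra_simps)
qed

end

section \<open>One side of a certificate\<close>

text \<open>The hypotheses of \<open>certificate\<close> about one item. On the top edge the net
  density at \<open>s\<close> is \<open>T - 3 * (b - pa + a * s)\<close>; the slope condition makes
  it \<open>2 * a * L - 3 * a * s\<close>, and the last condition matches its total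
  \<open>a * L^2 / 2\<close> with the mass \<open>(c - g) * (b - pa)\<close> arriving from the left
  edge.\<close>

definition half_certificate :: "real \<Rightarrow> real \<Rightarrow> real \<Rightarrow> real \<Rightarrow> real \<Rightarrow> real \<Rightarrow> real \<Rightarrow> real \<Rightarrow> bool" where
  "half_certificate c T b p L a g pa \<longleftrightarrow>
     pa = p - (1 - a) * L \<and> 0 \<le> L \<and> 0 \<le> a \<and> a \<le> 1 \<and> pa \<le> b \<and> T \<le> 3 * b - 3 * p + 3 * L \<and>
     (0 < L \<longrightarrow> T - 3 * (b - pa) = 2 * a * L) \<and> 0 \<le> g \<and> g \<le> c \<and> (0 < g \<longrightarrow> a = 1) \<and>
     (c - g) * (b - pa) = a * L^2 / 2"

text \<open>The total mass outside the no-sale region for pure bundling at price \<open>c1 + c2 + p\<close>.\<close>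

definition excess :: "real \<Rightarrow> real \<Rightarrow> real \<Rightarrow> real \<Rightarrow> real \<Rightarrow> real" where
  "excess c1 c2 b1 b2 p = 3 / 2 * p^2 + (c1 + c2) * p - b1 * b2"

lemma certificate_if_halves:
  assumes h1: "half_certificate c1 (c2 + b2) b2 p L1 a1 g1 pa1" and h2: "half_certificate c2 (c1 + b1) b1 p L2 a2 g2 pa2"
    and "0 \<le> c1" "0 \<le> c2" "0 < b1" "0 < b2" "L1 + L2 \<le> p"
    and zero: "excess c1 c2 b1 b2 p = (p - pa1) * (3 / 2 * L1 + c1) + (p - pa2) * (3 / 2 * L2 + c2)"
  shows "certificate c1 c2 b1 b2 L1 L2 a1 a2 g1 g2 p pa1 pa2"
proof
  \<comment> \<open>Multiplied by \<open>L1\<close>, the slope condition also holds for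
    \<open>L1 = 0\<close>, so one polynomial elimination covers all cases.\<close>
  have s1: "(c2 + b2 - 3 * (b2 - pa1)) * L1 = 2 * a1 * L1^2"
    using h1 by (cases "L1 = 0") (auto simp: half_certificate_def power2_eq_square)
  have s2: "(c1 + b1 - 3 * (b1 - pa2)) * L2 = 2 * a2 * L2^2"
    using h2 by (cases "L2 = 0") (auto simp: half_certificate_def power2_eq_square)
  have e: "2 * ((c1 - g1) * (b2 - pa1)) = a1 * L1^2" "2 * ((c2 - g2) * (b1 - pa2)) = a2 * L2^2"
    and pa: "pa1 = p - (1 - a1) * L1" "pa2 = p - (1 - a2) * L2"
    using h1 h2 by (auto simp: half_certificate_def)
  have z: "3 * p^2 + 2 * (c1 + c2) * p - 2 * b1 * b2 = (p - pa1) * (3 * L1 + 2 * c1) + (p - pa2) * (3 * L2 + 2 * c2)"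
    using zero by (simp add: excess_def field_simps)
  have "2 * ((c2 + b2) * (b1 - L1)) + 2 * ((c1 + b1) * (b2 - L2)) - 6 * (b1 - L1) * (b2 - L2)
       + 3 * (p - L1 - L2)^2 - 2 * (g1 * (b2 - pa1)) - 2 * (g2 * (b1 - pa2)) = 0"
    using s1 s2 e pa z by algebra
  moreover have "2 * ((c2 + b2) * (b1 - L1) + (c1 + b1) * (b2 - L2) - 3 * (b1 - L1) * (b2 - L2)
       + 3 / 2 * (p - L1 - L2)^2 - g1 * (b2 - pa1) - g2 * (b1 - pa2)) =
      2 * ((c2 + b2) * (b1 - L1)) + 2 * ((c1 + b1) * (b2 - L2)) - 6 * (b1 - L1) * (b2 - L2)
       + 3 * (p - L1 - L2)^2 - 2 * (g1 * (b2 - pa1)) - 2 * (g2 * (b1 - pa2))"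
    by (simp add: algebra_simps power2_eq_square)
  ultimately show "(c2 + b2) * (b1 - L1) + (c1 + b1) * (b2 - L2) - 3 * (b1 - L1) * (b2 - L2)
       + 3 / 2 * (p - L1 - L2)^2 - g1 * (b2 - pa1) - g2 * (b1 - pa2) = 0"
    by linarith
qed (use assms in \<open>auto simp: half_certificate_def\<close>)

text \<open>
  The part of the structure belonging to one item \<open>i\<close>, with \<open>c = c\<^sub>i\<close>, \<open>b = b\<^sub>j\<close>, \<open>T = c\<^sub>j + b\<^sub>j\<close>:
  \<open>v = c\<^sub>j - 2 b\<^sub>j + 3 p\<^sub>a\<^sub>i\<close>, and \<open>L\<close> is the width of the region where item \<open>i\<close> is sold with probability
  \<open>a\<^sub>i = v / (2 L)\<close>.  Eliminating \<open>p\<^sub>a\<^sub>i\<close> from \<open>v L = 4 c (b - p\<^sub>a\<^sub>i)\<close> gives the product equation below;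
  together with the first equation it is a quadratic equation for \<open>v\<close> in terms of \<open>p\<close>.
\<close>

definition active :: "real \<Rightarrow> real \<Rightarrow> real \<Rightarrow> real \<Rightarrow> real \<Rightarrow> real \<Rightarrow> bool" where
  "active c T b p v L \<longleftrightarrow>
     p = L + b - T / 3 - v / 6 \<and> v * (3 * L + 4 * c) = 4 * c * T \<and> 0 \<le> v \<and> v \<le> 2 * L"

text \<open>The \<open>p\<close> at which \<open>active\<close> has \<open>v = 2 * L\<close>, that
  is \<open>a = 1\<close>: then \<open>3 * v^2 + 8 * c * v = 8 * c * T\<close> and
  \<open>p = b - T / 3 + v / 3\<close>, with the nonnegative root \<open>v\<close>.\<close>

definition threshold :: "real \<Rightarrow> real \<Rightarrow> real \<Rightarrow> real" where
  "threshold c T b = b - T / 3 - 4 * c / 9 + 2 / 9 * sqrt (2 * c * (2 * c + 3 * T))"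

text \<open>With \<open>y = 3 * L + 4 * c\<close>, the equations of \<open>active\<close> read
  \<open>m = y - v / 2\<close> and \<open>v * y = 4 * c * T\<close>; hence
  \<open>(y + v / 2)^2 = m^2 + 8 * c * T\<close>.\<close>

definition active_v :: "real \<Rightarrow> real \<Rightarrow> real \<Rightarrow> real \<Rightarrow> real" where
  "active_v c T b p = (let m = 3 * p - 3 * b + T + 4 * c in sqrt (m^2 + 8 * c * T) - m)"

definition active_L :: "real \<Rightarrow> real \<Rightarrow> real \<Rightarrow> real \<Rightarrow> real" where
  "active_L c T b p = (let m = 3 * p - 3 * b + T + 4 * c in (sqrt (m^2 + 8 * c * T) + m) / 6 - 4 * c / 3)"

lemma continuous_active_v [continuous_intros]: "continuous_on A (active_v c T b)"
  unfolding active_v_def Let_def by (auto intro!: continuous_intros)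

lemma continuous_active_L [continuous_intros]: "continuous_on A (active_L c T b)"
  unfolding active_L_def Let_def by (auto intro!: continuous_intros)

lemma pa_max_eq_threshold: "pa_max ci cj bi bj = threshold ci (cj + bj) bj"
  by (simp add: pa_max_def threshold_def field_simps)

lemma active_if_threshold_le:
  assumes "0 \<le> c" "0 < T" "threshold c T b \<le> p"
  shows "active c T b p (active_v c T b p) (active_L c T b p)"
proof -
  define m where "m = 3 * p - 3 * b + T + 4 * c"
  define r where "r = sqrt (m^2 + 8 * c * T)"
  define S where "S = sqrt (2 * c * (2 * c + 3 * T))"
  have v: "active_v c T b p = r - m" and L: "active_L c T b p = (r + m) / 6 - 4 * c / 3"
    by (simp_all add: active_v_def active_L_def Let_def m_def r_def)
  have r2: "r^2 = m^2 + 8 * c * T" using assms by (simp add: r_def)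
  have S2: "S^2 = 2 * c * (2 * c + 3 * T)" using assms by (simp add: S_def)
  have S: "0 \<le> S" using assms by (simp add: S_def)
  have p: "p = (r + m) / 6 - 4 * c / 3 + b - T / 3 - (r - m) / 6" by (simp add: m_def field_simps)
  have "r \<ge> m" unfolding r_def using assms by (intro real_le_rsqrt) simp
  have m_ge: "3 * m \<ge> 8 * c + 2 * S"
    using assms(3) unfolding threshold_def S_def[symmetric] m_def by (simp add: field_simps)
  have S_ge: "2 * c \<le> S" unfolding S_def using assms by (intro real_le_rsqrt) (simp add: algebra_simps power2_eq_square)
  \<comment> \<open>The remaining requirement \<open>v <= 2 * L\<close> amounts to
    \<open>r <= 2 * m - 4 * c\<close>.\<close>
  have "m^2 + 8 * c * T \<le> (2 * m - 4 * c)^2"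
  proof -
    have "(2 * S)^2 \<le> (3 * m - 8 * c)^2" using m_ge S by (intro power_mono) auto
    then show ?thesis using S2 by (simp add: power2_eq_square algebra_simps)
  qed
  then have "r \<le> 2 * m - 4 * c"
    unfolding r_def using m_ge S_ge S assms(1) by (intro real_le_lsqrt) auto
  then have "r - m \<le> 2 * ((r + m) / 6 - 4 * c / 3)"
    by (simp add: field_simps)
  moreover have "(r - m) * (3 * ((r + m) / 6 - 4 * c / 3) + 4 * c) = 4 * c * T"
    using r2 by (simp add: field_simps power2_eq_square)
  ultimately show ?thesis
    unfolding active_def v L using \<open>r \<ge> m\<close> p by (intro conjI) linarith+
qed

lemma active_unique:
  assumes "0 \<le> c" and act: "active c T b p v L"
  shows "v = active_v c T b p" "L = active_L c T b p"
proof -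
  define m where "m = 3 * p - 3 * b + T + 4 * c"
  define y where "y = 3 * L + 4 * c"
  have m: "m = y - v / 2" using act by (simp add: active_def m_def y_def field_simps)
  have y: "0 \<le> y" "v * y = 4 * c * T" "0 \<le> v" using act assms by (auto simp: active_def y_def)
  have "m^2 + 8 * c * T = (y + v / 2)^2"
    using y(2) unfolding m by (simp add: power2_eq_square field_simps)
  then have "sqrt (m^2 + 8 * c * T) = y + v / 2" using y by simp
  then show "v = active_v c T b p" "L = active_L c T b p"
    unfolding active_v_def active_L_def Let_def m_def[symmetric] by (simp_all add: m y_def field_simps)
qed

lemma active_le:
  assumes "0 \<le> c" "0 < T" "active c T b p v L"
  shows "v \<le> T" "0 \<le> L"
proof -
  have a: "v * (3 * L + 4 * c) = 4 * c * T" "0 \<le> v" "v \<le> 2 * L" using assms by (auto simp: active_def)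
  then show "0 \<le> L" by simp
  then have "0 \<le> v * (3 * L)" using a by simp
  then have "4 * c * v \<le> 4 * c * T" using a(1) by (simp add: algebra_simps)
  then show "v \<le> T"
    using assms a by (cases "c = 0") auto
qed

lemma threshold_le_if_active:
  assumes "0 \<le> c" "0 < T" "active c T b p v L"
  shows "threshold c T b \<le> p"
proof -
  have a: "p = L + b - T / 3 - v / 6" "v * (3 * L + 4 * c) = 4 * c * T" "0 \<le> v" "v \<le> 2 * L"
    using assms by (auto simp: active_def)
  define S where "S = sqrt (2 * c * (2 * c + 3 * T))"
  \<comment> \<open>Chosen so that the claim reads \<open>S <= x\<close>.\<close>
  define x where "x = (9 * L - 3 / 2 * v + 4 * c) / 2"
  have x0: "0 \<le> x" using a assms by (simp add: x_def)
  have "2 * c * (2 * c + 3 * T) \<le> x^2"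
  proof -
    have "4 * (x^2 - 2 * c * (2 * c + 3 * T)) = (9 * L - 3 / 2 * v)^2 + 8 * c * (9 * L - 3 / 2 * v) - 24 * c * T"
      by (simp add: x_def power2_eq_square field_simps)
    also have "\<dots> = (9 * L - 3 / 2 * v)^2 + 8 * c * (9 * L - 3 / 2 * v) - 6 * (v * (3 * L + 4 * c))"
      using a(2) by simp
    also have "\<dots> = 9 / 4 * (2 * L - v) * (18 * L - v) + 36 * c * (2 * L - v)"
      by (simp add: power2_eq_square field_simps)
    also have "\<dots> \<ge> 0" using a assms by (intro add_nonneg_nonneg mult_nonneg_nonneg) auto
    finally show ?thesis by simp
  qed
  then have "S \<le> x" unfolding S_def using x0 by (intro real_le_lsqrt) auto
  then show ?thesis
    unfolding threshold_def S_def[symmetric] using a(1) by (simp add: x_def field_simps)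
qed

lemma half_certificate_if_active:
  assumes "0 \<le> c" "0 < T" and act: "active c T b p v L"
  shows "half_certificate c T b p L (v / (2 * L)) 0 (p - L + v / 2)"
proof -
  have a: "p = L + b - T / 3 - v / 6" "v * (3 * L + 4 * c) = 4 * c * T" "0 \<le> v" "v \<le> 2 * L"
    using act by (auto simp: active_def)
  \<comment> \<open>If \<open>L = 0\<close>, then \<open>v = 0\<close> as well and the quotient is
    0.\<close>
  have aL: "v / (2 * L) * L = v / 2" using a by (cases "L = 0") auto
  have edge: "c * (b - (p - L + v / 2)) = v / (2 * L) * L^2 / 2"
  proof -
    have "v / (2 * L) * L^2 / 2 = (v / (2 * L) * L) * L / 2" by (simp only: power2_eq_square mult.assoc)
    also have "\<dots> = v * L / 4" unfolding aL by simp
    finally have "v / (2 * L) * L^2 / 2 = v * L / 4" .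
    moreover have "b - (p - L + v / 2) = (T - v) / 3" using a(1) by (simp add: field_simps)
    moreover have "c * ((T - v) / 3) = v * L / 4" using a(2) by (simp add: field_simps)
    ultimately show ?thesis by (simp only:)
  qed
  have "p - L + v / 2 = p - (1 - v / (2 * L)) * L" using aL by (simp only: left_diff_distrib)
  moreover have "v / (2 * L) \<le> 1" using a by (cases "L = 0") (auto simp: divide_le_eq)
  ultimately show ?thesis
    unfolding half_certificate_def
  proof (intro conjI impI)
    show "0 \<le> L" "0 \<le> v / (2 * L)" using active_le[OF assms] a by auto
    show "p - L + v / 2 \<le> b" using active_le[OF assms] a by simp
    show "T \<le> 3 * b - 3 * p + 3 * L" using a by simp
    show "T - 3 * (b - (p - L + v / 2)) = 2 * (v / (2 * L)) * L" if "0 < L"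
      using that a(1) by simp
    show "(c - 0) * (b - (p - L + v / 2)) = v / (2 * L) * L^2 / 2" using edge by (simp only: diff_zero)
  qed (use assms(1) in simp_all)
qed

text \<open>With \<open>a = 1\<close> the slope condition gives \<open>L = w / 2\<close>. The top
  edge then absorbs only \<open>L^2 / 2\<close> of the mass \<open>c * (b - p)\<close> of the left
  edge; that this is not too much is what \<open>p <= threshold c T b\<close> says, and
  \<open>g\<close> is the surplus density.\<close>

lemma half_certificate_if_le_threshold:
  assumes "0 \<le> c" "0 < T" "p \<le> threshold c T b"
  defines "w \<equiv> T - 3 * (b - p)"
  obtains g where "half_certificate c T b p (max 0 (w / 2)) 1 g p" "w < T" "0 < w \<Longrightarrow> 3 * w^2 + 8 * c * w \<le> 8 * c * T"
proof -
  define S where "S = sqrt (2 * c * (2 * c + 3 * T))"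
  have S: "S^2 = 2 * c * (2 * c + 3 * T)" "0 \<le> S" using assms by (simp_all add: S_def)
  have "3 * w + 4 * c \<le> 2 * S"
    using assms(3) unfolding threshold_def S_def[symmetric] w_def by (simp add: field_simps)
  then have q: "3 * w^2 + 8 * c * w \<le> 8 * c * T" if "0 < w"
  proof -
    have "(3 * w + 4 * c)^2 \<le> (2 * S)^2"
      using \<open>3 * w + 4 * c \<le> 2 * S\<close> that assms by (intro power_mono) auto
    then show ?thesis using S by (simp add: power2_eq_square algebra_simps)
  qed
  have wT: "w < T"
  proof (rule ccontr)
    assume "\<not> w < T"
    then have w: "T \<le> w" "0 < w" using assms by auto
    then have "8 * c * T \<le> 8 * c * w" using assms by (intro mult_left_mono) auto
    moreover have "0 < w^2" using w by simp
    ultimately show False using q[OF w(2)] by linarith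
  qed
  have bp: "b - p = (T - w) / 3" by (simp add: w_def)
  define L where "L = max 0 (w / 2)"
  define g where "g = c - L^2 / (2 * (b - p))"
  have "L^2 / 2 \<le> c * (b - p)"
  proof (cases "0 < w")
    case True
    then show ?thesis using q unfolding bp by (simp add: L_def power2_eq_square field_simps)
  next
    case False
    then show ?thesis using wT assms unfolding bp by (simp add: L_def)
  qed
  moreover have "0 < b - p" using wT bp by simp
  ultimately have "0 \<le> g" "g \<le> c" "(c - g) * (b - p) = L^2 / 2"
    by (simp_all add: g_def field_simps)
  moreover have "0 \<le> L" by (simp add: L_def)
  moreover have "T \<le> 3 * b - 3 * p + 3 * L"
  proof -
    have "w / 2 \<le> L" "0 \<le> L" "3 * b - 3 * p = T - w" by (simp_all add: L_def w_def)
    then show ?thesis by linarith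
  qed
  moreover have "0 < L \<longrightarrow> T - 3 * (b - p) = 2 * 1 * L"
    unfolding w_def[symmetric] by (auto simp: L_def)
  ultimately have "half_certificate c T b p L 1 g p"
    unfolding half_certificate_def using \<open>0 < b - p\<close> by (intro conjI) simp_all
  then show ?thesis using wT q unfolding L_def by (rule that)
qed

section \<open>Existence of certificates\<close>

text \<open>
  Selling \<open>(a, 1)\<close> next to a side of length \<open>L\<close> cuts a triangle and a boundary segment off the no-sale
  region; the total mass outside decreases by this amount.
\<close>

definition reduction :: "real \<Rightarrow> real \<Rightarrow> real \<Rightarrow> real" where
  "reduction c v L = (L - v / 2) * (3 / 2 * L + c)"

lemma reduction_nonneg: "\<lbrakk>0 \<le> c; active c T b p v L\<rbrakk> \<Longrightarrow> 0 \<le> reduction c v L"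
  by (auto simp: active_def reduction_def)

text \<open>The balance in terms of the height \<open>p - L\<close> of the junction and its distance
  \<open>b1 - L\<close> to the right edge, from which signs can be read off.\<close>

lemma excess_identity_one:
  assumes "active c1 (c2 + b2) b2 p v L"
  shows "6 * (excess c1 c2 b1 b2 p - reduction c1 v L) =
    (p - L) * (6 * c2 + 9 * (p - L)) - 6 * b2 * (2 * (b1 - L) - (c1 + b1))"
proof -
  have "v = 6 * L + 4 * b2 - 2 * c2 - 6 * p" "v * (3 * L + 4 * c1) = 4 * c1 * (c2 + b2)"
    using assms by (auto simp: active_def field_simps)
  then have "18 * p^2 + 12 * (c1 + c2) * p - 12 * b1 * b2 - 3 * ((2 * L - v) * (3 * L + 2 * c1)) =
      2 * ((p - L) * (6 * c2 + 9 * (p - L)) - 6 * b2 * (2 * (b1 - L) - (c1 + b1)))"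
    by algebra
  moreover have "12 * (excess c1 c2 b1 b2 p - reduction c1 v L) =
      18 * p^2 + 12 * (c1 + c2) * p - 12 * b1 * b2 - 3 * ((2 * L - v) * (3 * L + 2 * c1))"
    by (simp add: excess_def reduction_def field_simps)
  ultimately show ?thesis by simp
qed

text \<open>The balance in terms of \<open>p - L1 - L2\<close>, the horizontal extent of the
  boundary between no sale and \<open>(1, 1)\<close>.\<close>

lemma excess_identity_two:
  assumes "active c1 (c2 + b2) b2 p v1 L1" "active c2 (c1 + b1) b1 p v2 L2"
  shows "12 * (excess c1 c2 b1 b2 p - reduction c1 v1 L1 - reduction c2 v2 L2) =
    4 * (c2 + b2) * (c1 + b1) - v1 * v2 - 6 * (p - L1 - L2) * (3 * (p - L1 - L2) + v1 + v2)"
proof -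
  have "v1 = 6 * L1 + 4 * b2 - 2 * c2 - 6 * p" "v1 * (3 * L1 + 4 * c1) = 4 * c1 * (c2 + b2)"
    "v2 = 6 * L2 + 4 * b1 - 2 * c1 - 6 * p" "v2 * (3 * L2 + 4 * c2) = 4 * c2 * (c1 + b1)"
    using assms by (auto simp: active_def field_simps)
  then have "18 * p^2 + 12 * (c1 + c2) * p - 12 * b1 * b2 - 3 * ((2 * L1 - v1) * (3 * L1 + 2 * c1))
      - 3 * ((2 * L2 - v2) * (3 * L2 + 2 * c2)) =
    4 * (c2 + b2) * (c1 + b1) - v1 * v2 - 6 * (p - L1 - L2) * (3 * (p - L1 - L2) + v1 + v2)"
    by algebra
  moreover have "12 * (excess c1 c2 b1 b2 p - reduction c1 v1 L1 - reduction c2 v2 L2) =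
      18 * p^2 + 12 * (c1 + c2) * p - 12 * b1 * b2 - 3 * ((2 * L1 - v1) * (3 * L1 + 2 * c1))
      - 3 * ((2 * L2 - v2) * (3 * L2 + 2 * c2))"
    by (simp add: excess_def reduction_def field_simps)
  ultimately show ?thesis by simp
qed

text \<open>By \<open>pa_min_le_iff\<close> the left side is nonnegative exactly if
  \<open>pa\<close> respects its lower bound. The first form serves structure (b), the second
  structure (a).\<close>

lemma lower_bound_identity:
  assumes "active c1 (c2 + b2) b2 p v L"
  shows "v * (2 * b1 + 3 * c1) - c1 * (4 * b2 + 6 * c2) =
      v * (4 * (b1 - L) - 2 * (c1 + b1)) + 2 * (p - L) * c1"
    and "v * (2 * b1 + 3 * c1) - c1 * (4 * b2 + 6 * c2) = v * (3 * (b1 - L) - (c1 + b1)) - 2 * c1 * c2"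
proof -
  have "v = 6 * L + 4 * b2 - 2 * c2 - 6 * p" "v * (3 * L + 4 * c1) = 4 * c1 * (c2 + b2)"
    using assms by (auto simp: active_def field_simps)
  then have "3 * (v * (2 * b1 + 3 * c1) - c1 * (4 * b2 + 6 * c2)) =
      3 * (v * (4 * (b1 - L) - 2 * (c1 + b1)) + 2 * (p - L) * c1)"
    "v * (2 * b1 + 3 * c1) - c1 * (4 * b2 + 6 * c2) = v * (3 * (b1 - L) - (c1 + b1)) - 2 * c1 * c2"
    by algebra+
  then show "v * (2 * b1 + 3 * c1) - c1 * (4 * b2 + 6 * c2) =
      v * (4 * (b1 - L) - 2 * (c1 + b1)) + 2 * (p - L) * c1"
    "v * (2 * b1 + 3 * c1) - c1 * (4 * b2 + 6 * c2) = v * (3 * (b1 - L) - (c1 + b1)) - 2 * c1 * c2"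
    by simp_all
qed

text \<open>An equivalent form of the hypothesis of the theorem, with denominators cleared, whose
  conditions are permuted when the items are swapped.\<close>

locale market =
  fixes c1 c2 b1 b2 :: real
  assumes c_nonneg: "0 \<le> c1" "0 \<le> c2" and b_pos: "0 < b1" "0 < b2"
    and cond1: "c2 \<le> b2 \<or> c2 * (b1 + 3 * c1) \<le> 2 * b2 * (b1 + c1)"
    and cond2: "c1 \<le> b1 \<or> c1 * (b2 + 3 * c2) \<le> 2 * b1 * (b2 + c2)"
    and cond: "c1 \<le> b1 \<or> c2 \<le> b2"

lemma market_swap: "market c1 c2 b1 b2 \<Longrightarrow> market c2 c1 b2 b1"
  unfolding market_def by blast

section \<open>Order of the junctions\<close>

context market
begin

abbreviation "T \<equiv> c2 + b2"
abbreviation "R \<equiv> c1 + b1"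

lemma TR_pos: "0 < T" "0 < R" using c_nonneg b_pos by auto

lemma c2_le: "c2 \<le> 2 * b2"
proof (cases "c2 \<le> b2")
  case False
  then have le: "c2 * (b1 + 3 * c1) \<le> 2 * b2 * (b1 + c1)" using cond1 by blast
  also have "\<dots> \<le> 2 * b2 * (b1 + 3 * c1)" using c_nonneg b_pos by (intro mult_left_mono) auto
  finally show ?thesis using c_nonneg b_pos by simp
qed (use b_pos in simp)

text \<open>A junction below the bottom edge forces \<open>v > 2 * (2 * b2 - c2)\<close>, so
  \<open>c2 > b2\<close> by \<open>v <= T\<close>; the second alternative of \<open>cond1\<close>
  then limits \<open>L\<close>.\<close>

lemma cut_near_left:
  assumes act: "active c1 T b2 p v L" and neg: "p < L"
  shows "R \<le> 2 * (b1 - L)"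
proof -
  define m where "m = 2 * b2 - c2"
  have a: "p = L + b2 - T / 3 - v / 6" "v * (3 * L + 4 * c1) = 4 * c1 * T" "0 \<le> v" "v \<le> 2 * L"
    using act by (auto simp: active_def)
  have vT: "v \<le> T" and L: "0 \<le> L" using active_le[OF c_nonneg(1) TR_pos(1) act] by auto
  have vm: "2 * m < v" using a(1) neg by (simp add: m_def field_simps)
  then have "b2 < c2" using vT by (simp add: m_def)
  then have "c2 * (b1 + 3 * c1) \<le> 2 * b2 * (b1 + c1)" using cond1 by auto
  then have q: "c1 * (3 * c2 - 2 * b2) \<le> b1 * m" by (simp add: m_def algebra_simps)
  have m0: "0 \<le> m" using c2_le by (simp add: m_def)
  have "m \<noteq> 0"
  proof
    assume "m = 0"
    then have "c1 * (3 * c2 - 2 * b2) \<le> 0" "0 < 3 * c2 - 2 * b2" using q \<open>b2 < c2\<close> b_pos by auto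
    then have "c1 = 0" using c_nonneg by (smt (verit) mult_pos_pos)
    then show False using a vm m0 by auto
  qed
  then have "0 < m" using m0 by simp
  have "2 * m * (3 * L + 4 * c1) \<le> v * (3 * L + 4 * c1)"
    using vm L c_nonneg by (intro mult_right_mono) auto
  then have "2 * L * m \<le> 4 * c1 * (c2 - b2)" using a(2) by (simp add: m_def algebra_simps)
  also have "\<dots> \<le> (b1 - c1) * m" using q by (simp add: m_def algebra_simps)
  finally have "2 * L \<le> b1 - c1" using \<open>0 < m\<close> by simp
  then show ?thesis by simp
qed

text \<open>For \<open>p >= L\<close> this is read off from the signs in
  \<open>excess_identity_one\<close>; otherwise \<open>cut_near_left\<close> applies.\<close>

lemma cut_bound:
  assumes act: "active c1 T b2 p v L" and le: "excess c1 c2 b1 b2 p \<le> reduction c1 v L"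
  shows "R \<le> 2 * (b1 - L)"
proof (cases "p < L")
  case False
  have "0 \<le> (p - L) * (6 * c2 + 9 * (p - L))" using False c_nonneg by (intro mult_nonneg_nonneg) auto
  then have "0 \<le> 6 * b2 * (2 * (b1 - L) - R)" using excess_identity_one[OF act, of b1] le by simp
  then have "0 \<le> 2 * (b1 - L) - R" using b_pos by (simp add: zero_le_mult_iff)
  then show ?thesis by simp
qed (use cut_near_left[OF act] in simp)

lemma junction_le_if_zero:
  assumes act: "active c1 T b2 p v L" and zero: "excess c1 c2 b1 b2 p = reduction c1 v L"
  shows "L \<le> p"
proof (rule ccontr)
  assume "\<not> L \<le> p"
  then have neg: "p < L" by simp
  have "p = L + b2 - T / 3 - v / 6" "v \<le> T"
    using act active_le[OF c_nonneg(1) TR_pos(1) act] by (auto simp: active_def)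
  then have "0 < 6 * c2 + 9 * (p - L)" using c_nonneg b_pos by (simp add: field_simps)
  then have "(p - L) * (6 * c2 + 9 * (p - L)) < 0" using neg by (simp add: mult_neg_pos)
  moreover have "0 \<le> 6 * b2 * (2 * (b1 - L) - R)" using cut_near_left[OF act neg] b_pos by simp
  ultimately show False using excess_identity_one[OF act, of b1] zero by simp
qed

text \<open>If the junctions crossed, the last product in \<open>excess_identity_two\<close> would
  be negative; since \<open>v1 * v2 <= T * R\<close>, the mass left after both reductions would be
  positive.\<close>

lemma junctions_ordered:
  assumes act1: "active c1 T b2 p v1 L1" and act2: "active c2 R b1 p v2 L2"
    and le: "excess c1 c2 b1 b2 p \<le> reduction c1 v1 L1"
  shows "L1 + L2 \<le> p"
proof (rule ccontr)
  assume "\<not> L1 + L2 \<le> p"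
  then have neg: "p - L1 - L2 < 0" by simp
  have v: "0 \<le> v1" "v1 \<le> T" "0 \<le> v2" "v2 \<le> R"
    using active_le[OF c_nonneg(1) TR_pos(1) act1] active_le[OF c_nonneg(2) TR_pos(2) act2] act1 act2
    by (auto simp: active_def)
  have "p = L2 + b1 - R / 3 - v2 / 6" using act2 by (auto simp: active_def)
  then have "0 < 3 * (p - L1 - L2) + v1 + v2"
    using cut_bound[OF act1 le] v TR_pos by (simp add: field_simps)
  then have "(p - L1 - L2) * (3 * (p - L1 - L2) + v1 + v2) < 0"
    using neg by (intro mult_neg_pos) auto
  moreover have "v1 * v2 \<le> T * R" using v by (intro mult_mono) auto
  moreover have "0 < T * R" using TR_pos by simp
  moreover have "0 \<le> reduction c2 v2 L2" by (rule reduction_nonneg[OF c_nonneg(2) act2])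
  moreover have "12 * (excess c1 c2 b1 b2 p - reduction c1 v1 L1 - reduction c2 v2 L2) =
      4 * (T * R) - v1 * v2 - 6 * ((p - L1 - L2) * (3 * (p - L1 - L2) + v1 + v2))"
    using excess_identity_two[OF act1 act2] by (simp only: mult.assoc)
  ultimately have "0 < 12 * (excess c1 c2 b1 b2 p - reduction c1 v1 L1 - reduction c2 v2 L2)"
    "0 \<le> reduction c2 v2 L2" by simp_all
  then show False using le by simp
qed

text \<open>Serves twice: started at the second threshold it produces structure (a), and started at
  a root of the equation in (b) beyond that threshold it shows that (a) is solvable.\<close>

lemma climb:
  assumes th: "threshold c1 T b2 \<le> p0" "threshold c2 R b1 \<le> p0"
    and act0: "active c1 T b2 p0 v1 L1" "active c2 R b1 p0 v2 L2"
    and le: "excess c1 c2 b1 b2 p0 \<le> reduction c1 v1 L1 + reduction c2 v2 L2" and k: "L1 + L2 \<le> p0"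
  obtains p v1 L1 v2 L2 where "p0 \<le> p" "active c1 T b2 p v1 L1" "active c2 R b1 p v2 L2"
    "L1 + L2 \<le> p" "excess c1 c2 b1 b2 p = reduction c1 v1 L1 + reduction c2 v2 L2"
proof -
  define w1 l1 w2 l2 where "w1 = active_v c1 T b2" and "l1 = active_L c1 T b2"
    and "w2 = active_v c2 R b1" and "l2 = active_L c2 R b1"
  have act: "active c1 T b2 p (w1 p) (l1 p)" "active c2 R b1 p (w2 p) (l2 p)" if "p0 \<le> p" for p
    using active_if_threshold_le[OF c_nonneg(1) TR_pos(1)] active_if_threshold_le[OF c_nonneg(2) TR_pos(2)]
      th that unfolding w1_def l1_def w2_def l2_def by auto
  have eq0: "w1 p0 = v1" "l1 p0 = L1" "w2 p0 = v2" "l2 p0 = L2"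
    using active_unique[OF c_nonneg(1) act0(1)] active_unique[OF c_nonneg(2) act0(2)]
    by (simp_all add: w1_def l1_def w2_def l2_def)
  define f where "f p = excess c1 c2 b1 b2 p - reduction c1 (w1 p) (l1 p) - reduction c2 (w2 p) (l2 p)" for p
  \<comment> \<open>a zero of the maximum is a zero of \<open>f\<close>, because \<open>f\<close> is positive where \<open>l1 + l2 = p\<close>\<close>
  define h where "h p = max (f p) (l1 p + l2 p - p)" for p
  \<comment> \<open>Large enough that the junctions have met: \<open>l1 P >= P - b2\<close> and
    \<open>l2 P >= P - b1\<close>.\<close>
  define P where "P = max p0 (2 * b2 + 2 * b1)"
  have "continuous_on {p0..P} h"
    unfolding h_def f_def excess_def reduction_def w1_def l1_def w2_def l2_def
    by (auto intro!: continuous_intros)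
  moreover have "h p0 \<le> 0" using le k by (simp add: h_def f_def eq0)
  moreover have "0 \<le> h P"
  proof -
    have "P = l1 P + b2 - T / 3 - w1 P / 6" "0 \<le> w1 P" "P = l2 P + b1 - R / 3 - w2 P / 6" "0 \<le> w2 P"
      using act[of P] by (auto simp: active_def P_def)
    then have "6 * l1 P = 6 * P - 6 * b2 + 2 * T + w1 P" "6 * l2 P = 6 * P - 6 * b1 + 2 * R + w2 P"
      "0 \<le> w1 P" "0 \<le> w2 P"
      by (simp_all add: field_simps)
    then have "6 * (P - b2) \<le> 6 * l1 P" "6 * (P - b1) \<le> 6 * l2 P" using TR_pos by simp_all
    moreover have "2 * b2 + 2 * b1 \<le> P" by (simp add: P_def)
    ultimately have "0 \<le> l1 P + l2 P - P" using b_pos by simp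
    then show ?thesis by (simp add: h_def)
  qed
  moreover have "p0 \<le> P" by (simp add: P_def)
  ultimately obtain p where p: "p0 \<le> p" "h p = 0" using IVT'[of h p0 0 P] by auto
  note a = act[OF p(1)]
  have v: "0 \<le> w1 p" "w1 p \<le> T" "0 \<le> w2 p" "w2 p \<le> R"
    using active_le[OF c_nonneg(1) TR_pos(1) a(1)] active_le[OF c_nonneg(2) TR_pos(2) a(2)] a
    by (auto simp: active_def)
  have "f p \<le> 0" "l1 p + l2 p \<le> p" using p(2) by (auto simp: h_def)
  moreover have "l1 p + l2 p \<noteq> p"
  proof
    assume "l1 p + l2 p = p"
    then have "p - l1 p - l2 p = 0" by simp
    then have "12 * f p = 4 * T * R - w1 p * w2 p"
      using excess_identity_two[OF a] by (simp add: f_def)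
    moreover have "w1 p * w2 p \<le> T * R" using v by (intro mult_mono) auto
    moreover have "0 < T * R" using TR_pos by simp
    ultimately show False using \<open>f p \<le> 0\<close> by (simp add: algebra_simps)
  qed
  ultimately have "f p = 0" using p(2) by (auto simp: h_def max_def split: if_splits)
  then show ?thesis using that[OF p(1) a \<open>l1 p + l2 p \<le> p\<close>] by (simp add: f_def)
qed

lemma certificate_two:
  assumes act1: "active c1 T b2 p v1 L1" and act2: "active c2 R b1 p v2 L2" and "L1 + L2 \<le> p"
    and zero: "excess c1 c2 b1 b2 p = reduction c1 v1 L1 + reduction c2 v2 L2"
  shows "certificate c1 c2 b1 b2 L1 L2 (v1 / (2 * L1)) (v2 / (2 * L2)) 0 0 p
    (p - L1 + v1 / 2) (p - L2 + v2 / 2)"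
  by (rule certificate_if_halves[OF half_certificate_if_active[OF c_nonneg(1) TR_pos(1) act1]
      half_certificate_if_active[OF c_nonneg(2) TR_pos(2) act2]])
    (use assms c_nonneg b_pos in \<open>simp_all add: reduction_def\<close>)

lemma certificate_one:
  assumes act: "active c1 T b2 p v L" and th: "p \<le> threshold c2 R b1" and "L \<le> p"
    and zero: "excess c1 c2 b1 b2 p = reduction c1 v L"
  obtains L2 g2 where "certificate c1 c2 b1 b2 L L2 (v / (2 * L)) 1 0 g2 p (p - L + v / 2) p"
proof -
  define w where "w = R - 3 * (b1 - p)"
  obtain g where g: "half_certificate c2 R b1 p (max 0 (w / 2)) 1 g p"
    using half_certificate_if_le_threshold[OF c_nonneg(2) TR_pos(2) th] unfolding w_def by blast
  have "L + max 0 (w / 2) \<le> p"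
  proof -
    \<comment> \<open>The goal is \<open>w / 2 <= k\<close>. The balance gives
      \<open>4 * k <= 6 * (2 * X - R)\<close>, and \<open>w = R - 3 * X + 3 * k\<close>.\<close>
    define k where "k = p - L"
    define X where "X = b1 - L"
    have k0: "0 \<le> k" using assms(3) by (simp add: k_def)
    have a: "p = L + b2 - T / 3 - v / 6" "0 \<le> v" "v \<le> T"
      using act active_le[OF c_nonneg(1) TR_pos(1) act] by (auto simp: active_def)
    have kv: "6 * b2 = 2 * T + v + 6 * k" "6 * c2 + 9 * k = 4 * T - v + 3 * k"
      using a by (simp_all add: k_def field_simps)
    have "6 * b2 * (2 * X - R) = k * (6 * c2 + 9 * k)"
      using excess_identity_one[OF act, of b1] zero by (simp add: k_def X_def)
    moreover have "k * (4 * b2) \<le> k * (6 * c2 + 9 * k)"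
    proof (rule mult_left_mono[OF _ k0])
      have "b2 \<le> T" using c_nonneg by simp
      moreover have "k \<le> b2" using a TR_pos by (simp add: k_def field_simps)
      ultimately show "4 * b2 \<le> 6 * c2 + 9 * k" using kv a(3) by simp
    qed
    ultimately have "b2 * (4 * k) \<le> b2 * (6 * (2 * X - R))" by (simp add: algebra_simps)
    then have "4 * k \<le> 6 * (2 * X - R)" using b_pos by simp
    moreover have "w = R - 3 * X + 3 * k" by (simp add: w_def X_def k_def)
    ultimately have "w / 2 \<le> k" using TR_pos by simp
    then show ?thesis using k0 by (simp add: k_def)
  qed
  then have "certificate c1 c2 b1 b2 L (max 0 (w / 2)) (v / (2 * L)) 1 0 g p (p - L + v / 2) p"
    by (intro certificate_if_halves[OF half_certificate_if_active[OF c_nonneg(1) TR_pos(1) act] g])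
      (use zero c_nonneg b_pos in \<open>simp_all add: reduction_def\<close>)
  then show ?thesis by (rule that)
qed

text \<open>The conclusion is equivalent to \<open>w / 2 <= p\<close>: the junction does not fall
  below the bottom edge. Its failure would imply \<open>c2 > b2\<close>, and \<open>cond1\<close>,
  the balance and the threshold bound on \<open>w\<close> would be incompatible.\<close>

lemma bundle_junction_le:
  assumes p: "0 < p" and zero: "excess c1 c2 b1 b2 p = 0"
    and w: "w = T - 3 * (b2 - p)" "w < T" "0 < w \<Longrightarrow> 3 * w^2 + 8 * c1 * w \<le> 8 * c1 * T"
  shows "p \<le> 2 * b2 - c2"
proof (rule ccontr)
  define m where "m = 2 * b2 - c2"
  assume "\<not> p \<le> 2 * b2 - c2"
  then have pm: "m < p" by (simp add: m_def)
  have m0: "0 \<le> m" using c2_le by (simp add: m_def)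
  have w3: "w = 3 * p - m" by (simp add: w m_def)
  then have w0: "0 < w" using pm m0 by simp
  have "p < b2" using w by simp
  then have "b2 < c2" using pm by (simp add: m_def)
  then have "c2 * (b1 + 3 * c1) \<le> 2 * b2 * (b1 + c1)" using cond1 by auto
  then have q: "c1 * (4 * b2 - 3 * m) \<le> b1 * m" by (simp add: m_def algebra_simps)
  define h where "h = p - m"
  have h: "0 < h" using pm by (simp add: h_def)
  have mb: "m + h < b2" using \<open>p < b2\<close> by (simp add: h_def)
  have pas: "w^2 \<le> 8 * c1 * (b2 - p)"
    using w(3)[OF w0] unfolding w(1) by (simp add: power2_eq_square algebra_simps)
  have ex: "2 * (b1 * b2) = 3 * p^2 + 2 * c1 * p + 2 * (2 * b2 - m) * p"
    using zero by (simp add: excess_def m_def field_simps power2_eq_square)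
  \<comment> \<open>\<open>A - m * h\<close> is the factor of \<open>2 * c1\<close> once
    \<open>b1 * b2\<close> is eliminated by \<open>ex\<close>; afterwards \<open>pas\<close>
    eliminates \<open>c1\<close>.\<close>
  define A where "A = 4 * b2^2 - 3 * m * b2 - m^2"
  have A: "A = (4 * b2 + m) * (b2 - m)" by (simp add: A_def power2_eq_square algebra_simps)
  then have A0: "0 < A" using mb m0 h b_pos by (simp add: add_pos_nonneg)
  have "2 * b2 * (c1 * (4 * b2 - 3 * m)) \<le> m * (2 * (b1 * b2))"
    using mult_left_mono[OF q, of "2 * b2"] b_pos by (simp add: algebra_simps)
  then have "2 * c1 * (b2 * (4 * b2 - 3 * m) - m * p) \<le> m * (3 * p^2 + 2 * (2 * b2 - m) * p)"
    unfolding ex by (simp add: algebra_simps)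
  then have q2: "2 * c1 * (A - m * h) \<le> m * (3 * p^2 + 2 * (2 * b2 - m) * p)"
    by (simp add: A_def h_def power2_eq_square algebra_simps)
  have "m * h \<le> (4 * b2 + m) * (b2 - m)"
    using mb m0 h b_pos by (intro mult_mono) auto
  then have Amh: "0 \<le> A - m * h" using A by simp
  have "w^2 * (A - m * h) \<le> 8 * c1 * (b2 - p) * (A - m * h)"
    by (rule mult_right_mono[OF pas Amh])
  also have "\<dots> = 4 * (b2 - p) * (2 * c1 * (A - m * h))" by (simp add: algebra_simps)
  also have "\<dots> \<le> 4 * (b2 - p) * (m * (3 * p^2 + 2 * (2 * b2 - m) * p))"
    using \<open>p < b2\<close> by (intro mult_left_mono[OF q2]) simp
  finally have "w^2 * (A - m * h) - 4 * (b2 - p) * (m * (3 * p^2 + 2 * (2 * b2 - m) * p)) \<le> 0"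
    by simp
  \<comment> \<open>In powers of \<open>h\<close> all coefficients are nonnegative and that of
    \<open>h^2\<close> is positive.\<close>
  moreover have "w^2 * (A - m * h) - 4 * (b2 - p) * (m * (3 * p^2 + 2 * (2 * b2 - m) * p)) =
      h * (8 * m * A + 4 * m^2 * b2 + 12 * m^3) + h^2 * (9 * A + 4 * m * b2 + 16 * m^2) + 3 * m * h^3"
    unfolding w3 A_def h_def by (simp add: power2_eq_square power3_eq_cube algebra_simps)
  moreover have "0 \<le> h * (8 * m * A + 4 * m^2 * b2 + 12 * m^3)" "0 \<le> 3 * m * h^3"
    using h m0 A0 b_pos by simp_all
  moreover have "0 < h^2 * (9 * A + 4 * m * b2 + 16 * m^2)"
    using h m0 A0 b_pos by (intro mult_pos_pos add_pos_nonneg) auto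
  ultimately show False by linarith
qed

end

section \<open>The equations of the theorem as mass balances\<close>

lemma excess_swap: "excess c2 c1 b2 b1 p = excess c1 c2 b1 b2 p"
  by (simp add: excess_def algebra_simps)

lemma solves_a_swap: "solves_a c1 c2 b1 b2 pa1 pa2 \<Longrightarrow> solves_a c2 c1 b2 b1 pa2 pa1"
  unfolding solves_a_def by (auto simp: algebra_simps)

lemma p_bundle_swap: "p_bundle c2 c1 b2 b1 = p_bundle c1 c2 b1 b2"
  by (simp add: p_bundle_def algebra_simps)

text \<open>Dictionary between \<open>v\<close>, \<open>L\<close> and the expressions in
  \<open>pa\<close> occurring in the theorem.\<close>

lemma active_price:
  assumes "active c1 (c2 + b2) b2 p v L"
  defines "pa \<equiv> p - L + v / 2"
  shows "c2 - 2 * b2 + 3 * pa = v" "4 * c1 * (b2 - pa) = v * L" "(2 * b2 - c2 - pa) / 2 = p - L"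
proof -
  have a: "6 * p = 6 * L + 4 * b2 - 2 * c2 - v" "v * (3 * L + 4 * c1) = 4 * c1 * (c2 + b2)"
    and pa: "2 * pa = 2 * p - 2 * L + v"
    using assms by (auto simp: active_def pa_def field_simps)
  have "2 * (c2 - 2 * b2 + 3 * pa) = 2 * v" "2 * (2 * b2 - c2 - pa) = 2 * (2 * (p - L))"
    using a(1) pa by simp_all
  then show "c2 - 2 * b2 + 3 * pa = v" "(2 * b2 - c2 - pa) / 2 = p - L" by simp_all
  have "6 * (4 * c1 * (b2 - pa)) = 6 * (v * L)" using a pa by algebra
  then show "4 * c1 * (b2 - pa) = v * L"
    by (rule iffD1[OF mult_left_cancel[OF zero_neq_numeral[symmetric]]])
qed

lemma params_from_active:
  assumes "active c1 (c2 + b2) b2 p v L"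
  shows "params_from c1 c2 b2 (p - L + v / 2) (v / (2 * L)) p"
proof -
  note P = active_price[OF assms]
  have P2: "8 * c1 * (b2 - (p - L + v / 2)) = 2 * (v * L)"
    unfolding P(2)[symmetric] by simp
  show ?thesis
    unfolding params_from_def P P2 by (auto simp: power2_eq_square)
qed

lemma price_le_pa_max:
  assumes "0 \<le> c1" "0 < c2 + b2" and act: "active c1 (c2 + b2) b2 p v L"
  shows "p - L + v / 2 \<le> pa_max c1 c2 b1 b2"
proof -
  define S where "S = sqrt (2 * c1 * (2 * c1 + 3 * (c2 + b2)))"
  have a: "v * (3 * L + 4 * c1) = 4 * c1 * (c2 + b2)" "0 \<le> v" "v \<le> 2 * L"
    using act by (auto simp: active_def)
  have "3 * v + 4 * c1 \<le> 2 * S"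
  proof -
    have "v * v \<le> v * (2 * L)" using a by (intro mult_left_mono)
    then have "((3 * v + 4 * c1) / 2)^2 \<le> 2 * c1 * (2 * c1 + 3 * (c2 + b2))"
      using a(1) by (simp add: power2_eq_square field_simps)
    then have "(3 * v + 4 * c1) / 2 \<le> S" unfolding S_def by (rule real_le_rsqrt)
    then show ?thesis by simp
  qed
  then show ?thesis
    using active_price(1)[OF act]
    unfolding pa_max_eq_threshold threshold_def S_def[symmetric] by (simp add: field_simps)
qed

lemma pa_min_le_iff:
  assumes "0 \<le> c1" "0 < b1"
  shows "pa_min c1 c2 b1 b2 \<le> pa \<longleftrightarrow>
    c1 * (4 * b2 + 6 * c2) \<le> (c2 - 2 * b2 + 3 * pa) * (2 * b1 + 3 * c1)"
proof -
  have "0 < 3 * (2 * b1 + 3 * c1)" using assms by simp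
  then show ?thesis
    unfolding pa_min_def by (simp add: pos_divide_le_eq algebra_simps)
qed

text \<open>The cubic in (b) is the balance with the denominator \<open>v\<close> of
  \<open>L = 4 * c1 * (b2 - pa) / v\<close> cleared.\<close>

lemma solves_b_polynomial:
  assumes "2 * p = 2 * L + 2 * pa - v" "v = c2 - 2 * b2 + 3 * pa" "v * L = 4 * c1 * (b2 - pa)"
  shows "- 8 * c1 * b2^2 + (c2 * b1 - b2 * b1 - b2 * c1) * (c2 - 2 * b2)
       + (c2 / 2 - b1) * (c2 - 2 * b2)^2 - 3 / 8 * (c2 - 2 * b2)^3
       + (c1 * (4 * c2 - 3 * b2) + 3 * b1 * b2 + 2 * (c2 - 2 * c1) * (c2 - 2 * b2)
          - 15 / 8 * (c2 - 2 * b2)^2) * pa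
       + (3 * c2 / 2 - 21 / 8 * (c2 - 2 * b2)) * pa^2 - 9 / 8 * pa^3
     = - v * (excess c1 c2 b1 b2 p - reduction c1 v L)" (is "?poly = ?rhs")
proof -
  have "8 * ?poly = - 64 * c1 * b2^2 + 8 * (c2 * b1 - b2 * b1 - b2 * c1) * (c2 - 2 * b2)
       + (4 * c2 - 8 * b1) * (c2 - 2 * b2)^2 - 3 * (c2 - 2 * b2)^3
       + (8 * c1 * (4 * c2 - 3 * b2) + 24 * b1 * b2 + 16 * (c2 - 2 * c1) * (c2 - 2 * b2)
          - 15 * (c2 - 2 * b2)^2) * pa
       + (12 * c2 - 21 * (c2 - 2 * b2)) * pa^2 - 9 * pa^3"
    by (simp add: field_simps)
  also have "\<dots> = - v * (12 * p^2 + 8 * (c1 + c2) * p - 8 * b1 * b2 - 2 * (2 * L - v) * (3 * L + 2 * c1))"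
    using assms by algebra
  also have "\<dots> = 8 * ?rhs"
    by (simp add: excess_def reduction_def field_simps)
  finally show ?thesis by simp
qed

text \<open>The first equation of (a) says that both items yield the same \<open>p\<close>; the
  second is the balance at this \<open>p\<close>. Both are multiplied by
  \<open>v1 * v2\<close>.\<close>

lemma solves_a_polynomials:
  assumes "2 * p1 = 2 * L1 + 2 * pa1 - v1" "v1 = c2 - 2 * b2 + 3 * pa1" "v1 * L1 = 4 * c1 * (b2 - pa1)"
    and "2 * p2 = 2 * L2 + 2 * pa2 - v2" "v2 = c1 - 2 * b1 + 3 * pa2" "v2 * L2 = 4 * c2 * (b1 - pa2)"
  shows "(c1 - c2 - 2 * (b1 - b2) - (pa1 - pa2)) * (c1 - 2 * b1 + 3 * pa2) * (c2 - 2 * b2 + 3 * pa1)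
       + 8 * c1 * (b2 - pa1) * (c1 - 2 * b1 + 3 * pa2)
       - 8 * c2 * (b1 - pa2) * (c2 - 2 * b2 + 3 * pa1) = 2 * v1 * v2 * (p1 - p2)"
    and "p1 = p2 \<Longrightarrow> 3 * ((b1 * (c2 - 2 * b2 + 3 * pa1) - 4 * c1 * (b2 - pa1))
          * (b2 * (c1 - 2 * b1 + 3 * pa2) - 4 * c2 * (b1 - pa2)))
       - ((b1 * (c2 - 2 * b2 + 3 * pa1) - 4 * c1 * (b2 - pa1)) * (c1 - 2 * b1 + 3 * pa2) * (c2 + b2)
          + (b2 * (c1 - 2 * b1 + 3 * pa2) - 4 * c2 * (b1 - pa2)) * (c2 - 2 * b2 + 3 * pa1) * (c1 + b1))
       - 3 / 8 * (((2 * b2 - c2 - pa1) * (c1 - 2 * b1 + 3 * pa2) - 8 * c2 * (b1 - pa2))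
          * ((2 * b1 - c1 - pa2) * (c2 - 2 * b2 + 3 * pa1) - 8 * c1 * (b2 - pa1)))
      = - v1 * v2 * (excess c1 c2 b1 b2 p1 - reduction c1 v1 L1 - reduction c2 v2 L2)" (is "_ \<Longrightarrow> ?poly = ?rhs")
proof -
  show "(c1 - c2 - 2 * (b1 - b2) - (pa1 - pa2)) * (c1 - 2 * b1 + 3 * pa2) * (c2 - 2 * b2 + 3 * pa1)
       + 8 * c1 * (b2 - pa1) * (c1 - 2 * b1 + 3 * pa2)
       - 8 * c2 * (b1 - pa2) * (c2 - 2 * b2 + 3 * pa1) = 2 * v1 * v2 * (p1 - p2)"
    using assms by algebra
  assume eq: "p1 = p2"
  define k where "k = p1 - L1 - L2"
  have f1: "b1 * (c2 - 2 * b2 + 3 * pa1) - 4 * c1 * (b2 - pa1) = v1 * (b1 - L1)"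
    "b2 * (c1 - 2 * b1 + 3 * pa2) - 4 * c2 * (b1 - pa2) = v2 * (b2 - L2)"
    using assms(2,3,5,6) by algebra+
  have f2: "(2 * b2 - c2 - pa1) * (c1 - 2 * b1 + 3 * pa2) - 8 * c2 * (b1 - pa2) = 2 * v2 * k"
    "(2 * b1 - c1 - pa2) * (c2 - 2 * b2 + 3 * pa1) - 8 * c1 * (b2 - pa1) = 2 * v1 * k"
    using assms eq k_def by algebra+
  have f3: "c1 - 2 * b1 + 3 * pa2 = v2" "c2 - 2 * b2 + 3 * pa1 = v1" using assms by simp_all
  have "2 * ?poly = v1 * v2 * (6 * (b1 - L1) * (b2 - L2) - 2 * (b1 - L1) * (c2 + b2) - 2 * (b2 - L2) * (c1 + b1) - 3 * k^2)"
    unfolding f1 f2 unfolding f3 by (simp add: power2_eq_square algebra_simps)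
  moreover have "6 * (b1 - L1) * (b2 - L2) - 2 * (b1 - L1) * (c2 + b2) - 2 * (b2 - L2) * (c1 + b1) - 3 * k^2
     = - (3 * p1^2 + 2 * (c1 + c2) * p1 - 2 * b1 * b2) + (2 * L1 - v1) * (3 * L1 + 2 * c1) / 2 + (2 * L2 - v2) * (3 * L2 + 2 * c2) / 2"
    (is "?l = ?r")
  proof -
    have "2 * ?l = - 2 * (3 * p1^2 + 2 * (c1 + c2) * p1 - 2 * b1 * b2) + (2 * L1 - v1) * (3 * L1 + 2 * c1) + (2 * L2 - v2) * (3 * L2 + 2 * c2)"
      using assms eq k_def by algebra
    then show ?thesis by simp
  qed
  moreover have "?r = - 2 * (excess c1 c2 b1 b2 p1 - reduction c1 v1 L1 - reduction c2 v2 L2)"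
    by (simp add: excess_def reduction_def field_simps)
  ultimately have "2 * ?poly = v1 * v2 * (- 2 * (excess c1 c2 b1 b2 p1 - reduction c1 v1 L1 - reduction c2 v2 L2))"
    by (simp only:)
  also have "\<dots> = 2 * ?rhs" by algebra
  finally show "?poly = ?rhs" by (rule iffD1[OF mult_left_cancel[OF zero_neq_numeral[symmetric]]])
qed

lemma excess_mono:
  assumes "0 \<le> c1" "0 \<le> c2" "0 \<le> q" "q < p"
  shows "excess c1 c2 b1 b2 q < excess c1 c2 b1 b2 p"
proof -
  have "q^2 < p^2" using assms by (intro power_strict_mono) auto
  moreover have "(c1 + c2) * q \<le> (c1 + c2) * p" using assms by (intro mult_left_mono) auto
  ultimately show ?thesis by (simp add: excess_def)
qed

lemma excess_p_bundle:
  assumes "0 \<le> c1" "0 \<le> c2" "0 < b1" "0 < b2"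
  shows "0 < p_bundle c1 c2 b1 b2" "excess c1 c2 b1 b2 (p_bundle c1 c2 b1 b2) = 0"
proof -
  define S where "S = sqrt ((c1 + c2)^2 + 6 * b1 * b2)"
  define p where "p = p_bundle c1 c2 b1 b2"
  have "p = (S - c1 - c2) / 3" by (simp add: p_def p_bundle_def S_def)
  then have pS: "3 * p + (c1 + c2) = S" by simp
  have "c1 + c2 < S" unfolding S_def using assms by (intro real_less_rsqrt) simp
  then show "0 < p_bundle c1 c2 b1 b2" using pS by (simp add: p_def)
  have "S^2 = (c1 + c2)^2 + 6 * b1 * b2" using assms by (simp add: S_def)
  then have "6 * excess c1 c2 b1 b2 p = 0"
    unfolding pS[symmetric] by (simp add: excess_def power2_eq_square algebra_simps)
  then show "excess c1 c2 b1 b2 (p_bundle c1 c2 b1 b2) = 0" by (simp add: p_def)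
qed

text \<open>From \<open>c1 <= m2 < 3 * p\<close> the first factor in \<open>xy\<close> is below
  \<open>2 * p\<close>, so the second exceeds \<open>3 * p\<close>. This makes \<open>c2\<close> so
  large that \<open>q\<close> forces \<open>7 * c1 < m1\<close>, although \<open>p < c1\<close> and
  \<open>m1 < 2 * p\<close>.\<close>

lemma bundle_junctions_case:
  fixes c1 c2 m1 m2 p :: real
  assumes "0 < p" "p \<le> m1" "p \<le> m2" "m2 < 3 * p" "m1 + m2 < 4 * p"
    and xy: "6 * p^2 < (c1 - (4 * p - m2)) * (c2 - (4 * p - m1))"
    and gt: "4 * p - m2 < c1" "4 * p - m1 < c2" and "c1 \<le> m2"
    and q: "c2 \<le> m1 \<or> c1 * (4 * c2 - 3 * m1) \<le> m1 * m2"
  shows False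
proof -
  have m: "2 * p < m2" "m1 < 2 * p" using assms by simp_all
  then have "\<not> c2 \<le> m1" using gt by simp
  then have q: "c1 * (4 * c2 - 3 * m1) \<le> m1 * m2" using q by simp
  have y: "3 * p < c2 - (4 * p - m1)"
  proof (rule ccontr)
    assume "\<not> ?thesis"
    then have "(c1 - (4 * p - m2)) * (c2 - (4 * p - m1)) \<le> (2 * p) * (3 * p)"
      using assms gt by (intro mult_mono) auto
    then show False using xy by (simp add: power2_eq_square)
  qed
  then have "7 * m2 < 4 * c2 - 3 * m1" using assms by simp
  moreover have "0 < c1" using gt assms by simp
  ultimately have "c1 * (7 * m2) < c1 * (4 * c2 - 3 * m1)" by simp
  then have "m2 * (7 * c1) < m2 * m1" using q by (simp add: mult.commute mult.left_commute)
  then have "7 * c1 < m1" using m assms by simp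
  then show False using gt assms by simp
qed

section \<open>Pure bundling and the choice of the structure\<close>

context market
begin

text \<open>For pure bundling \<open>L1 = (3 * p - m1) / 2\<close> and
  \<open>L2 = (3 * p - m2) / 2\<close> if these are positive, so the conclusion is
  \<open>L1 + L2 <= p\<close>.\<close>

lemma bundle_junctions:
  assumes p: "0 < p" and zero: "excess c1 c2 b1 b2 p = 0"
    and le: "p \<le> 2 * b2 - c2" "p \<le> 2 * b1 - c1" and gt: "2 * b2 - c2 < 3 * p" "2 * b1 - c1 < 3 * p"
  shows "4 * p \<le> (2 * b2 - c2) + (2 * b1 - c1)"
proof (rule ccontr)
  define m1 m2 where "m1 = 2 * b2 - c2" and "m2 = 2 * b1 - c1"
  assume "\<not> ?thesis"
  then have lt: "m1 + m2 < 4 * p" by (simp add: m1_def m2_def)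
  \<comment> \<open>The balance written as a product: its right side exceeds \<open>6 * p^2\<close>,
    so both factors have the same sign.\<close>
  have xy: "(c1 - (4 * p - m2)) * (c2 - (4 * p - m1)) = 22 * p^2 - 4 * p * (m1 + m2)"
    using zero by (simp add: excess_def m1_def m2_def power2_eq_square algebra_simps)
  moreover have "p * (m1 + m2) < p * (4 * p)" using lt p by (rule mult_strict_left_mono)
  ultimately have xy_gt: "6 * p^2 < (c1 - (4 * p - m2)) * (c2 - (4 * p - m1))"
    by (simp add: power2_eq_square)
  have p2: "0 < p^2" using p by simp
  have le': "p \<le> m1" "p \<le> m2" "m1 < 3 * p" "m2 < 3 * p" using le gt by (simp_all add: m1_def m2_def)
  have "0 < (c1 - (4 * p - m2)) * (c2 - (4 * p - m1))" using xy_gt p2 by linarith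
  then consider "c1 < 4 * p - m2" "c2 < 4 * p - m1" | "4 * p - m2 < c1" "4 * p - m1 < c2"
    by (auto simp: zero_less_mult_iff)
  then show False
  proof cases
    case 1
    have "((4 * p - m2) - c1) * ((4 * p - m1) - c2) \<le> (4 * p - m2) * (4 * p - m1)"
      using 1 c_nonneg by (intro mult_mono) auto
    then have "6 * p^2 \<le> m1 * m2" using xy by (simp add: power2_eq_square algebra_simps)
    moreover have "4 * (m1 * m2) \<le> (m1 + m2)^2"
      using zero_le_power2[of "m1 - m2"] by (simp add: power2_eq_square algebra_simps)
    moreover have "(m1 + m2)^2 \<le> (4 * p)^2" using lt le' p by (intro power_mono) auto
    ultimately show False using p2 by (simp add: power2_eq_square)
  next
    case 2
    have q1: "c2 \<le> m1 \<or> c1 * (4 * c2 - 3 * m1) \<le> m1 * m2"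
      using cond1 by (auto simp: m1_def m2_def algebra_simps)
    have q2: "c1 \<le> m2 \<or> c2 * (4 * c1 - 3 * m2) \<le> m2 * m1"
      using cond2 by (auto simp: m1_def m2_def algebra_simps)
    from cond show False
    proof
      assume "c1 \<le> b1"
      then have "c1 \<le> m2" by (simp add: m2_def)
      then show False
        using bundle_junctions_case[of p m1 m2 c1 c2] p le' lt xy_gt 2 q1 by simp
    next
      assume "c2 \<le> b2"
      then have "c2 \<le> m1" by (simp add: m1_def)
      then show False
        using bundle_junctions_case[of p m2 m1 c2 c1] p le' lt xy_gt 2 q2 by (simp add: mult.commute)
    qed
  qed
qed

lemma certificate_bundle:
  assumes p: "0 < p" and zero: "excess c1 c2 b1 b2 p = 0"
    and th: "p \<le> threshold c1 T b2" "p \<le> threshold c2 R b1"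
  obtains L1 L2 g1 g2 where "certificate c1 c2 b1 b2 L1 L2 1 1 g1 g2 p p p"
proof -
  interpret swap: market c2 c1 b2 b1 by (rule market_swap) (rule market_axioms)
  define w1 w2 where "w1 = T - 3 * (b2 - p)" and "w2 = R - 3 * (b1 - p)"
  obtain g1 where g1: "half_certificate c1 T b2 p (max 0 (w1 / 2)) 1 g1 p"
    and w1: "w1 < T" "0 < w1 \<Longrightarrow> 3 * w1^2 + 8 * c1 * w1 \<le> 8 * c1 * T"
    using half_certificate_if_le_threshold[OF c_nonneg(1) TR_pos(1) th(1)] unfolding w1_def by blast
  obtain g2 where g2: "half_certificate c2 R b1 p (max 0 (w2 / 2)) 1 g2 p"
    and w2: "w2 < R" "0 < w2 \<Longrightarrow> 3 * w2^2 + 8 * c2 * w2 \<le> 8 * c2 * R"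
    using half_certificate_if_le_threshold[OF c_nonneg(2) TR_pos(2) th(2)] unfolding w2_def by blast
  have le: "p \<le> 2 * b2 - c2" "p \<le> 2 * b1 - c1"
    using bundle_junction_le[OF p zero w1_def w1] swap.bundle_junction_le[OF p _ w2_def w2] zero
    by (simp_all add: excess_swap)
  have w: "w1 = 3 * p - (2 * b2 - c2)" "w2 = 3 * p - (2 * b1 - c1)" by (simp_all add: w1_def w2_def)
  have "max 0 (w1 / 2) + max 0 (w2 / 2) \<le> p"
  proof (cases "0 < w1 \<and> 0 < w2")
    case True
    then have "4 * p \<le> (2 * b2 - c2) + (2 * b1 - c1)"
      using bundle_junctions[OF p zero le] w by simp
    then show ?thesis using True w by (simp add: field_simps)
  next
    case False
    then show ?thesis using le p w by (auto simp: max_def)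
  qed
  then have "certificate c1 c2 b1 b2 (max 0 (w1 / 2)) (max 0 (w2 / 2)) 1 1 g1 g2 p p p"
    by (intro certificate_if_halves[OF g1 g2]) (use zero c_nonneg b_pos in simp_all)
  then show ?thesis by (rule that)
qed

lemma threshold_nonneg: "0 \<le> threshold c1 T b2"
proof -
  have "2 * c1 \<le> sqrt (2 * c1 * (2 * c1 + 3 * T))"
    using mult_nonneg_nonneg[OF c_nonneg(1) less_imp_le[OF TR_pos(1)]]
    by (intro real_le_rsqrt) (simp add: power2_eq_square algebra_simps)
  moreover have "0 \<le> 3 * b2 - T" using c2_le by simp
  ultimately show ?thesis unfolding threshold_def by (simp add: field_simps)
qed

lemma structure_cases:
  assumes th: "threshold c1 T b2 \<le> threshold c2 R b1"
  obtains (bundled) "p_bundle c1 c2 b1 b2 \<le> threshold c1 T b2"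
    | (one) p v L where "p \<le> threshold c2 R b1" "active c1 T b2 p v L"
        "excess c1 c2 b1 b2 p = reduction c1 v L"
    | (two) p v1 L1 v2 L2 where "active c1 T b2 p v1 L1" "active c2 R b1 p v2 L2"
        "L1 + L2 \<le> p" "excess c1 c2 b1 b2 p = reduction c1 v1 L1 + reduction c2 v2 L2"
proof (cases "p_bundle c1 c2 b1 b2 \<le> threshold c1 T b2")
  case False
  let ?t1 = "threshold c1 T b2" and ?t2 = "threshold c2 R b1"
  define w l where "w = active_v c1 T b2" and "l = active_L c1 T b2"
  define f where "f p = excess c1 c2 b1 b2 p - reduction c1 (w p) (l p)" for p
  have act: "active c1 T b2 p (w p) (l p)" if "?t1 \<le> p" for p
    using active_if_threshold_le[OF c_nonneg(1) TR_pos(1) that] by (simp add: w_def l_def)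
  have "excess c1 c2 b1 b2 ?t1 < 0"
    using excess_mono[OF c_nonneg threshold_nonneg, where p = "p_bundle c1 c2 b1 b2" and ?b1.0 = b1 and ?b2.0 = b2] False
      excess_p_bundle(2)[OF c_nonneg b_pos] by simp
  then have "f ?t1 \<le> 0"
    using reduction_nonneg[OF c_nonneg(1) act[OF order_refl]] by (simp add: f_def)
  show ?thesis
  proof (cases "0 \<le> f ?t2")
    case True
    have "continuous_on {?t1..?t2} f"
      unfolding f_def excess_def reduction_def w_def l_def by (auto intro!: continuous_intros)
    then obtain p where "?t1 \<le> p" "p \<le> ?t2" "f p = 0"
      using IVT'[of f ?t1 0 ?t2] \<open>f ?t1 \<le> 0\<close> True th by auto
    then show ?thesis using one[OF _ act[of p]] by (simp add: f_def)
  next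
    case False
    let ?v2 = "active_v c2 R b1 ?t2" and ?L2 = "active_L c2 R b1 ?t2"
    have act2: "active c2 R b1 ?t2 ?v2 ?L2"
      by (rule active_if_threshold_le[OF c_nonneg(2) TR_pos(2) order_refl])
    have le: "excess c1 c2 b1 b2 ?t2 \<le> reduction c1 (w ?t2) (l ?t2)"
      using False by (simp add: f_def)
    have le2: "excess c1 c2 b1 b2 ?t2 \<le> reduction c1 (w ?t2) (l ?t2) + reduction c2 ?v2 ?L2"
      using le reduction_nonneg[OF c_nonneg(2) act2] by simp
    obtain p v1 L1 v2 L2 where "active c1 T b2 p v1 L1" "active c2 R b1 p v2 L2"
      "L1 + L2 \<le> p" "excess c1 c2 b1 b2 p = reduction c1 v1 L1 + reduction c2 v2 L2"
      by (rule climb[OF th order_refl act[OF th] act2 le2 junctions_ordered[OF act[OF th] act2 le]])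
    then show ?thesis by (rule two)
  qed
qed (use bundled in blast)

text \<open>By \<open>lower_bound_identity\<close> the claim is
  \<open>v1 * (6 * k + v2) >= 4 * c1 * c2\<close>, for which \<open>4 * c1 * c2 <= v1 * v2\<close>
  suffices.\<close>

lemma lower_bound_two:
  assumes act1: "active c1 T b2 p v1 L1" and act2: "active c2 R b1 p v2 L2" and k: "L1 + L2 \<le> p"
  shows "pa_min c1 c2 b1 b2 \<le> p - L1 + v1 / 2"
proof -
  define k where "k = p - L1 - L2"
  define A B where "A = 4 * T - v1" and "B = 4 * R - v2"
  have k0: "0 \<le> k" using k by (simp add: k_def)
  have v: "0 \<le> v1" "v1 \<le> T" "0 \<le> v2" "v2 \<le> R"
    using active_le[OF c_nonneg(1) TR_pos(1) act1] active_le[OF c_nonneg(2) TR_pos(2) act2] act1 act2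
    by (auto simp: active_def)
  have a: "v1 = 6 * L1 + 4 * b2 - 2 * c2 - 6 * p" "v1 * (3 * L1 + 4 * c1) = 4 * c1 * (c2 + b2)"
    "v2 = 6 * L2 + 4 * b1 - 2 * c1 - 6 * p" "v2 * (3 * L2 + 4 * c2) = 4 * c2 * (c1 + b1)"
    using act1 act2 by (auto simp: active_def field_simps)
  have AB: "0 < A" "0 < B" using v TR_pos by (simp_all add: A_def B_def)
  \<comment> \<open>Multiplying the two relations compares \<open>c1 * c2\<close> with
    \<open>v1 * v2\<close>.\<close>
  have cA: "2 * c1 * A = v1 * (B - 6 * k)" and cB: "2 * c2 * B = v2 * (A - 6 * k)"
    using a unfolding A_def B_def k_def by algebra+
  have "(4 * c1 * c2) * (A * B) \<le> (v1 * v2) * (A * B)"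
  proof (cases "v1 = 0 \<or> v2 = 0")
    case True
    then have "c1 = 0 \<or> c2 = 0" using cA cB AB by auto
    then show ?thesis using v AB by auto
  next
    case False
    have "0 \<le> v1 * (B - 6 * k)" "0 \<le> v2 * (A - 6 * k)"
      unfolding cA[symmetric] cB[symmetric] using c_nonneg AB by simp_all
    then have "0 \<le> B - 6 * k" "0 \<le> A - 6 * k" using False v by (simp_all add: zero_le_mult_iff)
    then have "(A - 6 * k) * (B - 6 * k) \<le> A * B" using k0 AB by (intro mult_mono) auto
    then have "(v1 * v2) * ((A - 6 * k) * (B - 6 * k)) \<le> (v1 * v2) * (A * B)"
      using v by (intro mult_left_mono) auto
    moreover have "(4 * c1 * c2) * (A * B) = (2 * c1 * A) * (2 * c2 * B)" by simp
    ultimately show ?thesis unfolding cA cB by (simp add: algebra_simps)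
  qed
  then have cc: "4 * c1 * c2 \<le> v1 * v2" using AB by simp
  have "2 * (3 * (b1 - L1) - R) = 6 * k + v2" using a(3) by (simp add: k_def)
  then have "2 * (v1 * (3 * (b1 - L1) - R)) = v1 * (6 * k + v2)" by (metis mult.left_commute)
  moreover have "0 \<le> v1 * k" using v k0 by simp
  ultimately have "0 \<le> v1 * (3 * (b1 - L1) - R) - 2 * c1 * c2" using cc by (simp add: algebra_simps)
  then show ?thesis
    unfolding pa_min_le_iff[OF c_nonneg(1) b_pos(1)] active_price(1)[OF act1]
    using lower_bound_identity(2)[OF act1, of b1] by simp
qed

lemma two_sided:
  assumes act1: "active c1 T b2 p v1 L1" and act2: "active c2 R b1 p v2 L2" and k: "L1 + L2 \<le> p"
    and zero: "excess c1 c2 b1 b2 p = reduction c1 v1 L1 + reduction c2 v2 L2"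
  defines "pa1 \<equiv> p - L1 + v1 / 2" and "pa2 \<equiv> p - L2 + v2 / 2"
  shows "solves_a c1 c2 b1 b2 pa1 pa2" "optimal_a c1 c2 b1 b2 pa1 pa2"
proof -
  interpret swap: market c2 c1 b2 b1 by (rule market_swap) (rule market_axioms)
  have 1: "2 * p = 2 * L1 + 2 * pa1 - v1" "v1 = c2 - 2 * b2 + 3 * pa1" "v1 * L1 = 4 * c1 * (b2 - pa1)"
    using active_price[OF act1] by (auto simp: pa1_def)
  have 2: "2 * p = 2 * L2 + 2 * pa2 - v2" "v2 = c1 - 2 * b1 + 3 * pa2" "v2 * L2 = 4 * c2 * (b1 - pa2)"
    using active_price[OF act2] by (auto simp: pa2_def)
  have "pa_min c2 c1 b2 b1 \<le> pa2"
    unfolding pa2_def using swap.lower_bound_two[OF act2 act1] k by (simp add: add.commute)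
  then show "solves_a c1 c2 b1 b2 pa1 pa2"
    unfolding solves_a_def
    using solves_a_polynomials[OF 1 2] zero lower_bound_two[OF act1 act2 k, folded pa1_def]
      price_le_pa_max[OF c_nonneg(1) TR_pos(1) act1, of b1, folded pa1_def]
      price_le_pa_max[OF c_nonneg(2) TR_pos(2) act2, of b2, folded pa2_def]
    by simp
  interpret certificate c1 c2 b1 b2 L1 L2 "v1 / (2 * L1)" "v2 / (2 * L2)" 0 0 p pa1 pa2
    unfolding pa1_def pa2_def by (rule certificate_two[OF act1 act2 k zero])
  show "optimal_a c1 c2 b1 b2 pa1 pa2"
    unfolding optimal_a_def
    using params_from_active[OF act1, folded pa1_def] params_from_active[OF act2, folded pa2_def]
      no_sale_shape optimal_menu_a by blast
qed

lemma one_sided: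
  assumes act: "active c1 T b2 p v L" and th: "p \<le> threshold c2 R b1"
    and zero: "excess c1 c2 b1 b2 p = reduction c1 v L"
  defines "pa \<equiv> p - L + v / 2"
  obtains L2 g2 where "solves_b c1 c2 b1 b2 pa" "params_from c1 c2 b2 pa (v / (2 * L)) p"
    "certificate c1 c2 b1 b2 L L2 (v / (2 * L)) 1 0 g2 p pa p"
proof -
  have 1: "2 * p = 2 * L + 2 * pa - v" "v = c2 - 2 * b2 + 3 * pa" "v * L = 4 * c1 * (b2 - pa)"
    using active_price[OF act] by (auto simp: pa_def)
  have L: "L \<le> p" by (rule junction_le_if_zero[OF act zero])
  have v: "0 \<le> v" using act by (simp add: active_def)
  have "0 \<le> v * (4 * (b1 - L) - 2 * R)" "0 \<le> 2 * (p - L) * c1"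
    using cut_bound[OF act] zero v L c_nonneg by (auto intro!: mult_nonneg_nonneg)
  then have "pa_min c1 c2 b1 b2 \<le> pa"
    unfolding pa_min_le_iff[OF c_nonneg(1) b_pos(1)] 1(2)[symmetric]
    using lower_bound_identity(1)[OF act, of b1] by simp
  then have "solves_b c1 c2 b1 b2 pa"
    unfolding solves_b_def solves_b_polynomial[OF 1] using zero
      price_le_pa_max[OF c_nonneg(1) TR_pos(1) act, of b1, folded pa_def] by simp
  moreover obtain L2 g2 where "certificate c1 c2 b1 b2 L L2 (v / (2 * L)) 1 0 g2 p pa p"
    using certificate_one[OF act th L zero] unfolding pa_def by blast
  ultimately show ?thesis using that params_from_active[OF act, folded pa_def] by blast
qed

text \<open>As \<open>c1 > 0\<close>, the lower end of the range gives \<open>v > 0\<close>, so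
  \<open>L\<close> and \<open>p\<close> can be recovered from \<open>pa\<close>; the upper end gives
  \<open>v <= 2 * L\<close>.\<close>

lemma active_if_in_range:
  assumes c1: "0 < c1" and range: "pa_min c1 c2 b1 b2 \<le> pa" "pa \<le> pa_max c1 c2 b1 b2"
  defines "v \<equiv> c2 - 2 * b2 + 3 * pa"
  defines "L \<equiv> 4 * c1 * (b2 - pa) / v"
  defines "p \<equiv> L + pa - v / 2"
  shows "0 < v" "active c1 T b2 p v L" "pa = p - L + v / 2"
proof -
  show pa: "pa = p - L + v / 2" by (simp add: p_def)
  have "0 < c1 * (4 * b2 + 6 * c2)" using c1 c_nonneg b_pos by (intro mult_pos_pos) auto
  also have "\<dots> \<le> v * (2 * b1 + 3 * c1)"
    using range(1) unfolding pa_min_le_iff[OF c_nonneg(1) b_pos(1)] v_def .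
  finally show v: "0 < v" using c_nonneg b_pos by (simp add: zero_less_mult_iff)
  have vL: "v * L = 4 * c1 * (b2 - pa)" using v by (simp add: L_def)
  define S where "S = sqrt (2 * c1 * (2 * c1 + 3 * T))"
  have S: "S^2 = 2 * c1 * (2 * c1 + 3 * T)" "0 \<le> S" using c_nonneg TR_pos by (simp_all add: S_def)
  have "3 * v + 4 * c1 \<le> 2 * S"
    using range(2) unfolding pa_max_eq_threshold threshold_def S_def[symmetric] v_def
    by (simp add: field_simps)
  then have "(3 * v + 4 * c1)^2 \<le> (2 * S)^2" using v c1 by (intro power_mono) auto
  then have "v * v \<le> v * (2 * L)"
    using S(1) vL unfolding v_def by (simp add: power2_eq_square algebra_simps)
  then have "v \<le> 2 * L" using v by simp
  moreover have "v * (3 * L + 4 * c1) = 4 * c1 * T" using vL unfolding v_def by (simp add: algebra_simps)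
  moreover have "p = L + b2 - T / 3 - v / 6" by (simp add: p_def v_def field_simps)
  ultimately show "active c1 T b2 p v L" using v by (simp add: active_def)
qed

lemma optimal_a_if_solves_a:
  assumes c: "0 < c1" "0 < c2" and sol: "solves_a c1 c2 b1 b2 pa1 pa2"
  shows "optimal_a c1 c2 b1 b2 pa1 pa2"
proof -
  interpret swap: market c2 c1 b2 b1 by (rule market_swap) (rule market_axioms)
  define v1 v2 where "v1 = c2 - 2 * b2 + 3 * pa1" and "v2 = c1 - 2 * b1 + 3 * pa2"
  define L1 L2 where "L1 = 4 * c1 * (b2 - pa1) / v1" and "L2 = 4 * c2 * (b1 - pa2) / v2"
  define p p2 where "p = L1 + pa1 - v1 / 2" and "p2 = L2 + pa2 - v2 / 2"
  have r: "pa_min c1 c2 b1 b2 \<le> pa1" "pa1 \<le> pa_max c1 c2 b1 b2"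
    "pa_min c2 c1 b2 b1 \<le> pa2" "pa2 \<le> pa_max c2 c1 b2 b1"
    using sol by (auto simp: solves_a_def)
  have A1: "0 < v1" "active c1 T b2 p v1 L1" "pa1 = p - L1 + v1 / 2"
    using active_if_in_range[OF c(1) r(1,2)] by (simp_all add: v1_def L1_def p_def)
  have A2: "0 < v2" "active c2 R b1 p2 v2 L2" "pa2 = p2 - L2 + v2 / 2"
    using swap.active_if_in_range[OF c(2) r(3,4)] by (simp_all add: v2_def L2_def p2_def)
  have 1: "2 * p = 2 * L1 + 2 * pa1 - v1" "v1 = c2 - 2 * b2 + 3 * pa1" "v1 * L1 = 4 * c1 * (b2 - pa1)"
    using A1(1) by (simp_all add: p_def v1_def[symmetric] L1_def)
  have 2: "2 * p2 = 2 * L2 + 2 * pa2 - v2" "v2 = c1 - 2 * b1 + 3 * pa2" "v2 * L2 = 4 * c2 * (b1 - pa2)"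
    using A2(1) by (simp_all add: p2_def v2_def[symmetric] L2_def)
  have "2 * v1 * v2 * (p - p2) = 0"
    using sol solves_a_polynomials(1)[OF 1 2] by (simp add: solves_a_def)
  then have eq: "p = p2" using A1 A2 by simp
  note act2 = A2(2)[folded eq]
  have "- v1 * v2 * (excess c1 c2 b1 b2 p - reduction c1 v1 L1 - reduction c2 v2 L2) = 0"
    using sol unfolding solves_a_def solves_a_polynomials(2)[OF 1 2 eq] by blast
  then have zero: "excess c1 c2 b1 b2 p = reduction c1 v1 L1 + reduction c2 v2 L2"
    using A1 A2 by simp
  define k where "k = p - L1 - L2"
  have v: "v1 \<le> T" "v2 \<le> R"
    using active_le[OF c_nonneg(1) TR_pos(1) A1(2)] active_le[OF c_nonneg(2) TR_pos(2) act2] by auto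
  \<comment> \<open>The balance is quadratic in \<open>k\<close> and could have a negative root; the
    lower bound on \<open>pa1\<close> excludes it by making \<open>3 * k + v1 + v2\<close>
    positive.\<close>
  have "0 \<le> v1 * (3 * (b1 - L1) - R) - 2 * c1 * c2"
    using r(1) unfolding pa_min_le_iff[OF c_nonneg(1) b_pos(1)] 1(2)[symmetric]
    using lower_bound_identity(2)[OF A1(2), of b1] by simp
  moreover have "0 < 2 * c1 * c2" using c by simp
  ultimately have "0 < v1 * (3 * (b1 - L1) - R)" by linarith
  then have "0 < 3 * (b1 - L1) - R" using A1(1) by (simp add: zero_less_mult_iff)
  moreover have "6 * p = 6 * L2 + 4 * b1 - 2 * c1 - v2" using act2 by (auto simp: active_def field_simps)
  ultimately have pos: "0 < 3 * k + v1 + v2" using A1 A2 by (simp add: k_def)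
  have "4 * T * R - v1 * v2 - 6 * k * (3 * k + v1 + v2) = 0"
    using excess_identity_two[OF A1(2) act2] zero by (simp add: k_def)
  moreover have "v1 * v2 \<le> T * R" using v A1 A2 by (intro mult_mono) auto
  moreover have "0 < T * R" using TR_pos by simp
  moreover have "4 * T * R = 4 * (T * R)" by simp
  ultimately have "0 < 6 * k * (3 * k + v1 + v2)" by linarith
  then have "0 < k" using pos by (simp add: zero_less_mult_iff)
  then have "L1 + L2 \<le> p" by (simp add: k_def)
  from two_sided(2)[OF A1(2) act2 this zero] show ?thesis
    using A1(3) A2(3) eq by simp
qed

text \<open>If \<open>p\<close> were beyond the second threshold, \<open>climb\<close> could start
  there with both partial allocations and would solve (a), contrary to \<open>no_a\<close>.\<close>

lemma one_sided_if_solves_b: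
  assumes c1: "0 < c1" and no_a: "\<not> (\<exists>qa1 qa2. solves_a c1 c2 b1 b2 qa1 qa2)"
    and sol: "solves_b c1 c2 b1 b2 pa"
  obtains p v L where "active c1 T b2 p v L" "p \<le> threshold c2 R b1"
    "excess c1 c2 b1 b2 p = reduction c1 v L" "pa = p - L + v / 2"
proof -
  define v where "v = c2 - 2 * b2 + 3 * pa"
  define L where "L = 4 * c1 * (b2 - pa) / v"
  define p where "p = L + pa - v / 2"
  have r: "pa_min c1 c2 b1 b2 \<le> pa" "pa \<le> pa_max c1 c2 b1 b2"
    using sol by (auto simp: solves_b_def)
  have A: "0 < v" "active c1 T b2 p v L" "pa = p - L + v / 2"
    using active_if_in_range[OF c1 r] by (simp_all add: v_def L_def p_def)
  have 1: "2 * p = 2 * L + 2 * pa - v" "v = c2 - 2 * b2 + 3 * pa" "v * L = 4 * c1 * (b2 - pa)"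
    using A(1) by (simp_all add: p_def v_def[symmetric] L_def)
  have "- v * (excess c1 c2 b1 b2 p - reduction c1 v L) = 0"
    using sol unfolding solves_b_def solves_b_polynomial[OF 1] by blast
  then have zero: "excess c1 c2 b1 b2 p = reduction c1 v L" using A by simp
  have "p \<le> threshold c2 R b1"
  proof (rule ccontr)
    assume "\<not> p \<le> threshold c2 R b1"
    then have th: "threshold c2 R b1 \<le> p" by simp
    let ?v2 = "active_v c2 R b1 p" and ?L2 = "active_L c2 R b1 p"
    have act2: "active c2 R b1 p ?v2 ?L2"
      by (rule active_if_threshold_le[OF c_nonneg(2) TR_pos(2) th])
    have le: "excess c1 c2 b1 b2 p \<le> reduction c1 v L + reduction c2 ?v2 ?L2"
      using zero reduction_nonneg[OF c_nonneg(2) act2] by simp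
    obtain p' v1 L1 v2 L2 where "active c1 T b2 p' v1 L1" "active c2 R b1 p' v2 L2"
      "L1 + L2 \<le> p'" "excess c1 c2 b1 b2 p' = reduction c1 v1 L1 + reduction c2 v2 L2"
      by (rule climb[OF threshold_le_if_active[OF c_nonneg(1) TR_pos(1) A(2)] th A(2) act2 le
          junctions_ordered[OF A(2) act2 eq_refl[OF zero]]])
    then show False using two_sided(1) no_a by blast
  qed
  then show ?thesis using that A zero by blast
qed

lemma optimal_b_one_sided:
  assumes act: "active c1 T b2 p v L" and th: "p \<le> threshold c2 R b1"
    and zero: "excess c1 c2 b1 b2 p = reduction c1 v L"
  shows "solves_b c1 c2 b1 b2 (p - L + v / 2)" "optimal_b c1 c2 b1 b2 (p - L + v / 2)"
proof -
  obtain L2 g2 where *: "solves_b c1 c2 b1 b2 (p - L + v / 2)"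
    "params_from c1 c2 b2 (p - L + v / 2) (v / (2 * L)) p"
    "certificate c1 c2 b1 b2 L L2 (v / (2 * L)) 1 0 g2 p (p - L + v / 2) p"
    by (rule one_sided[OF act th zero])
  show "solves_b c1 c2 b1 b2 (p - L + v / 2)" by (rule *(1))
  show "optimal_b c1 c2 b1 b2 (p - L + v / 2)"
    unfolding optimal_b_def using *(2) certificate.optimal_menu_b[OF *(3) refl] by blast
qed

lemma optimal_b'_one_sided:
  assumes act: "active c2 R b1 p v L" and th: "p \<le> threshold c1 T b2"
    and zero: "excess c1 c2 b1 b2 p = reduction c2 v L"
  shows "solves_b c2 c1 b2 b1 (p - L + v / 2)" "optimal_b' c1 c2 b1 b2 (p - L + v / 2)"
proof -
  interpret swap: market c2 c1 b2 b1 by (rule market_swap) (rule market_axioms)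
  obtain L2 g2 where *: "solves_b c2 c1 b2 b1 (p - L + v / 2)"
    "params_from c2 c1 b1 (p - L + v / 2) (v / (2 * L)) p"
    "certificate c2 c1 b2 b1 L L2 (v / (2 * L)) 1 0 g2 p (p - L + v / 2) p"
    using swap.one_sided[OF act th] zero by (metis excess_swap)
  show "solves_b c2 c1 b2 b1 (p - L + v / 2)" by (rule *(1))
  show "optimal_b' c1 c2 b1 b2 (p - L + v / 2)"
    unfolding optimal_b'_def
    using *(2) certificate.optimal_menu_b'[OF certificate_swap[OF *(3)] refl] by blast
qed

lemma certificate_p_bundle:
  assumes "p_bundle c1 c2 b1 b2 \<le> threshold c1 T b2" "p_bundle c1 c2 b1 b2 \<le> threshold c2 R b1"
  defines "p \<equiv> p_bundle c1 c2 b1 b2"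
  obtains L1 L2 g1 g2 where "certificate c1 c2 b1 b2 L1 L2 1 1 g1 g2 p p p"
  unfolding p_def
  by (rule certificate_bundle[OF excess_p_bundle[OF c_nonneg b_pos] assms(1,2)])

lemma structure_exists:
  "(\<exists>pa1 pa2. solves_a c1 c2 b1 b2 pa1 pa2 \<and> optimal_a c1 c2 b1 b2 pa1 pa2) \<or>
   (\<exists>pa1. solves_b c1 c2 b1 b2 pa1 \<and> optimal_b c1 c2 b1 b2 pa1) \<or>
   (\<exists>pa2. solves_b c2 c1 b2 b1 pa2 \<and> optimal_b' c1 c2 b1 b2 pa2) \<or>
   (p_bundle c1 c2 b1 b2 \<le> threshold c1 T b2 \<and> p_bundle c1 c2 b1 b2 \<le> threshold c2 R b1)"
proof (cases "threshold c1 T b2 \<le> threshold c2 R b1")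
  case True
  then show ?thesis
  proof (cases rule: structure_cases)
    case bundled
    then show ?thesis using True by simp
  next
    case (one p v L)
    then show ?thesis using optimal_b_one_sided[OF one(2,1,3)] by blast
  next
    case (two p v1 L1 v2 L2)
    then show ?thesis using two_sided[OF two] by blast
  qed
next
  case False
  interpret swap: market c2 c1 b2 b1 by (rule market_swap) (rule market_axioms)
  have th: "threshold c2 R b1 \<le> threshold c1 T b2" using False by simp
  then show ?thesis
  proof (cases rule: swap.structure_cases)
    case bundled
    then show ?thesis using th by (simp add: p_bundle_swap)
  next
    case (one p v L)
    then show ?thesis
      using optimal_b'_one_sided[OF one(2,1)] one(3) by (auto simp: excess_swap)
  next
    case (two p v2 L2 v1 L1)
    have "L1 + L2 \<le> p" "excess c1 c2 b1 b2 p = reduction c1 v1 L1 + reduction c2 v2 L2"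
      using two(3,4) by (simp_all add: excess_swap)
    then show ?thesis using two_sided[OF two(2,1)] by blast
  qed
qed

lemma optimal_c_if_bundled:
  assumes "p_bundle c1 c2 b1 b2 \<le> threshold c1 T b2" "p_bundle c1 c2 b1 b2 \<le> threshold c2 R b1"
  shows "optimal_c c1 c2 b1 b2"
proof -
  obtain L1 L2 g1 g2 where "certificate c1 c2 b1 b2 L1 L2 1 1 g1 g2
      (p_bundle c1 c2 b1 b2) (p_bundle c1 c2 b1 b2) (p_bundle c1 c2 b1 b2)"
    by (rule certificate_p_bundle[OF assms])
  then show ?thesis
    unfolding optimal_c_def by (rule certificate.optimal_menu_c) simp_all
qed

section \<open>Vanishing lower valuations\<close>

lemma price_if_free:
  assumes "c1 = 0" "solves_b c1 c2 b1 b2 pa"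
  shows "c2 - 2 * b2 + 3 * pa = 0"
proof (rule antisym)
  have r: "pa_min c1 c2 b1 b2 \<le> pa" "pa \<le> pa_max c1 c2 b1 b2"
    using assms(2) by (auto simp: solves_b_def)
  show "c2 - 2 * b2 + 3 * pa \<le> 0" using r(2) assms(1) by (simp add: pa_max_def field_simps)
  have "0 \<le> (c2 - 2 * b2 + 3 * pa) * (2 * b1)"
    using r(1) assms(1) unfolding pa_min_le_iff[OF c_nonneg(1) b_pos(1)] by simp
  then show "0 \<le> c2 - 2 * b2 + 3 * pa" using b_pos by (simp add: zero_le_mult_iff)
qed

text \<open>Here \<open>c1\<close> and \<open>c2 - 2 * b2 + 3 * pa1\<close> both vanish, and with
  them every term of the two equations.\<close>

lemma solves_a_if_free:
  assumes "c1 = 0" "solves_b c1 c2 b1 b2 pa1" "solves_b c2 c1 b2 b1 pa2"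
  shows "solves_a c1 c2 b1 b2 pa1 pa2"
proof -
  have "pa1 \<in> {pa_min c1 c2 b1 b2..pa_max c1 c2 b1 b2}" "pa2 \<in> {pa_min c2 c1 b2 b1..pa_max c2 c1 b2 b1}"
    using assms(2,3) by (auto simp: solves_b_def)
  then show ?thesis
    unfolding solves_a_def using assms(1) price_if_free[OF assms(1,2)] by simp
qed

text \<open>For \<open>c1 = 0\<close> the price \<open>p\<close> cannot be recovered from
  \<open>pa\<close>. But \<open>pa\<close> is the only point of its range and
  \<open>solves_a_if_free\<close> excludes (b'), so \<open>structure_exists\<close> leaves (b) with
  the same \<open>pa\<close> or pure bundling.\<close>

lemma optimal_b_if_solves_b:
  assumes no_a: "\<not> (\<exists>qa1 qa2. solves_a c1 c2 b1 b2 qa1 qa2)" and sol: "solves_b c1 c2 b1 b2 pa"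
  shows "optimal_b c1 c2 b1 b2 pa"
proof (cases "c1 = 0")
  case False
  then have "0 < c1" using c_nonneg by simp
  then obtain p v L where "active c1 T b2 p v L" "p \<le> threshold c2 R b1"
    "excess c1 c2 b1 b2 p = reduction c1 v L" "pa = p - L + v / 2"
    by (rule one_sided_if_solves_b[OF _ no_a sol])
  then show ?thesis using optimal_b_one_sided(2) by blast
next
  case True
  note pa = price_if_free[OF True]
  have "\<not> (\<exists>pa2. solves_b c2 c1 b2 b1 pa2)"
    using solves_a_if_free[OF True sol] no_a by blast
  then consider pa' where "solves_b c1 c2 b1 b2 pa'" "optimal_b c1 c2 b1 b2 pa'"
    | "p_bundle c1 c2 b1 b2 \<le> threshold c1 T b2" "p_bundle c1 c2 b1 b2 \<le> threshold c2 R b1"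
    using structure_exists no_a by blast
  then show ?thesis
  proof cases
    case (1 pa')
    have "pa' = pa" using pa[OF 1(1)] pa[OF sol] by simp
    then show ?thesis using 1(2) by simp
  next
    \<comment> \<open>Bundling is a menu of type (b) with \<open>a1 = 1\<close>, as
      \<open>?p <= pa\<close>; the formulas for \<open>a1\<close> and \<open>p\<close> impose
      nothing because both denominators vanish.\<close>
    case 2
    let ?p = "p_bundle c1 c2 b1 b2"
    obtain L1 L2 g1 g2 where cert: "certificate c1 c2 b1 b2 L1 L2 1 1 g1 g2 ?p ?p ?p"
      by (rule certificate_p_bundle[OF 2])
    have "3 * ?p \<le> 3 * pa"
      using 2(1) pa[OF sol] True by (simp add: threshold_def field_simps)
    then have "?p \<le> pa" by simp
    then have "optimal_menu (valuations c1 c2 b1 b2) (menu_b c1 c2 1 pa ?p)"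
      by (intro certificate.optimal_menu_b_bundle[OF cert]) simp_all
    moreover have "params_from c1 c2 b2 pa 1 ?p"
      using pa[OF sol] True by (simp add: params_from_def)
    ultimately show ?thesis unfolding optimal_b_def by blast
  qed
qed

lemma optimal_b'_if_solves_b:
  assumes no_a: "\<not> (\<exists>qa1 qa2. solves_a c1 c2 b1 b2 qa1 qa2)" and sol: "solves_b c2 c1 b2 b1 pa"
  shows "optimal_b' c1 c2 b1 b2 pa"
proof -
  interpret swap: market c2 c1 b2 b1 by (rule market_swap) (rule market_axioms)
  have no_a': "\<not> (\<exists>qa2 qa1. solves_a c2 c1 b2 b1 qa2 qa1)"
    using no_a solves_a_swap by blast
  show ?thesis
  proof (cases "c2 = 0")
    case False
    then have "0 < c2" using c_nonneg by simp
    then obtain p v L where "active c2 R b1 p v L" "p \<le> threshold c1 T b2"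
      "excess c2 c1 b2 b1 p = reduction c2 v L" "pa = p - L + v / 2"
      by (rule swap.one_sided_if_solves_b[OF _ no_a' sol])
    then show ?thesis using optimal_b'_one_sided(2) by (metis excess_swap)
  next
    case True
    note pa = swap.price_if_free[OF True]
    have "\<not> (\<exists>pa1. solves_b c1 c2 b1 b2 pa1)"
      using swap.solves_a_if_free[OF True sol] no_a' by blast
    then consider pa' where "solves_b c2 c1 b2 b1 pa'" "optimal_b' c1 c2 b1 b2 pa'"
      | "p_bundle c1 c2 b1 b2 \<le> threshold c1 T b2" "p_bundle c1 c2 b1 b2 \<le> threshold c2 R b1"
      using structure_exists no_a by blast
    then show ?thesis
    proof cases
      case (1 pa')
      have "pa' = pa" using pa[OF 1(1)] pa[OF sol] by simp
      then show ?thesis using 1(2) by simp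
    next
      case 2
      let ?p = "p_bundle c1 c2 b1 b2"
      obtain L1 L2 g1 g2 where cert: "certificate c1 c2 b1 b2 L1 L2 1 1 g1 g2 ?p ?p ?p"
        by (rule certificate_p_bundle[OF 2])
      have "3 * ?p \<le> 3 * pa"
        using 2(2) pa[OF sol] True by (simp add: threshold_def field_simps)
      then have "?p \<le> pa" by simp
      then have "optimal_menu (valuations c1 c2 b1 b2) (menu_b' c1 c2 1 pa ?p)"
        by (intro certificate.optimal_menu_b'_bundle[OF cert]) simp_all
      moreover have "params_from c2 c1 b1 pa 1 ?p"
        using pa[OF sol] True by (simp add: params_from_def)
      ultimately show ?thesis unfolding optimal_b'_def by blast
    qed
  qed
qed

end

text \<open>The first conjunct provides a structure in every case, including \<open>c1 = 0\<close>
  or \<open>c2 = 0\<close>, where a solution of the equations in (a) need not determine one.\<close>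

theorem theorem3:
  fixes c1 c2 b1 b2 :: real
  assumes "0 \<le> c1" "0 \<le> c2" "0 < b1" "0 < b2"
    and "(c1 \<le> b1 \<and> c2 \<le> 2 * b2 * (b1 + c1) / (b1 + 3 * c1)) \<or>
         (c2 \<le> b2 \<and> c1 \<le> 2 * b1 * (b2 + c2) / (b2 + 3 * c2))"
  shows
    "((\<exists>pa1 pa2. solves_a c1 c2 b1 b2 pa1 pa2 \<and> optimal_a c1 c2 b1 b2 pa1 pa2) \<or>
      (\<exists>pa1. solves_b c1 c2 b1 b2 pa1 \<and> optimal_b c1 c2 b1 b2 pa1) \<or>
      (\<exists>pa2. solves_b c2 c1 b2 b1 pa2 \<and> optimal_b' c1 c2 b1 b2 pa2) \<or>
      optimal_c c1 c2 b1 b2) \<and>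
     (\<forall>pa1 pa2. 0 < c1 \<and> 0 < c2 \<and> solves_a c1 c2 b1 b2 pa1 pa2 \<longrightarrow>
        optimal_a c1 c2 b1 b2 pa1 pa2) \<and>
     (\<forall>pa1. \<not> (\<exists>qa1 qa2. solves_a c1 c2 b1 b2 qa1 qa2) \<and> solves_b c1 c2 b1 b2 pa1 \<longrightarrow>
        optimal_b c1 c2 b1 b2 pa1) \<and>
     (\<forall>pa2. \<not> (\<exists>qa1 qa2. solves_a c1 c2 b1 b2 qa1 qa2) \<and> solves_b c2 c1 b2 b1 pa2 \<longrightarrow>
        optimal_b' c1 c2 b1 b2 pa2) \<and>
     (\<not> (\<exists>pa1 pa2. solves_a c1 c2 b1 b2 pa1 pa2) \<and>
      \<not> (\<exists>pa1. solves_b c1 c2 b1 b2 pa1) \<and>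
      \<not> (\<exists>pa2. solves_b c2 c1 b2 b1 pa2) \<longrightarrow>
        optimal_c c1 c2 b1 b2)"
proof -
  have pos: "0 < b1 + 3 * c1" "0 < b2 + 3 * c2" using assms by simp_all
  have cond: "(c1 \<le> b1 \<and> c2 * (b1 + 3 * c1) \<le> 2 * b2 * (b1 + c1)) \<or>
      (c2 \<le> b2 \<and> c1 * (b2 + 3 * c2) \<le> 2 * b1 * (b2 + c2))"
    using assms(5) pos_le_divide_eq[OF pos(1)] pos_le_divide_eq[OF pos(2)] by blast
  interpret market c1 c2 b1 b2
    by unfold_locales (use assms(1-4) cond in blast)+
  show ?thesis
    using structure_exists optimal_c_if_bundled optimal_a_if_solves_a
      optimal_b_if_solves_b optimal_b'_if_solves_b by blast
qed

end
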